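(* (1) For $f \in \mathcal{V}_{\lambda,\ell}^\infty$, the dual local zeta functions $\Phi_\pm(\mathcal{F}f;s)$ have analytic continuations to meromorphic functions of $s$ in $\mathbb{C}$, with poles located only at $s=-k, 1-2\lambda-k$ $(k \in \mathbb{Z}_{\geq0})$. (2) The following local functional equation holds: \[ \begin{pmatrix} \Phi_{+}(\mathcal{F}f; s) \\ \Phi_{-}(\mathcal{F}f; s) \end{pmatrix} = (2\pi)^{-s} \Gamma(s) \begin{pmatrix} e^{{\pi is}/{2}} & e^{-{\pi is}/{2}} \\ e^{-{\pi is}/{2}} & e^{{\pi is}/{2}} \end{pmatrix} \begin{pmatrix} \Phi_{+}(f; 1-s) \\ \Phi_{-}(f; 1-s) \end{pmatrix}. \] (3) If $\lambda \not\in \frac12\mathbb{Z}$, then all the poles of $\Phi_\pm(\mathcal{F}f;s)$ are of order at most $1$. If $\lambda=\frac q2$ $(q\in \mathbb{Z})$, then the poles at $s=\min\{0,-(q-1)\}-k$ $(k \in \mathbb{Z}_{\geq 0})$ are of order at most $2$, and the other poles are of order at most $1$. Except for the (possible double) poles at $s=\min\{0,-(q-1)\}-k$ for $\lambda = \frac q2$, the residues are \begin{eqnarray*} \mathrm{Res}_{s=-k} \Phi_\pm(\mathcal{F}f;s) &=& \frac{(\pm1)^k(\mathcal{F}f)^{(k)}(0)}{k!}, \\ \mathrm{Res}_{s=1-2\lambda-k} \Phi_\pm(\mathcal{F}f;s) &=& (2\pi)^{2\lambda+k-1} \Gamma(1-2\lambda-k) \frac{(f_\infty)^{(k)}(0)}{k!}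 (\pm i)^{k-1} \left(e^{\pm \lambda \pi i} - i^{-\ell} e^{\mp \lambda\pi i} \right). \end{eqnarray*}
   Context: Fix $\lambda\in\mathbb{C}$ and $\ell\in\mathbb{Z}$. For a smooth $f$ on $\mathbb{R}$ put $f_\infty(x)=(\mathrm{sgn}\,x)^{\ell/2}|x|^{-2\lambda}f(-1/x)$ with $(\mathrm{sgn}\,x)^{\ell/2}=1$ for $x>0$, $i^\ell$ for $x<0$. $\mathcal{V}^\infty_{\lambda,\ell}$ is the space of $C^\infty$ functions $f$ on $\mathbb{R}$ such that $f_\infty$ extends to a $C^\infty$ function on $\mathbb{R}$. Fourier transform: for $t\ne0$, $\mathcal{F}f(t)=\left(\frac{-1}{2\pi it}\right)^m\int_{\mathbb{R}}f^{(m)}(x)\exp(2\pi ixt)\,dx$ for any integer $m\ge0$ with $\Re\lambda+m/2>1/2$ (independent of $m$; equals the usual Fourier transform $\int f(x)\exp(2\pi ixt)dx$ when $f$ is integrable). Local zeta functions $\Phi_\pm(f;s)=\int_0^\infty x^{s-1}f(\pm x)\,dx$, defined for all $\lambda$ via $\Phi_\pm(f;s)=\frac{(\mp1)^m}{s(s+1)\cdots(s+m-1)}\Phi_\pm(f^{(m)};s+m)$ and meromorphic in $s$ with simple poles at most at $s=-k,2\lambda+k$. Regularized values: $(\mathcal{F}f)^{(k)}(0)=(2\pi i)^k(\Phi_+(f;k+1)+(-1)^k\Phi_-(f;k+1))$, well-defined for $\lambda\not\in\frac{k+1}2-\frac12\mathbb{Z}_{\ge0}$. Dual local zeta functions $\Phi_\pm(\mathcal{F}f;s)=\int_0^\infty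 t^{s-1}\mathcal{F}f(\pm t)\,dt$, absolutely convergent for $\Re(s)$ sufficiently large. *)

theory Defs
  imports "HOL-Complex_Analysis.Complex_Analysis"
begin

definition nderiv :: "nat \<Rightarrow> (real \<Rightarrow> complex) \<Rightarrow> real \<Rightarrow> complex" where
  "nderiv n f = ((\<lambda>g x. vector_derivative g (at x)) ^^ n) f"

definition smooth :: "(real \<Rightarrow> complex) \<Rightarrow> bool" where
  "smooth f \<longleftrightarrow> (\<forall>n x. nderiv n f differentiable (at x))"

text \<open>Only the values at \<open>x \<noteq> 0\<close> are meaningful.\<close>
definition f_inf :: "complex \<Rightarrow> int \<Rightarrow> (real \<Rightarrow> complex) \<Rightarrow> real \<Rightarrow> complex" where
  "f_inf lam l f x =
     (if x > 0 then 1 else \<i> powi l) * complex_of_real \<bar>x\<bar> powr (- 2 * lam) * f (- 1 / x)"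

definition Vspace :: "complex \<Rightarrow> int \<Rightarrow> (real \<Rightarrow> complex) set" where
  "Vspace lam l = {f. smooth f \<and> (\<exists>g. smooth g \<and> (\<forall>x. x \<noteq> 0 \<longrightarrow> g x = f_inf lam l f x))}"

text \<open>For \<open>f \<in> Vspace lam l\<close> this is the unique smooth extension of \<open>f_inf lam l f\<close> to the real line.\<close>
definition f_inf_ext :: "complex \<Rightarrow> int \<Rightarrow> (real \<Rightarrow> complex) \<Rightarrow> real \<Rightarrow> complex" where
  "f_inf_ext lam l f = (f_inf lam l f)(0 := Lim (at 0) (f_inf lam l f))"

definition fourier_m :: "nat \<Rightarrow> (real \<Rightarrow> complex) \<Rightarrow> real \<Rightarrow> complex" where
  "fourier_m m f t =
     (- 1 / (2 * of_real pi * \<i> * of_real t)) ^ m *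
     (LINT x|lborel. nderiv m f x * exp (2 * of_real pi * \<i> * of_real x * of_real t))"

text \<open>For \<open>f \<in> Vspace lam l\<close> and \<open>t \<noteq> 0\<close>, every admissible \<open>m\<close> yields the same value; the least one is taken.
  The value at \<open>t = 0\<close> is not used.\<close>
definition fourier :: "complex \<Rightarrow> (real \<Rightarrow> complex) \<Rightarrow> real \<Rightarrow> complex" where
  "fourier lam f = fourier_m (LEAST m. Re lam + real m / 2 > 1 / 2) f"

text \<open>In the zeta functions below the sign \<open>\<plusminus>\<close> is an argument \<open>\<epsilon> \<in> {1, -1}\<close>.\<close>
definition mellin_integrand :: "real \<Rightarrow> (real \<Rightarrow> complex) \<Rightarrow> complex \<Rightarrow> real \<Rightarrow> complex" where
  "mellin_integrand \<epsilon> f s x = complex_of_real x powr (s - 1) * f (\<epsilon> * x)"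

definition mellin :: "real \<Rightarrow> (real \<Rightarrow> complex) \<Rightarrow> complex \<Rightarrow> complex" where
  "mellin \<epsilon> f s = (LINT x:{0<..}|lborel. mellin_integrand \<epsilon> f s x)"

text \<open>The integral of \<open>nderiv m f\<close> converges absolutely for \<open>- m < Re s < 2 Re lam\<close>. Meromorphic functions
  are normalised by \<open>nicely_meromorphic_on\<close> (continuous off the poles, value 0 at the poles),
  which makes the continuation unique.\<close>
definition local_zeta :: "complex \<Rightarrow> real \<Rightarrow> (real \<Rightarrow> complex) \<Rightarrow> complex \<Rightarrow> complex" where
  "local_zeta lam \<epsilon> f = (SOME G. G nicely_meromorphic_on UNIV \<and>
     (\<forall>m s. - real m < Re s \<and> Re s < 2 * Re lam \<and> s \<notin> \<int>\<^sub>\<le>\<^sub>0 \<longrightarrow>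
        G s = of_real (- \<epsilon>) ^ m / pochhammer s m * mellin \<epsilon> (nderiv m f) (s + of_nat m)))"

text \<open>The regularised value of the \<open>k\<close>-th derivative of the Fourier transform at 0.\<close>
definition fourier_deriv0 :: "complex \<Rightarrow> (real \<Rightarrow> complex) \<Rightarrow> nat \<Rightarrow> complex" where
  "fourier_deriv0 lam f k = (2 * of_real pi * \<i>) ^ k *
     (local_zeta lam 1 f (of_nat k + 1) + (- 1) ^ k * local_zeta lam (- 1) f (of_nat k + 1))"

definition dual_zeta :: "complex \<Rightarrow> real \<Rightarrow> (real \<Rightarrow> complex) \<Rightarrow> complex \<Rightarrow> complex" where
  "dual_zeta lam \<epsilon> f = (SOME G. G nicely_meromorphic_on UNIV \<and>
     (\<exists>c. \<forall>s. Re s > c \<longrightarrow>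
        set_integrable lborel {0<..} (mellin_integrand \<epsilon> (fourier lam f) s) \<and>
        G s = mellin \<epsilon> (fourier lam f) s))"

text \<open>Empty unless \<open>2 * lam\<close> is an integer.\<close>
definition double_points :: "complex \<Rightarrow> complex set" where
  "double_points lam =
     {of_int (min 0 (- (q - 1))) - of_nat k | (q :: int) (k :: nat). lam = of_int q / 2}"

end

theory Submission
  imports Defs
begin

text \<open>Three sources could produce poles of the dual zeta function: \<open>Gamma s\<close> at
  \<open>s = - k\<close>, the Taylor coefficients of \<open>g\<close> at
  \<open>s = 1 - 2 * lam - k\<close>, and those of \<open>f\<close> at \<open>s = k + 1\<close>. The
  last ones cancel between the two half-lines, so a double pole can occur only where the first two
  families meet, and that intersection is \<open>double_points\<close>. The strip for the functional
  equation is \<open>M < Re s < M + 1\<close>, where \<open>M\<close> is the order of the derivative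
  used by \<open>fourier\<close>. As \<open>2 * Re lam + M > 1\<close>, the Mellin integrals of
  \<open>nderiv M f\<close> and of its Fourier integral both converge absolutely there at the
  arguments that the equation pairs. \<open>local_zeta\<close> and \<open>dual_zeta\<close> are
  \<open>SOME\<close> choices. Nothing is read off from them directly: an explicit meromorphic
  formula with its removable singularities filled in shows that the required condition can be met,
  and the identity theorem shows that the choice is this formula.\<close>

text \<open>
  Splitting the integral at 1 and substituting \<open>1 / x\<close> in the outer part writes a local zeta function of \<open>f\<close> as
  \<open>A f s + c * A g (2 * lam - s)\<close>, where \<open>g\<close> extends \<open>f_inf\<close> and \<open>A h\<close> continues the
  integral of \<open>x powr (s - 1) * h x\<close> over the unit interval; subtracting Taylor polynomials of \<open>h\<close> at 0 shows that
  \<open>A h\<close> has simple poles with residues \<open>nderiv k h 0 / fact k\<close> at \<open>- k\<close>.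
  The functional equation is proved on one vertical strip, for a derivative of \<open>f\<close> of sufficiently high order, by
  inserting the convergence factor \<open>exp (- d * t)\<close>, exchanging integrals, evaluating a Gamma integral and letting
  \<open>d\<close> tend to 0. Elsewhere it follows by analytic continuation, and it reduces poles and residues of the dual
  zeta functions to those of \<open>Gamma\<close> and \<open>A\<close>.
\<close>

section \<open>Holomorphic parameter integrals and Mellin transforms\<close>

text \<open>Only the integrand itself has to be dominated, not its derivative: Cauchy's inequality
  on discs of radius \<open>r / 2\<close> bounds the derivative in \<open>s\<close> by
  \<open>2 * G x / r\<close>, hence also the difference quotients, and dominated convergence along
  sequences gives differentiability under the integral.\<close>

lemma holomorphic_integral_parametric:
  fixes h :: "complex \<Rightarrow> 'a \<Rightarrow> complex"
  assumes "open S"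
    and meas: "\<And>s. s \<in> S \<Longrightarrow> h s \<in> borel_measurable M"
    and holo: "\<And>x. x \<in> space M \<Longrightarrow> (\<lambda>s. h s x) holomorphic_on S"
    and dom: "\<And>s. s \<in> S \<Longrightarrow> \<exists>r>0. \<exists>G. integrable M G \<and> (\<forall>z\<in>ball s r. \<forall>x\<in>space M. z \<in> S \<longrightarrow> norm (h z x) \<le> G x)"
  shows "(\<lambda>s. \<integral>x. h s x \<partial>M) holomorphic_on S"
  unfolding holomorphic_on_open[OF \<open>open S\<close>]
proof
  fix s assume s: "s \<in> S"
  obtain r1 G where r1: "r1 > 0" "integrable M G"
    "\<And>z x. z \<in> ball s r1 \<Longrightarrow> x \<in> space M \<Longrightarrow> z \<in> S \<Longrightarrow> norm (h z x) \<le> G x"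
    using dom[OF s] by metis
  obtain r2 where r2: "r2 > 0" "cball s r2 \<subseteq> S"
    using \<open>open S\<close> s open_contains_cball by metis
  define r where "r = min (r1/2) r2"
  have r: "r > 0" "cball s r \<subseteq> S" using r1 r2 by (auto simp: r_def)
  have G: "norm (h z x) \<le> G x" if "z \<in> cball s r" "x \<in> space M" for z x
  proof -
    have "z \<in> ball s r1" using that \<open>r1 > 0\<close> by (auto simp: r_def)
    thus ?thesis using r1(3) that r by auto
  qed
  define D where "D x = deriv (\<lambda>s. h s x) s" for x
  let ?Q = "\<lambda>k x. (h (s + k) x - h s x) / k"
  have bd: "norm (?Q k x) \<le> 2 * G x / r" if k: "k \<in> ball 0 (r/2)" and x: "x \<in> space M" for k x
  proof -
    have der: "norm (deriv (\<lambda>s. h s x) z) \<le> 2 * G x / r" if z: "z \<in> ball s (r/2)" for z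
    proof -
      have sub: "cball z (r/2) \<subseteq> cball s r"
      proof
        fix w assume "w \<in> cball z (r/2)"
        then show "w \<in> cball s r" using z dist_triangle[of s w z] by (auto simp: dist_commute)
      qed
      have hol: "(\<lambda>s. h s x) holomorphic_on cball z (r/2)"
        using holo[OF x] r sub by (meson holomorphic_on_subset)
      have "norm ((deriv ^^ 1) (\<lambda>s. h s x) z) \<le> fact 1 * G x / (r/2)^1"
      proof (rule Cauchy_inequality)
        show "(\<lambda>s. h s x) holomorphic_on ball z (r/2)" using hol by (rule holomorphic_on_subset) auto
        show "continuous_on (cball z (r/2)) (\<lambda>s. h s x)" using hol by (rule holomorphic_on_imp_continuous_on)
        fix w assume "norm (z - w) = r/2"
        then have "w \<in> cball z (r/2)" by (simp add: dist_norm)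
        then show "norm (h w x) \<le> G x" using sub G x by blast
      qed (use r in auto)
      then show ?thesis by (simp add: field_simps)
    qed
    have "norm (h (s + k) x - h s x) \<le> 2 * G x / r * norm ((s + k) - s)"
    proof (rule field_differentiable_bound[of "ball s (r/2)" "\<lambda>s. h s x"])
      fix z assume z: "z \<in> ball s (r/2)"
      have "z \<in> S" using z r by (auto simp: subset_iff)
      then have "((\<lambda>s. h s x) has_field_derivative deriv (\<lambda>s. h s x) z) (at z)"
        using holo[OF x] \<open>open S\<close> holomorphic_derivI by blast
      then show "((\<lambda>s. h s x) has_field_derivative deriv (\<lambda>s. h s x) z) (at z within ball s (r/2))"
        by (rule has_field_derivative_at_within)
    qed (use der k r in \<open>auto simp: dist_norm\<close>)
    moreover have "0 \<le> G x" using G[of s x] x r norm_ge_zero[of "h s x"] by (smt (verit) centre_in_cball)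
    ultimately show ?thesis using r
      by (cases "k = 0") (auto simp: norm_divide divide_simps mult_ac)
  qed
  have int: "integrable M (h z)" if "z \<in> cball s r" for z
    using G that r by (intro Bochner_Integration.integrable_bound[OF r1(2)])
      (auto intro!: meas AE_I2 order_trans[OF _ abs_ge_self] simp: subset_iff)
  have "((\<lambda>k. ((\<integral>x. h (s + k) x \<partial>M) - (\<integral>x. h s x \<partial>M)) / k) \<longlongrightarrow> (\<integral>x. D x \<partial>M)) (at 0 within ball 0 (r/2))"
    unfolding tendsto_at_iff_sequentially
  proof (intro allI impI)
    fix X :: "nat \<Rightarrow> complex" assume X: "\<forall>i. X i \<in> ball 0 (r/2) - {0}" and lim: "X \<longlonglongrightarrow> 0"
    have in1: "s + X i \<in> cball s r" for i
      using X r by (auto simp: dist_norm intro: less_imp_le order_trans) (smt (verit) field_sum_of_halves)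
    have eq: "((\<integral>x. h (s + X i) x \<partial>M) - (\<integral>x. h s x \<partial>M)) / X i = (\<integral>x. ?Q (X i) x \<partial>M)" for i
      using int[OF in1, of i] int[of s] r by simp
    have l: "(\<lambda>i. ?Q (X i) x) \<longlonglongrightarrow> D x" if "x \<in> space M" for x
    proof -
      have "((\<lambda>s. h s x) has_field_derivative D x) (at s)"
        using holo[OF that] s \<open>open S\<close> holomorphic_derivI unfolding D_def by blast
      then have "((\<lambda>k. ?Q k x) \<longlongrightarrow> D x) (at 0)" by (simp add: DERIV_def)
      moreover have "filterlim X (at 0) sequentially"
        using X lim by (auto simp: filterlim_at)
      ultimately show ?thesis by (rule filterlim_compose)
    qed
    have m: "(\<lambda>x. ?Q (X i) x) \<in> borel_measurable M" for i
      using meas[of "s + X i"] meas[OF s] in1 r by (auto simp: subset_iff)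
    have "(\<lambda>i. \<integral>x. ?Q (X i) x \<partial>M) \<longlonglongrightarrow> (\<integral>x. D x \<partial>M)"
    proof (rule integral_dominated_convergence)
      show "D \<in> borel_measurable M" by (rule borel_measurable_LIMSEQ_metric[OF m l])
      show "integrable M (\<lambda>x. 2 * G x / r)" using r1(2) by auto
      show "AE x in M. norm (?Q (X i) x) \<le> 2 * G x / r" for i
        using bd X by (intro AE_I2) blast
    qed (use m l in auto)
    then show "((\<lambda>k. ((\<integral>x. h (s + k) x \<partial>M) - (\<integral>x. h s x \<partial>M)) / k) \<circ> X) \<longlonglongrightarrow> (\<integral>x. D x \<partial>M)"
      by (simp add: eq o_def)
  qed
  then have "((\<lambda>k. ((\<integral>x. h (s + k) x \<partial>M) - (\<integral>x. h s x \<partial>M)) / k) \<longlongrightarrow> (\<integral>x. D x \<partial>M)) (at 0)"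
    using r by (subst (asm) at_within_open) auto
  then show "\<exists>f'. ((\<lambda>s. \<integral>x. h s x \<partial>M) has_field_derivative f') (at s)"
    by (auto simp: DERIV_def)
qed

lemma of_real_powr_eq_exp_ln: "x > 0 \<Longrightarrow> complex_of_real x powr z = exp (z * of_real (ln x))"
  by (simp add: powr_def Ln_of_real)

text \<open>On the positive half-line \<open>powr\<close> is \<open>exp\<close> of a multiple of the
  real logarithm, so the branch cut of the complex power never enters.\<close>

lemma measurable_indicator_powr [measurable]:
  assumes "S \<in> sets borel" "S \<subseteq> {0<..}"
  shows "(\<lambda>x. indicator S x *\<^sub>R (complex_of_real x powr z)) \<in> borel_measurable borel"
proof -
  have "(\<lambda>x. indicator S x *\<^sub>R exp (z * complex_of_real (ln x))) \<in> borel_measurable borel"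
    using assms(1) by measurable
  also have "(\<lambda>x. indicator S x *\<^sub>R exp (z * complex_of_real (ln x))) =
      (\<lambda>x. indicator S x *\<^sub>R (complex_of_real x powr z))"
    using assms(2) by (intro ext) (auto simp: indicator_def of_real_powr_eq_exp_ln)
  finally show ?thesis .
qed

lemma set_borel_measurable_mellin:
  assumes "S \<in> sets borel" "S \<subseteq> {0<..}" "h \<in> borel_measurable borel"
  shows "set_borel_measurable lborel S (\<lambda>x. complex_of_real x powr z * h x)"
proof -
  have "(\<lambda>x. (indicator S x *\<^sub>R (complex_of_real x powr z)) * h x) \<in> borel_measurable borel"
    using measurable_indicator_powr[OF assms(1,2)] assms(3) by (rule borel_measurable_times)
  then show ?thesis by (simp add: set_borel_measurable_def mult_scaleR_left)
qed

text \<open>On a vertical strip the integrand of a Mellin transform is dominated by its values on the two edges.\<close>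

lemma powr_le_add_powr:
  fixes x a b c :: real assumes "x > 0" "a \<le> c" "c \<le> b"
  shows "x powr c \<le> x powr a + x powr b"
proof (cases "x \<le> 1")
  case True
  then have "x powr c \<le> x powr a" using assms by (intro powr_mono') auto
  then show ?thesis by (simp add: add_increasing2)
next
  case False
  then have "x powr c \<le> x powr b" using assms by (intro powr_mono) auto
  then show ?thesis by (simp add: add_increasing)
qed

context
  fixes S :: "real set" and h :: "real \<Rightarrow> complex" and a b :: real
  assumes S: "S \<in> sets borel" "S \<subseteq> {0<..}" and h: "h \<in> borel_measurable borel"
    and ia: "set_integrable lborel S (\<lambda>x. complex_of_real x powr (of_real a - 1) * h x)"
    and ib: "set_integrable lborel S (\<lambda>x. complex_of_real x powr (of_real b - 1) * h x)"
begin

private definition "G x = norm (indicator S x *\<^sub>R (complex_of_real x powr (of_real a - 1) * h x)) +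
  norm (indicator S x *\<^sub>R (complex_of_real x powr (of_real b - 1) * h x))"

private lemma G: "integrable lborel G"
  using ia ib unfolding G_def set_integrable_def by (intro Bochner_Integration.integrable_add integrable_norm)

private lemma G_bound:
  assumes "a \<le> Re s" "Re s \<le> b"
  shows "norm (indicator S x *\<^sub>R (complex_of_real x powr (s - 1) * h x)) \<le> G x"
proof (cases "x \<in> S")
  case True
  then have "x > 0" using S by auto
  then show ?thesis using True powr_le_add_powr[of x "a-1" "Re s-1" "b-1"] assms
    by (auto simp: G_def norm_mult norm_powr_real_powr distrib_right[symmetric] intro!: mult_right_mono)
qed (auto simp: G_def)

lemma holomorphic_mellin_strip:
  "(\<lambda>s. LINT x:S|lborel. complex_of_real x powr (s - 1) * h x) holomorphic_on {s. a < Re s \<and> Re s < b}"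
  unfolding set_lebesgue_integral_def
proof (rule holomorphic_integral_parametric)
  have "open ({s. a < Re s} \<inter> {s. Re s < b})"
    by (intro open_Int open_halfspace_Re_gt open_halfspace_Re_lt)
  then show "open {s. a < Re s \<and> Re s < b}" by (simp add: Collect_conj_eq)
  show "(\<lambda>x. indicat_real S x *\<^sub>R (complex_of_real x powr (s - 1) * h x)) \<in> borel_measurable lborel" for s
    using set_borel_measurable_mellin[OF S h] by (simp add: set_borel_measurable_def)
  show "(\<lambda>s. indicat_real S x *\<^sub>R (complex_of_real x powr (s - 1) * h x)) holomorphic_on {s. a < Re s \<and> Re s < b}" for x
  proof (cases "x \<in> S")
    case True
    then have "x > 0" using S by auto
    then show ?thesis using True by (simp add: of_real_powr_eq_exp_ln) (intro holomorphic_intros)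
  qed auto
  show "\<exists>r>0. \<exists>G. integrable lborel G \<and> (\<forall>z\<in>ball s r. \<forall>x\<in>space lborel. z \<in> {s. a < Re s \<and> Re s < b} \<longrightarrow>
     norm (indicat_real S x *\<^sub>R (complex_of_real x powr (z - 1) * h x)) \<le> G x)" for s
    using G G_bound by (intro exI[of _ 1] exI[of _ G] conjI) auto
qed

end

text \<open>Integrability is itself a conclusion of the fundamental theorem for nonnegative
  integrands, because the antiderivative \<open>x powr c / c\<close> has finite limits at both
  ends.\<close>

lemma set_integrable_powr_unit:
  assumes "(c::real) > 0" shows "set_integrable lborel {0<..<1} (\<lambda>x. x powr (c - 1))"
proof -
  have lim: "((\<lambda>x. x powr c / c) \<longlongrightarrow> 0) (at_right 0)"
    using assms by (auto intro!: tendsto_eq_intros simp: eventually_at_filter)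
  have lim1: "((\<lambda>x. x powr c / c) \<longlongrightarrow> 1 / c) (at_left 1)"
    using assms by (auto intro!: tendsto_eq_intros)
  have lims: "(((\<lambda>x. x powr c / c) \<circ> real_of_ereal) \<longlongrightarrow> 0) (at_right (ereal 0))"
    "(((\<lambda>x. x powr c / c) \<circ> real_of_ereal) \<longlongrightarrow> 1 / c) (at_left (ereal 1))"
    using lim lim1 by (simp_all add: ereal_tendsto_simps del: zero_ereal_def one_ereal_def)
  note FTC = interval_integral_FTC_nonneg[OF _ _ _ _ lims, of "\<lambda>x. x powr (c - 1)"]
  have *: "set_integrable lborel (einterval (ereal 0) (ereal 1)) (\<lambda>x. x powr (c - 1))"
    by (rule FTC) (use assms in \<open>auto intro!: derivative_eq_intros continuous_intros\<close>)
  from * show "set_integrable lborel {0<..<1} (\<lambda>x. x powr (c - 1))" by simp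
qed

section \<open>Smooth functions and Mellin transforms over the unit interval\<close>

lemma nderiv_0 [simp]: "nderiv 0 f = f"
  by (simp add: nderiv_def)

lemma nderiv_Suc: "nderiv (Suc n) f = (\<lambda>x. vector_derivative (nderiv n f) (at x))"
  by (simp add: nderiv_def)

lemma nderiv_nderiv: "nderiv m (nderiv n f) = nderiv (m + n) f"
  by (simp add: nderiv_def funpow_add)

lemma smooth_has_vector_derivative:
  "smooth f \<Longrightarrow> (nderiv n f has_vector_derivative nderiv (Suc n) f x) (at x)"
  by (simp add: smooth_def nderiv_Suc vector_derivative_works)

lemma smooth_has_vector_derivative':
  "smooth f \<Longrightarrow> (f has_vector_derivative nderiv (Suc 0) f x) (at x)"
  using smooth_has_vector_derivative[of f 0 x] by simp

text \<open>Meant for an explicit guess \<open>D\<close> of all derivatives at once: one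
  differentiation step then yields both the closed form and, through the next lemma,
  smoothness.\<close>

lemma nderiv_eqI:
  assumes "D 0 = f" "\<And>n x. (D n has_vector_derivative D (Suc n) x) (at x)"
  shows "nderiv n f = D n"
proof (induction n)
  case (Suc n)
  then show ?case using assms(2) by (auto simp: nderiv_Suc vector_derivative_at)
qed (use assms in auto)

lemma smoothI:
  assumes "D 0 = f" "\<And>n x. (D n has_vector_derivative D (Suc n) x) (at x)"
  shows "smooth f"
  unfolding smooth_def nderiv_eqI[of D, OF assms] using assms(2) differentiableI_vector by blast

lemma smooth_nderiv: "smooth f \<Longrightarrow> smooth (nderiv n f)"
  by (simp add: smooth_def nderiv_nderiv)

lemma smooth_isCont: "smooth f \<Longrightarrow> isCont f x"
  using smooth_has_vector_derivative'[of f x] has_vector_derivative_continuous by blast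

lemma smooth_continuous_on: "smooth f \<Longrightarrow> continuous_on S f"
  by (simp add: continuous_at_imp_continuous_on smooth_isCont)

lemma smooth_borel_measurable: "smooth f \<Longrightarrow> f \<in> borel_measurable borel"
  by (intro borel_measurable_continuous_onI smooth_continuous_on)

lemma smooth_comp_scale:
  assumes "smooth f"
  shows "smooth (\<lambda>x. f (c * x))" "nderiv n (\<lambda>x. f (c * x)) = (\<lambda>x. of_real c ^ n * nderiv n f (c * x))"
proof -
  define D where "D n x = of_real c ^ n * nderiv n f (c * x)" for n x
  have d: "(D n has_vector_derivative D (Suc n) x) (at x)" for n x
  proof -
    have "((nderiv n f \<circ> (\<lambda>x. c * x)) has_vector_derivative c *\<^sub>R nderiv (Suc n) f (c * x)) (at x)"
      by (rule vector_diff_chain_at)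
        (use smooth_has_vector_derivative[OF assms, of n "c * x"] in \<open>auto intro!: derivative_eq_intros\<close>)
    from has_vector_derivative_mult_right[OF this, of "of_real c ^ n"] show ?thesis
      by (simp add: D_def[abs_def] o_def scaleR_conv_of_real mult_ac)
  qed
  show "smooth (\<lambda>x. f (c * x))" by (rule smoothI[of D]) (use d in \<open>auto simp: D_def\<close>)
  have "nderiv n (\<lambda>x. f (c * x)) = D n" by (rule nderiv_eqI[of D]) (use d in \<open>auto simp: D_def\<close>)
  then show "nderiv n (\<lambda>x. f (c * x)) = (\<lambda>x. of_real c ^ n * nderiv n f (c * x))" by (simp add: D_def[abs_def])
qed

text \<open>The Euler operator \<open>c + x d/dx\<close>; each differentiation raises
  \<open>c\<close> by 1. It arises when the inversion relation between \<open>f\<close> and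
  \<open>g\<close> is differentiated.\<close>

lemma smooth_euler:
  fixes c :: complex
  assumes "smooth f"
  shows "smooth (\<lambda>x. c * f x + of_real x * nderiv 1 f x)"
    "nderiv n (\<lambda>x. c * f x + of_real x * nderiv 1 f x) =
      (\<lambda>x. (c + of_nat n) * nderiv n f x + of_real x * nderiv (Suc n) f x)"
proof -
  define D where "D n x = (c + of_nat n) * nderiv n f x + of_real x * nderiv (Suc n) f x" for n x
  have d: "(D n has_vector_derivative D (Suc n) x) (at x)" for n x
    unfolding D_def[abs_def]
    by (rule derivative_eq_intros smooth_has_vector_derivative[OF assms] refl | simp)+
      (simp add: algebra_simps)
  show "smooth (\<lambda>x. c * f x + of_real x * nderiv 1 f x)"
    by (rule smoothI[of D]) (use d in \<open>auto simp: D_def\<close>)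
  have "nderiv n (\<lambda>x. c * f x + of_real x * nderiv 1 f x) = D n"
    by (rule nderiv_eqI[of D]) (use d in \<open>auto simp: D_def\<close>)
  then show "nderiv n (\<lambda>x. c * f x + of_real x * nderiv 1 f x) =
      (\<lambda>x. (c + of_nat n) * nderiv n f x + of_real x * nderiv (Suc n) f x)" by (simp add: D_def[abs_def])
qed

section \<open>Taylor remainders at 0\<close>

definition taylor_rem :: "nat \<Rightarrow> (real \<Rightarrow> complex) \<Rightarrow> real \<Rightarrow> complex" where
  "taylor_rem N h x = h x - (\<Sum>k<N. nderiv k h 0 * of_real x ^ k / fact k)"

lemma taylor_rem_Suc:
  "taylor_rem N h x = taylor_rem (Suc N) h x + nderiv N h 0 / fact N * of_real x ^ N"
  by (simp add: taylor_rem_def)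

text \<open>Differentiation lowers the order by one and passes to \<open>nderiv 1 h\<close>; this
  drives both the induction for the remainder bound and the integration by parts below.\<close>

lemma taylor_rem_has_vector_derivative:
  assumes "smooth h"
  shows "(taylor_rem (Suc N) h has_vector_derivative taylor_rem N (nderiv 1 h) x) (at x)"
proof -
  have 1: "((\<lambda>x. nderiv (Suc k) h 0 * of_real x ^ Suc k / fact (Suc k)) has_vector_derivative
         nderiv k (nderiv 1 h) 0 * of_real x ^ k / fact k) (at x)" for k
  proof -
    have nz: "complex_of_nat (Suc k) \<noteq> 0" unfolding of_nat_eq_0_iff by simp
    have "((\<lambda>z. z ^ Suc k) has_field_derivative of_nat (Suc k) * of_real x ^ k) (at (complex_of_real x))"
      by (auto intro!: derivative_eq_intros simp del: of_nat_Suc power_Suc)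
    from DERIV_cmult[OF this, of "nderiv (Suc k) h 0 / fact (Suc k)"]
    have "((\<lambda>z. nderiv (Suc k) h 0 * z ^ Suc k / fact (Suc k)) has_field_derivative
         nderiv k (nderiv 1 h) 0 * of_real x ^ k / fact k) (at (complex_of_real x))"
      using nz by (simp add: nderiv_nderiv del: of_nat_Suc power_Suc)
    then show ?thesis using has_vector_derivative_real_field by blast
  qed
  have eq: "taylor_rem (Suc N) h = (\<lambda>x. h x - (h 0 + (\<Sum>k<N. nderiv (Suc k) h 0 * of_real x ^ Suc k / fact (Suc k))))"
    by (intro ext, subst taylor_rem_def, subst sum.lessThan_Suc_shift) simp
  show ?thesis unfolding eq taylor_rem_def
    by (rule derivative_eq_intros 1 smooth_has_vector_derivative'[OF assms] refl | simp)+
qed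

lemma taylor_rem_at_0: "taylor_rem (Suc N) h 0 = 0"
  by (simp add: taylor_rem_def sum.lessThan_Suc_shift del: sum.lessThan_Suc)

lemma continuous_on_taylor_rem: "smooth h \<Longrightarrow> continuous_on S (taylor_rem N h)"
  unfolding taylor_rem_def[abs_def] by (intro continuous_intros smooth_continuous_on) auto

lemma borel_measurable_taylor_rem: "smooth h \<Longrightarrow> taylor_rem N h \<in> borel_measurable borel"
  by (intro borel_measurable_continuous_onI continuous_on_taylor_rem)

text \<open>Induction over all smooth \<open>h\<close>: the remainder of order \<open>Suc N\<close>
  vanishes at 0 and its derivative is a remainder of order \<open>N\<close> of
  \<open>nderiv 1 h\<close>, so the mean value inequality gains one power of
  \<open>x\<close>.\<close>

lemma taylor_rem_bound:
  assumes "smooth h"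
  shows "\<exists>C\<ge>0. \<forall>x\<in>{0..1}. norm (taylor_rem N h x) \<le> C * x ^ N"
  using assms
proof (induction N arbitrary: h)
  case 0
  have "compact ((\<lambda>x. h x) ` {0..1})"
    using smooth_continuous_on[OF 0] by (intro compact_continuous_image) auto
  then obtain B where "\<And>x. x \<in> {0..1} \<Longrightarrow> norm (h x) \<le> B"
    using compact_imp_bounded bounded_iff by (metis imageI)
  then show ?case by (intro exI[of _ "max B 0"]) (auto simp: taylor_rem_def le_max_iff_disj)
next
  case (Suc N)
  obtain C where C: "C \<ge> 0" "\<And>x. x \<in> {0..1} \<Longrightarrow> norm (taylor_rem N (nderiv 1 h) x) \<le> C * x ^ N"
    using Suc.IH[OF smooth_nderiv[OF Suc.prems, of 1]] by auto
  have "norm (taylor_rem (Suc N) h x) \<le> C * x ^ Suc N" if x: "x \<in> {0..1}" for x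
  proof (cases "x = 0")
    case False
    then have "x > 0" using x by auto
    \<comment> \<open>On the interval from 0 to \<open>x\<close> the bound \<open>C * y ^ N\<close>
      is replaced by its value at \<open>x\<close>, so that the comparison function is
      linear.\<close>
    have "norm (taylor_rem (Suc N) h x - taylor_rem (Suc N) h 0) \<le> C * x ^ N * x - C * x ^ N * 0"
    proof (rule differentiable_bound_general[where f' = "taylor_rem N (nderiv 1 h)" and \<phi>' = "\<lambda>_. C * x ^ N"])
      show "continuous_on {0..x} (taylor_rem (Suc N) h)" by (rule continuous_on_taylor_rem[OF Suc.prems])
      show "(taylor_rem (Suc N) h has_vector_derivative taylor_rem N (nderiv 1 h) y) (at y)" for y
        by (rule taylor_rem_has_vector_derivative[OF Suc.prems])
      show "((*) (C * x ^ N) has_vector_derivative C * x ^ N) (at y)" for y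
        by (auto intro!: derivative_eq_intros)
      show "norm (taylor_rem N (nderiv 1 h) y) \<le> C * x ^ N" if "0 < y" "y < x" for y
      proof -
        have "C * y ^ N \<le> C * x ^ N" using that C by (intro mult_left_mono power_mono) auto
        then show ?thesis using C(2)[of y] that x by auto
      qed
    qed (use \<open>x > 0\<close> in \<open>auto intro!: continuous_intros\<close>)
    then show ?thesis by (simp add: taylor_rem_at_0 mult_ac)
  qed (simp add: taylor_rem_at_0)
  then show ?case using C by auto
qed

section \<open>Mellin integrals over the unit interval and their continuation\<close>

lemma set_integrable_mellin_unit:
  assumes "h \<in> borel_measurable borel" "\<And>x. x \<in> {0<..<1} \<Longrightarrow> norm (h x) \<le> C * x powr c" "Re s + c > 0"
  shows "set_integrable lborel {0<..<1} (\<lambda>x. complex_of_real x powr (s - 1) * h x)"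
proof -
  have "integrable lborel (\<lambda>x. C * (indicator {0<..<1} x *\<^sub>R (x powr (Re s + c - 1))))"
    using set_integrable_powr_unit(1)[OF assms(3)] unfolding set_integrable_def by (rule integrable_mult_right)
  then show ?thesis unfolding set_integrable_def
  proof (rule Bochner_Integration.integrable_bound)
    show "(\<lambda>x. indicat_real {0<..<1} x *\<^sub>R (complex_of_real x powr (s - 1) * h x)) \<in> borel_measurable lborel"
      using set_borel_measurable_mellin[of "{0<..<1}" h] assms by (auto simp: set_borel_measurable_def)
    have "x powr (Re s - 1) * norm (h x) \<le> \<bar>C * x powr (Re s + c - 1)\<bar>" if "x \<in> {0<..<1}" for x
    proof -
      have "x powr (Re s - 1) * norm (h x) \<le> x powr (Re s - 1) * (C * x powr c)"
        using assms(2)[OF that] by (intro mult_left_mono) auto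
      also have "\<dots> = C * x powr (Re s + c - 1)" by (simp add: powr_add[symmetric] algebra_simps)
      finally show ?thesis by linarith
    qed
    then show "AE x in lborel. norm (indicat_real {0<..<1} x *\<^sub>R (complex_of_real x powr (s - 1) * h x))
         \<le> norm (C * indicat_real {0<..<1} x *\<^sub>R x powr (Re s + c - 1))"
      by (intro AE_I2) (auto simp: indicator_def norm_mult norm_powr_real_powr)
  qed
qed

lemma holomorphic_mellin_unit:
  assumes "h \<in> borel_measurable borel" "\<And>x. x \<in> {0<..<1} \<Longrightarrow> norm (h x) \<le> C * x powr c"
  shows "(\<lambda>s. LINT x:{0<..<1}|lborel. complex_of_real x powr (s - 1) * h x) holomorphic_on {s. Re s > - c}"
proof -
  have "(\<lambda>s. LINT x:{0<..<1}|lborel. complex_of_real x powr (s - 1) * h x) analytic_on {s. Re s > - c}"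
    unfolding analytic_on_analytic_at[of _ "{s. Re s > - c}"]
  proof
    fix s assume "s \<in> {s. Re s > - c}"
    then have s: "Re s + c > 0" by auto
    \<comment> \<open>The midpoint of \<open>- c\<close> and \<open>Re s\<close>. Holomorphy is
      local, so a strip around \<open>s\<close> whose left edge still lies in the region of
      convergence is enough.\<close>
    define a where "a = (Re s - c) / 2"
    have a: "a < Re s" "a + c > 0" using s by (auto simp: a_def field_simps)
    have hol: "(\<lambda>s. LINT x:{0<..<1}|lborel. complex_of_real x powr (s - 1) * h x) holomorphic_on {z. a < Re z \<and> Re z < Re s + 1}"
      using a by (intro holomorphic_mellin_strip set_integrable_mellin_unit[OF assms]) (auto simp: assms)
    have "open ({z. a < Re z} \<inter> {z. Re z < Re s + 1})"
      by (intro open_Int open_halfspace_Re_gt open_halfspace_Re_lt)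
    then have "open {z. a < Re z \<and> Re z < Re s + 1}" by (simp add: Collect_conj_eq)
    then show "(\<lambda>s. LINT x:{0<..<1}|lborel. complex_of_real x powr (s - 1) * h x) analytic_on {s}"
      using hol a by (auto simp: analytic_at)
  qed
  then show ?thesis by (rule analytic_imp_holomorphic)
qed

lemma of_real_powr_has_vector_derivative:
  assumes "x > 0"
  shows "((\<lambda>x. complex_of_real x powr s) has_vector_derivative s * complex_of_real x powr (s - 1)) (at x)"
proof -
  have "((\<lambda>z. z powr s) has_field_derivative s * complex_of_real x powr (s - 1)) (at (complex_of_real x))"
    using assms by (intro has_field_derivative_powr) (auto simp: complex_nonpos_Reals_iff)
  then show ?thesis by (rule has_vector_derivative_real_field)
qed

text \<open>\<open>Re s + c > 0\<close> makes both integrals converge and kills the boundary term at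
  0, even when \<open>Re s\<close> is negative. The exponent \<open>(s + 1) - 1\<close> is left as
  it is to display a Mellin integral at \<open>s + 1\<close>.\<close>

lemma mellin_unit_by_parts:
  fixes h h' :: "real \<Rightarrow> complex"
  assumes h: "\<And>x. (h has_vector_derivative h' x) (at x)" and h': "continuous_on UNIV h'"
    and bd: "\<And>x. x \<in> {0<..<1} \<Longrightarrow> norm (h x) \<le> C * x powr c"
    and bd': "\<And>x. x \<in> {0<..<1} \<Longrightarrow> norm (h' x) \<le> C' * x powr (c - 1)"
    and s: "Re s + c > 0"
  shows "(LINT x:{0<..<1}|lborel. complex_of_real x powr ((s + 1) - 1) * h' x) =
    h 1 - s * (LINT x:{0<..<1}|lborel. complex_of_real x powr (s - 1) * h x)"
proof -
  have cont: "continuous_on UNIV h" using h by (auto intro: continuous_at_imp_continuous_on has_vector_derivative_continuous)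
  have i1: "set_integrable lborel {0<..<1} (\<lambda>x. complex_of_real x powr ((s + 1) - 1) * h' x)"
    using bd' s by (intro set_integrable_mellin_unit[where c = "c - 1" and C = C'] borel_measurable_continuous_onI h') auto
  have i2: "set_integrable lborel {0<..<1} (\<lambda>x. complex_of_real x powr (s - 1) * h x)"
    using bd s by (intro set_integrable_mellin_unit[where c = c and C = C] borel_measurable_continuous_onI cont) auto
  let ?F = "\<lambda>x. complex_of_real x powr s * h x"
  have F0: "(?F \<longlongrightarrow> 0) (at_right 0)"
  proof (rule Lim_null_comparison)
    have "\<forall>\<^sub>F x in at_right (0::real). x \<in> {0<..<1}" by (auto simp: eventually_at_right_field intro!: exI[of _ 1])
    then show "\<forall>\<^sub>F x in at_right 0. norm (?F x) \<le> C * x powr (Re s + c)"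
    proof eventually_elim
      case (elim x)
      have "x powr Re s * norm (h x) \<le> x powr Re s * (C * x powr c)"
        using bd[OF elim] by (intro mult_left_mono) auto
      then show ?case using elim by (simp add: norm_mult norm_powr_real_powr powr_add mult_ac)
    qed
    show "((\<lambda>x. C * x powr (Re s + c)) \<longlongrightarrow> 0) (at_right 0)"
      using s by (auto intro!: tendsto_eq_intros simp: eventually_at_filter)
  qed
  have F1: "(?F \<longlongrightarrow> h 1) (at_left 1)"
  proof -
    have "isCont ?F 1"
      using cont by (intro continuous_intros continuous_on_interior[of UNIV]) (auto simp: complex_nonpos_Reals_iff)
    then have "(?F \<longlongrightarrow> ?F 1) (at 1)" by (simp add: isCont_def)
    then show ?thesis by (auto intro: tendsto_within_subset)
  qed
  have lims: "((?F \<circ> real_of_ereal) \<longlongrightarrow> 0) (at_right (ereal 0))" "((?F \<circ> real_of_ereal) \<longlongrightarrow> h 1) (at_left (ereal 1))"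
    using F0 F1 by (simp_all add: ereal_tendsto_simps del: zero_ereal_def one_ereal_def)
  let ?d = "\<lambda>x. complex_of_real x powr ((s + 1) - 1) * h' x + s * (complex_of_real x powr (s - 1) * h x)"
  have ii: "set_integrable lborel {0<..<1} ?d"
    using i1 i2 by (intro set_integral_add set_integrable_mult_right) auto
  have "(LBINT x=ereal 0..ereal 1. ?d x) = h 1 - 0"
  proof (rule interval_integral_FTC_integrable[OF _ _ _ _ lims])
    fix x assume "ereal 0 < ereal x" "ereal x < ereal 1"
    then have x: "x > 0" by auto
    show "(?F has_vector_derivative ?d x) (at x)"
      by (rule derivative_eq_intros of_real_powr_has_vector_derivative h x refl | simp)+
    show "isCont ?d x"
      using cont h' x by (intro continuous_intros continuous_on_interior[of UNIV]) (auto simp: complex_nonpos_Reals_iff)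
  qed (use ii in auto)
  then have "(LINT x:{0<..<1}|lborel. ?d x) = h 1" by (simp add: interval_lebesgue_integral_def)
  moreover have "(LINT x:{0<..<1}|lborel. ?d x) = (LINT x:{0<..<1}|lborel. complex_of_real x powr ((s + 1) - 1) * h' x)
     + s * (LINT x:{0<..<1}|lborel. complex_of_real x powr (s - 1) * h x)"
    using i1 i2 by (subst set_integral_add) (auto intro!: set_integrable_mult_right)
  ultimately show ?thesis by (simp add: algebra_simps)
qed

text \<open>Integration by parts with the constant function 1, whose derivative vanishes.\<close>

lemma mellin_unit_one:
  assumes "Re s > 0"
  shows "(LINT x:{0<..<1}|lborel. complex_of_real x powr (s - 1)) = 1 / s"
proof -
  have "(LINT x:{0<..<1}|lborel. complex_of_real x powr ((s + 1) - 1) * 0) =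
    1 - s * (LINT x:{0<..<1}|lborel. complex_of_real x powr (s - 1) * 1)"
    using assms by (intro mellin_unit_by_parts[where C = 1 and C' = 0 and c = 0]) auto
  moreover have "s \<noteq> 0" using assms by auto
  ultimately show ?thesis by (simp add: field_simps)
qed

text \<open>A Taylor term contributes the integral of \<open>x powr (s + k - 1)\<close>, which is
  \<open>1 / (s + k)\<close>. So for \<open>Re s > 0\<close> this is the Mellin integral of
  \<open>h\<close>, while the remainder integral converges for all
  \<open>Re s > - N\<close>.\<close>

definition mellin_taylor :: "nat \<Rightarrow> (real \<Rightarrow> complex) \<Rightarrow> complex \<Rightarrow> complex" where
  "mellin_taylor N h s = (\<Sum>k<N. nderiv k h 0 / fact k / (s + of_nat k)) +
     (LINT x:{0<..<1}|lborel. of_real x powr (s - 1) * taylor_rem N h x)"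

text \<open>The meromorphic continuation of the integral of \<open>x powr (s - 1) * h x\<close> over the unit interval.
  At the possible poles \<open>s = 0, -1, \<dots>\<close> the value is junk.\<close>

definition mellin_unit :: "(real \<Rightarrow> complex) \<Rightarrow> complex \<Rightarrow> complex" where
  "mellin_unit h s = mellin_taylor (nat (\<lceil>- Re s\<rceil> + 1)) h s"

context
  fixes h :: "real \<Rightarrow> complex"
  assumes h: "smooth h"
begin

lemma taylor_rem_bound_powr:
  obtains C where "\<And>x. x \<in> {0<..<1} \<Longrightarrow> norm (taylor_rem N h x) \<le> C * x powr real N"
proof -
  obtain C where "\<And>x. x \<in> {0..1} \<Longrightarrow> norm (taylor_rem N h x) \<le> C * x ^ N"
    using taylor_rem_bound[OF h] by blast
  then show thesis by (intro that[of C]) (auto simp: powr_realpow)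
qed

lemma set_integrable_taylor_rem:
  assumes "Re s > - real N"
  shows "set_integrable lborel {0<..<1} (\<lambda>x. complex_of_real x powr (s - 1) * taylor_rem N h x)"
proof -
  obtain C where "\<And>x. x \<in> {0<..<1} \<Longrightarrow> norm (taylor_rem N h x) \<le> C * x powr real N"
    using taylor_rem_bound_powr by blast
  then show ?thesis
    using assms by (intro set_integrable_mellin_unit[where C = C and c = "real N"] borel_measurable_taylor_rem h) auto
qed

text \<open>One more Taylor term moves from the integral into the sum, which is legitimate as soon
  as \<open>Re (s + N) > 0\<close>.\<close>

lemma mellin_taylor_Suc:
  assumes "Re s > - real N"
  shows "mellin_taylor (Suc N) h s = mellin_taylor N h s"
proof -
  define a where "a = nderiv N h 0 / fact N"
  have eq: "of_real x powr (s - 1) * taylor_rem N h x =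
     of_real x powr (s - 1) * taylor_rem (Suc N) h x + a * (of_real x powr ((s + of_nat N) - 1))"
    if "x \<in> {0<..<1}" for x
  proof -
    have "complex_of_real x powr ((s + of_nat N) - 1) = of_real x powr (s - 1) * of_real x ^ N"
      using that by (simp add: powr_add powr_diff powr_nat')
    then show ?thesis by (subst taylor_rem_Suc) (simp add: a_def algebra_simps)
  qed
  have i2: "set_integrable lborel {0<..<1} (\<lambda>x. complex_of_real x powr ((s + of_nat N) - 1))"
    using set_integrable_mellin_unit[of "\<lambda>_. 1" 1 0 "s + of_nat N"] assms by auto
  have "(LINT x:{0<..<1}|lborel. of_real x powr (s - 1) * taylor_rem N h x) =
     (LINT x:{0<..<1}|lborel. of_real x powr (s - 1) * taylor_rem (Suc N) h x + a * (of_real x powr ((s + of_nat N) - 1)))"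
    using eq by (intro set_lebesgue_integral_cong) auto
  also have "\<dots> = (LINT x:{0<..<1}|lborel. of_real x powr (s - 1) * taylor_rem (Suc N) h x) + a * (1 / (s + of_nat N))"
    using assms i2 set_integrable_taylor_rem[of "Suc N" s]
    by (subst set_integral_add) (auto simp: mellin_unit_one)
  finally show ?thesis by (simp add: mellin_taylor_def a_def)
qed

text \<open>The truncation order in \<open>mellin_unit\<close> jumps with \<open>s\<close>; a fixed
  order on a half-plane is what makes the analytic structure visible.\<close>

lemma mellin_unit_eq:
  assumes "Re s > - real N"
  shows "mellin_unit h s = mellin_taylor N h s"
proof -
  define M where "M = nat (\<lceil>- Re s\<rceil> + 1)"
  have M: "Re s > - real M" unfolding M_def by linarith
  have step: "mellin_taylor (K + j) h s = mellin_taylor K h s" if "Re s > - real K" for K j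
    using that by (induction j) (auto simp: mellin_taylor_Suc)
  have "mellin_taylor M h s = mellin_taylor N h s"
    using step[OF M, of "N - M"] step[OF assms, of "M - N"] by (cases "N \<le> M") auto
  then show ?thesis by (simp add: mellin_unit_def M_def)
qed

lemma mellin_unit_integral:
  assumes "Re s > 0"
  shows "mellin_unit h s = (LINT x:{0<..<1}|lborel. of_real x powr (s - 1) * h x)"
  using mellin_unit_eq[of 0 s] assms by (simp add: mellin_taylor_def taylor_rem_def)

lemma mellin_unit_expansion:
  obtains H where "H holomorphic_on {s. Re s > - real N}"
    "\<And>s. Re s > - real N \<Longrightarrow> mellin_unit h s = (\<Sum>k<N. nderiv k h 0 / fact k / (s + of_nat k)) + H s"
proof -
  obtain C where "\<And>x. x \<in> {0<..<1} \<Longrightarrow> norm (taylor_rem N h x) \<le> C * x powr real N"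
    using taylor_rem_bound_powr by blast
  then have "(\<lambda>s. LINT x:{0<..<1}|lborel. of_real x powr (s - 1) * taylor_rem N h x) holomorphic_on {s. Re s > - real N}"
    by (intro holomorphic_mellin_unit borel_measurable_taylor_rem h)
  then show ?thesis using that mellin_unit_eq by (simp add: mellin_taylor_def)
qed

end

text \<open>Integration by parts, continued past the poles. The boundary value \<open>h 1\<close>
  appears in two pieces: the integral contributes the remainder at 1, and the pole terms contribute
  the Taylor polynomial at 1.\<close>

lemma mellin_unit_deriv:
  assumes h: "smooth h" and "s \<notin> \<int>\<^sub>\<le>\<^sub>0"
  shows "mellin_unit (nderiv 1 h) (s + 1) = h 1 - s * mellin_unit h s"
proof -
  define N where "N = nat (\<lceil>- Re s\<rceil> + 1)"
  have N: "Re s > - real N" unfolding N_def by linarith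
  have h1: "smooth (nderiv 1 h)" by (rule smooth_nderiv[OF h])
  obtain C where C: "\<And>x. x \<in> {0<..<1} \<Longrightarrow> norm (taylor_rem (Suc N) h x) \<le> C * x powr real (Suc N)"
    using taylor_rem_bound_powr[OF h] by blast
  obtain C' where C': "\<And>x. x \<in> {0..1} \<Longrightarrow> norm (taylor_rem N (nderiv 1 h) x) \<le> C' * x ^ N"
    using taylor_rem_bound[OF h1] by blast
  have ibp: "(LINT x:{0<..<1}|lborel. complex_of_real x powr ((s + 1) - 1) * taylor_rem N (nderiv 1 h) x) =
    taylor_rem (Suc N) h 1 - s * (LINT x:{0<..<1}|lborel. complex_of_real x powr (s - 1) * taylor_rem (Suc N) h x)"
    using C C' N by (intro mellin_unit_by_parts[where c = "real (Suc N)" and C = C and C' = C']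
        taylor_rem_has_vector_derivative[OF h] continuous_on_taylor_rem h1) (auto simp: powr_realpow)
  have nz: "s + of_nat k \<noteq> 0" for k
    using assms(2) by (metis add_eq_0_iff2 minus_of_nat_in_nonpos_Ints)
  define a where "a k = nderiv k h 0 / fact k" for k
  \<comment> \<open>This is \<open>s / (s + j) = 1 - j / (s + j)\<close> with
    \<open>j = k + 1\<close>; the factor \<open>j\<close> turns \<open>fact (Suc k)\<close> into
    \<open>fact k\<close>.\<close>
  have t: "s * (a (Suc k) / (s + of_nat (Suc k))) = a (Suc k) - nderiv k (nderiv 1 h) 0 / fact k / (s + 1 + of_nat k)" for k
  proof -
    have "complex_of_nat (Suc k) \<noteq> 0" unfolding of_nat_eq_0_iff by simp
    then show ?thesis using nz[of "Suc k"]
      by (simp add: a_def nderiv_nderiv divide_simps add_ac) (simp add: algebra_simps)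
  qed
  have "s * (\<Sum>k<Suc N. a k / (s + of_nat k)) = s * (a 0 / s) + (\<Sum>k<N. s * (a (Suc k) / (s + of_nat (Suc k))))"
    by (subst sum.lessThan_Suc_shift) (simp add: distrib_left sum_distrib_left)
  also have "\<dots> = a 0 + (\<Sum>k<N. a (Suc k)) - (\<Sum>k<N. nderiv k (nderiv 1 h) 0 / fact k / (s + 1 + of_nat k))"
    unfolding t sum_subtractf using nz[of 0] by simp
  also have "a 0 + (\<Sum>k<N. a (Suc k)) = (\<Sum>k<Suc N. a k)" by (simp only: sum.lessThan_Suc_shift)
  also have "(\<Sum>k<Suc N. a k) = h 1 - taylor_rem (Suc N) h 1" by (simp add: taylor_rem_def a_def)
  finally have sums: "s * (\<Sum>k<Suc N. a k / (s + of_nat k)) = h 1 - taylor_rem (Suc N) h 1 -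
     (\<Sum>k<N. nderiv k (nderiv 1 h) 0 / fact k / (s + 1 + of_nat k))" .
  have e1: "mellin_unit h s = mellin_taylor (Suc N) h s" using N by (intro mellin_unit_eq h) auto
  have "mellin_unit (nderiv 1 h) (s + 1) = mellin_taylor N (nderiv 1 h) (s + 1)"
    using N by (intro mellin_unit_eq h1) auto
  then show ?thesis
    unfolding e1 unfolding mellin_taylor_def ibp distrib_left sums[unfolded a_def] by simp
qed

text \<open>Multiplication by \<open>x\<close> shifts the Mellin argument by 1. The pole terms of
  both sides match one by one, so the identity also holds for the junk values at the poles.\<close>

lemma mellin_unit_euler:
  fixes c :: complex
  assumes h: "smooth h"
  shows "mellin_unit (\<lambda>x. c * h x + of_real x * nderiv 1 h x) s = c * mellin_unit h s + mellin_unit (nderiv 1 h) (s + 1)"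
proof -
  define g where "g x = c * h x + of_real x * nderiv 1 h x" for x
  have g: "smooth g" unfolding g_def[abs_def] by (rule smooth_euler[OF h])
  have g0: "nderiv k g 0 = (c + of_nat k) * nderiv k h 0" for k
    unfolding g_def[abs_def] by (subst smooth_euler(2)[OF h]) simp
  define N where "N = nat (\<lceil>- Re s\<rceil> + 1)"
  have N: "Re s > - real N" unfolding N_def by linarith
  have h1: "smooth (nderiv 1 h)" by (rule smooth_nderiv[OF h])
  have sh: "of_nat (Suc k) * nderiv (Suc k) h 0 / fact (Suc k) = nderiv k (nderiv 1 h) 0 / fact k" for k
  proof -
    have "complex_of_nat (Suc k) \<noteq> 0" unfolding of_nat_eq_0_iff by simp
    then show ?thesis by (simp add: nderiv_nderiv divide_simps del: of_nat_Suc)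
  qed
  have rem: "taylor_rem (Suc N) g x = c * taylor_rem (Suc N) h x + of_real x * taylor_rem N (nderiv 1 h) x" for x
  proof -
    have "(\<Sum>k<Suc N. nderiv k g 0 * of_real x ^ k / fact k) = c * (\<Sum>k<Suc N. nderiv k h 0 * of_real x ^ k / fact k)
       + (\<Sum>k<Suc N. of_nat k * nderiv k h 0 / fact k * of_real x ^ k)"
      unfolding g0 sum_distrib_left sum.distrib[symmetric]
      by (intro sum.cong refl) (simp add: algebra_simps add_divide_distrib)
    also have "(\<Sum>k<Suc N. of_nat k * nderiv k h 0 / fact k * of_real x ^ k) =
       (\<Sum>k<N. of_nat (Suc k) * nderiv (Suc k) h 0 / fact (Suc k) * of_real x ^ Suc k)"
      by (subst sum.lessThan_Suc_shift) (simp del: of_nat_Suc fact_Suc)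
    also have "\<dots> = of_real x * (\<Sum>k<N. nderiv k (nderiv 1 h) 0 * of_real x ^ k / fact k)"
      unfolding sh sum_distrib_left by (intro sum.cong) auto
    finally have sum: "(\<Sum>k<Suc N. nderiv k g 0 * of_real x ^ k / fact k) = c * (\<Sum>k<Suc N. nderiv k h 0 * of_real x ^ k / fact k) + \<dots>" .
    show ?thesis unfolding taylor_rem_def sum unfolding g_def by (simp add: algebra_simps del: sum.lessThan_Suc)
  qed
  have i1: "set_integrable lborel {0<..<1} (\<lambda>x. complex_of_real x powr (s - 1) * taylor_rem (Suc N) h x)"
    using N by (intro set_integrable_taylor_rem h) auto
  have i2: "set_integrable lborel {0<..<1} (\<lambda>x. complex_of_real x powr ((s + 1) - 1) * taylor_rem N (nderiv 1 h) x)"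
    using N by (intro set_integrable_taylor_rem h1) auto
  have "(LINT x:{0<..<1}|lborel. of_real x powr (s - 1) * taylor_rem (Suc N) g x) =
    (LINT x:{0<..<1}|lborel. c * (of_real x powr (s - 1) * taylor_rem (Suc N) h x) +
        of_real x powr ((s + 1) - 1) * taylor_rem N (nderiv 1 h) x)"
    by (intro set_lebesgue_integral_cong) (auto simp: rem algebra_simps powr_diff)
  also have "\<dots> = c * (LINT x:{0<..<1}|lborel. of_real x powr (s - 1) * taylor_rem (Suc N) h x) +
      (LINT x:{0<..<1}|lborel. of_real x powr ((s + 1) - 1) * taylor_rem N (nderiv 1 h) x)"
    using i1 i2 by (subst set_integral_add) auto
  finally have int: "(LINT x:{0<..<1}|lborel. of_real x powr (s - 1) * taylor_rem (Suc N) g x) = \<dots>" .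
  have "(\<Sum>k<Suc N. nderiv k g 0 / fact k / (s + of_nat k)) = c * (\<Sum>k<Suc N. nderiv k h 0 / fact k / (s + of_nat k)) +
     (\<Sum>k<Suc N. of_nat k * nderiv k h 0 / fact k / (s + of_nat k))"
    unfolding g0 sum_distrib_left sum.distrib[symmetric]
    by (intro sum.cong refl) (simp add: algebra_simps add_divide_distrib)
  also have "(\<Sum>k<Suc N. of_nat k * nderiv k h 0 / fact k / (s + of_nat k)) =
       (\<Sum>k<N. of_nat (Suc k) * nderiv (Suc k) h 0 / fact (Suc k) / (s + of_nat (Suc k)))"
    by (subst sum.lessThan_Suc_shift) (simp del: of_nat_Suc fact_Suc)
  also have "\<dots> = (\<Sum>k<N. nderiv k (nderiv 1 h) 0 / fact k / (s + 1 + of_nat k))"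
    unfolding sh by (simp add: add_ac)
  finally have sums: "(\<Sum>k<Suc N. nderiv k g 0 / fact k / (s + of_nat k)) = c * (\<Sum>k<Suc N. nderiv k h 0 / fact k / (s + of_nat k)) + \<dots>" .
  have "mellin_unit g s = mellin_taylor (Suc N) g s" using N by (intro mellin_unit_eq g) auto
  also have "\<dots> = c * mellin_taylor (Suc N) h s + mellin_taylor N (nderiv 1 h) (s + 1)"
    unfolding mellin_taylor_def int sums by (simp add: algebra_simps del: sum.lessThan_Suc)
  also have "mellin_taylor (Suc N) h s = mellin_unit h s" using N by (intro mellin_unit_eq[symmetric] h) auto
  also have "mellin_taylor N (nderiv 1 h) (s + 1) = mellin_unit (nderiv 1 h) (s + 1)"
    using N by (intro mellin_unit_eq[symmetric] h1) auto
  finally show ?thesis by (simp add: g_def[abs_def])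
qed

section \<open>Local behaviour of the continuation: analyticity, poles, meromorphy\<close>

lemma mellin_unit_expansion_at:
  assumes h: "smooth h"
  obtains N H where "H analytic_on {s}" "real N > - Re s"
    "\<forall>\<^sub>F z in nhds s. mellin_unit h z = (\<Sum>k<N. nderiv k h 0 / fact k / (z + of_nat k)) + H z"
proof -
  define N where "N = nat (\<lceil>- Re s\<rceil> + 1)"
  have N: "Re s > - real N" unfolding N_def by linarith
  obtain H where H: "H holomorphic_on {s. Re s > - real N}"
    "\<And>s. Re s > - real N \<Longrightarrow> mellin_unit h s = (\<Sum>k<N. nderiv k h 0 / fact k / (s + of_nat k)) + H s"
    using mellin_unit_expansion[OF h] by blast
  have o: "open {s. Re s > - real N}" by (rule open_halfspace_Re_gt)
  have "H analytic_on {s}" using H(1) o N by (auto simp: analytic_at)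
  moreover have "\<forall>\<^sub>F z in nhds s. z \<in> {s. Re s > - real N}"
    using o N by (intro eventually_nhds_in_open) auto
  then have "\<forall>\<^sub>F z in nhds s. mellin_unit h z = (\<Sum>k<N. nderiv k h 0 / fact k / (z + of_nat k)) + H z"
    by eventually_elim (use H(2) in auto)
  moreover have "real N > - Re s" using N by linarith
  ultimately show ?thesis using that by blast
qed

lemma mellin_unit_analytic:
  assumes "smooth h" "s \<notin> \<int>\<^sub>\<le>\<^sub>0"
  shows "mellin_unit h analytic_on {s}"
proof -
  obtain N H where H: "H analytic_on {s}" "real N > - Re s"
    "\<forall>\<^sub>F z in nhds s. mellin_unit h z = (\<Sum>k<N. nderiv k h 0 / fact k / (z + of_nat k)) + H z"
    by (rule mellin_unit_expansion_at[OF assms(1)])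
  have nz: "s + of_nat k \<noteq> 0" for k
    using assms(2) by (metis add_eq_0_iff2 minus_of_nat_in_nonpos_Ints)
  have "(\<lambda>z. (\<Sum>k<N. nderiv k h 0 / fact k / (z + of_nat k)) + H z) analytic_on {s}"
    using nz by (intro analytic_intros H) auto
  then show ?thesis using analytic_at_cong[OF H(3) refl] by blast
qed

text \<open>Only the summand of index \<open>k\<close> is singular at \<open>- k\<close>. The
  principal part is subtracted, rather than just its residue recorded, because it must later cancel
  against the one from the other half-line.\<close>

lemma mellin_unit_pole:
  assumes "smooth h"
  obtains c where "((\<lambda>s. mellin_unit h s - nderiv k h 0 / fact k / (s + of_nat k)) \<longlongrightarrow> c) (at (- of_nat k))"
proof -
  obtain N H where H: "H analytic_on {- of_nat k}" "real N > - Re (- of_nat k)"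
    "\<forall>\<^sub>F z in nhds (- of_nat k). mellin_unit h z = (\<Sum>k<N. nderiv k h 0 / fact k / (z + of_nat k)) + H z"
    by (rule mellin_unit_expansion_at[OF assms(1)])
  let ?R = "\<lambda>z. (\<Sum>j\<in>{..<N}-{k}. nderiv j h 0 / fact j / (z + of_nat j)) + H z"
  have "?R analytic_on {- of_nat k}"
    by (intro analytic_intros H) (auto simp: add_eq_0_iff2)
  then have "isCont ?R (- of_nat k)" by (rule analytic_at_imp_isCont)
  then have "(?R \<longlongrightarrow> ?R (- of_nat k)) (at (- of_nat k))" by (simp add: isCont_def)
  moreover have "\<forall>\<^sub>F z in at (- of_nat k). ?R z = mellin_unit h z - nderiv k h 0 / fact k / (z + of_nat k)"
  proof -
    have "\<forall>\<^sub>F z in at (- of_nat k). mellin_unit h z = (\<Sum>k<N. nderiv k h 0 / fact k / (z + of_nat k)) + H z"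
      using H(3) by (simp add: eventually_at_filter eventually_mono)
    then show ?thesis
    proof eventually_elim
      case (elim z)
      show ?case unfolding elim using H(2) by (subst sum.remove[of "{..<N}" k]) auto
    qed
  qed
  ultimately have "((\<lambda>s. mellin_unit h s - nderiv k h 0 / fact k / (s + of_nat k)) \<longlongrightarrow> ?R (- of_nat k)) (at (- of_nat k))"
    by (rule Lim_transform_eventually)
  then show ?thesis by (rule that)
qed

lemma mellin_unit_meromorphic:
  assumes "smooth h"
  shows "mellin_unit h meromorphic_on UNIV"
  unfolding meromorphic_on_meromorphic_at[of _ UNIV]
proof
  fix s
  obtain N H where H: "H analytic_on {s}" "real N > - Re s"
    "\<forall>\<^sub>F z in nhds s. mellin_unit h z = (\<Sum>k<N. nderiv k h 0 / fact k / (z + of_nat k)) + H z"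
    by (rule mellin_unit_expansion_at[OF assms(1)])
  have "(\<lambda>z. (\<Sum>k<N. nderiv k h 0 / fact k / (z + of_nat k)) + H z) meromorphic_on {s}"
    by (intro meromorphic_intros analytic_on_imp_meromorphic_on H)
  moreover have "\<forall>\<^sub>F z in at s. mellin_unit h z = (\<Sum>k<N. nderiv k h 0 / fact k / (z + of_nat k)) + H z"
    using H(3) by (simp add: eventually_at_filter eventually_mono)
  then have "mellin_unit h meromorphic_on {s} \<longleftrightarrow>
      (\<lambda>z. (\<Sum>k<N. nderiv k h 0 / fact k / (z + of_nat k)) + H z) meromorphic_on {s}"
    by (intro meromorphic_on_cong) auto
  ultimately show "mellin_unit h meromorphic_on {s}" by simp
qed

section \<open>Functions exchanged by inversion\<close>

text \<open>The change of variables theorem speaks of absolute integrability for Lebesgue measure;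
  \<open>meas\<close> is what allows the return to \<open>lborel\<close>.\<close>

lemma set_integral_inverse_unit:
  fixes F :: "real \<Rightarrow> complex"
  assumes meas: "set_borel_measurable lborel {1<..} F"
    and int: "set_integrable lborel {0<..<1} (\<lambda>y. (1 / y\<^sup>2) *\<^sub>R F (1 / y))"
  shows "set_integrable lborel {1<..} F"
    "(LINT x:{1<..}|lborel. F x) = (LINT y:{0<..<1}|lborel. (1 / y\<^sup>2) *\<^sub>R F (1 / y))"
proof -
  let ?G = "\<lambda>y. (1 / y\<^sup>2) *\<^sub>R F (1 / y)"
  have eq: "\<bar>- (1 / y\<^sup>2)\<bar> *\<^sub>R F (1 / y) = ?G y" for y :: real
    by simp
  have img: "(\<lambda>y. 1 / y) ` {0<..<1} = {1::real<..}"
  proof safe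
    fix x :: real assume "x > 1"
    then show "x \<in> (\<lambda>y. 1 / y) ` {0<..<1}" by (intro image_eqI[of _ _ "1 / x"]) auto
  qed auto
  have "?G absolutely_integrable_on {0<..<1}"
    using int unfolding set_integrable_def by (simp add: integrable_completion)
  then have "F absolutely_integrable_on {1<..} \<and> integral {1<..} F = integral {0<..<1} ?G"
    using has_absolute_integral_change_of_variables_real[of "{0<..<1}" "\<lambda>y. 1 / y" "\<lambda>y. - (1 / y\<^sup>2)" F "integral {0<..<1} ?G",
        unfolded img eq]
    by (fastforce intro!: derivative_eq_intros inj_onI simp: power2_eq_square)
  moreover from this meas show i: "set_integrable lborel {1<..} F"
    unfolding set_integrable_def set_borel_measurable_def by (simp add: integrable_completion)
  ultimately show "(LINT x:{1<..}|lborel. F x) = (LINT y:{0<..<1}|lborel. ?G y)"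
    using set_borel_integral_eq_integral(2)[OF i] set_borel_integral_eq_integral(2)[OF int] by simp
qed

lemma set_integral_split_at_1:
  fixes F :: "real \<Rightarrow> complex"
  assumes "set_integrable lborel {0<..<1} F" "set_integrable lborel {1<..} F"
  shows "set_integrable lborel {0<..} F"
    "(LINT x:{0<..}|lborel. F x) = (LINT x:{0<..<1}|lborel. F x) + (LINT x:{1<..}|lborel. F x)"
proof -
  have un: "set_integrable lborel ({0<..<1} \<union> {1<..}) F"
    using assms by (intro set_integrable_Un) auto
  have diff: "({0<..<1} \<union> {1<..}) - {0<..} \<union> ({0<..} - ({0<..<1} \<union> {1<..})) \<subseteq> {1::real}" by auto
  have "set_integrable lborel ({0<..<1} \<union> {1<..}) F \<longleftrightarrow> set_integrable lborel {0<..} F"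
    unfolding set_integrable_def using diff
    by (intro integrable_discrete_difference[where X = "{1}"]) (auto simp: indicator_def)
  with un show "set_integrable lborel {0<..} F" by simp
  have "(LINT x:{0<..}|lborel. F x) = (LINT x:{0<..<1} \<union> {1<..}|lborel. F x)"
    using diff by (intro set_integral_discrete_difference[where X = "{1}"]) auto
  also have "\<dots> = (LINT x:{0<..<1}|lborel. F x) + (LINT x:{1<..}|lborel. F x)"
    using assms by (intro set_integral_Un) auto
  finally show "(LINT x:{0<..}|lborel. F x) = (LINT x:{0<..<1}|lborel. F x) + (LINT x:{1<..}|lborel. F x)" .
qed

text \<open>\<open>f\<close> and \<open>g\<close> are exchanged by the inversion of weight \<open>lam\<close>, up to a constant on each half-line. Letting
  the two constants be arbitrary makes the class stable under differentiation.\<close>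

definition inversion_pair :: "complex \<Rightarrow> (real \<Rightarrow> complex) \<Rightarrow> (real \<Rightarrow> complex) \<Rightarrow> (real \<Rightarrow> complex) \<Rightarrow> bool" where
  "inversion_pair lam c f g \<longleftrightarrow> smooth f \<and> smooth g \<and>
     (\<forall>\<epsilon>\<in>{1, -1}. \<forall>x>0. f (\<epsilon> * x) = c \<epsilon> * of_real x powr (- 2 * lam) * g (- \<epsilon> * (1 / x)))"

text \<open>Differentiating \<open>x powr (- 2 * lam) * g (- \<epsilon> / x)\<close> yields
  \<open>- x powr (- 2 * lam - 1)\<close> times the Euler operator of \<open>g\<close>, taken at
  \<open>- \<epsilon> / x\<close>. The new exponent belongs to the weight
  \<open>lam + 1 / 2\<close>; the chain rule for \<open>f (\<epsilon> * x)\<close> supplies the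
  factor \<open>\<epsilon>\<close>.\<close>

lemma inversion_pair_deriv:
  assumes "inversion_pair lam c f g"
  shows "inversion_pair (lam + 1 / 2) (\<lambda>\<epsilon>. - of_real \<epsilon> * c \<epsilon>) (nderiv 1 f)
    (\<lambda>y. (2 * lam) * g y + of_real y * nderiv 1 g y)"
proof -
  have f: "smooth f" and g: "smooth g"
    and fg: "\<And>\<epsilon> x. \<epsilon> \<in> {1,-1} \<Longrightarrow> x > 0 \<Longrightarrow> f (\<epsilon> * x) = c \<epsilon> * of_real x powr (- 2 * lam) * g (- \<epsilon> * (1 / x))"
    using assms by (auto simp: inversion_pair_def)
  have "nderiv 1 f (\<epsilon> * x) = - of_real \<epsilon> * c \<epsilon> * of_real x powr (- 2 * (lam + 1 / 2)) *
          (2 * lam * g (- \<epsilon> * (1 / x)) + of_real (- \<epsilon> * (1 / x)) * nderiv 1 g (- \<epsilon> * (1 / x)))"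
    if \<epsilon>: "\<epsilon> \<in> {1,-1}" and x: "x > 0" for \<epsilon> x :: real
  proof -
    have d1: "((\<lambda>x. f (\<epsilon> * x)) has_vector_derivative of_real \<epsilon> * nderiv 1 f (\<epsilon> * x)) (at x)"
    proof -
      have "((f \<circ> (\<lambda>x. \<epsilon> * x)) has_vector_derivative \<epsilon> *\<^sub>R nderiv 1 f (\<epsilon> * x)) (at x)"
        by (rule vector_diff_chain_at)
          (use smooth_has_vector_derivative'[OF f] in \<open>auto intro!: derivative_eq_intros\<close>)
      then show ?thesis by (simp add: o_def scaleR_conv_of_real)
    qed
    have d2: "((\<lambda>x. g (- \<epsilon> * (1 / x))) has_vector_derivative of_real (\<epsilon> / x\<^sup>2) * nderiv 1 g (- \<epsilon> * (1 / x))) (at x)"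
    proof -
      have "((\<lambda>x. - \<epsilon> * (1 / x)) has_vector_derivative \<epsilon> / x\<^sup>2) (at x)"
        using x unfolding has_real_derivative_iff_has_vector_derivative[symmetric]
        by (auto intro!: derivative_eq_intros simp: power2_eq_square)
      then have "((g \<circ> (\<lambda>x. - \<epsilon> * (1 / x))) has_vector_derivative (\<epsilon> / x\<^sup>2) *\<^sub>R nderiv 1 g (- \<epsilon> * (1 / x))) (at x)"
        by (rule vector_diff_chain_at)
          (use smooth_has_vector_derivative'[OF g] in auto)
      then show ?thesis by (simp add: o_def scaleR_conv_of_real)
    qed
    have "((\<lambda>x. c \<epsilon> * of_real x powr (- 2 * lam) * g (- \<epsilon> * (1 / x))) has_vector_derivative
       c \<epsilon> * of_real x powr (- 2 * lam) * (of_real (\<epsilon> / x\<^sup>2) * nderiv 1 g (- \<epsilon> * (1 / x))) +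
       c \<epsilon> * ((- 2 * lam) * of_real x powr (- 2 * lam - 1)) * g (- \<epsilon> * (1 / x))) (at x)"
      by (intro has_vector_derivative_mult has_vector_derivative_mult_right d2 of_real_powr_has_vector_derivative x)
    then have "((\<lambda>x. f (\<epsilon> * x)) has_vector_derivative
       c \<epsilon> * of_real x powr (- 2 * lam) * (of_real (\<epsilon> / x\<^sup>2) * nderiv 1 g (- \<epsilon> * (1 / x))) +
       c \<epsilon> * ((- 2 * lam) * of_real x powr (- 2 * lam - 1)) * g (- \<epsilon> * (1 / x))) (at x)"
      by (rule has_vector_derivative_transform_within_open[of _ _ _ "{0<..}"]) (use fg[OF \<epsilon>] x in auto)
    from vector_derivative_unique_at[OF d1 this]
    have "of_real \<epsilon> * (of_real \<epsilon> * nderiv 1 f (\<epsilon> * x)) = of_real \<epsilon> * (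
       c \<epsilon> * of_real x powr (- 2 * lam) * (of_real (\<epsilon> / x\<^sup>2) * nderiv 1 g (- \<epsilon> * (1 / x))) +
       c \<epsilon> * ((- 2 * lam) * of_real x powr (- 2 * lam - 1)) * g (- \<epsilon> * (1 / x)))" by simp
    moreover have "complex_of_real \<epsilon> * (of_real \<epsilon> * y) = y" for y using \<epsilon> by auto
    ultimately have "nderiv 1 f (\<epsilon> * x) = of_real \<epsilon> * (
       c \<epsilon> * of_real x powr (- 2 * lam) * (of_real (\<epsilon> / x\<^sup>2) * nderiv 1 g (- \<epsilon> * (1 / x))) +
       c \<epsilon> * ((- 2 * lam) * of_real x powr (- 2 * lam - 1)) * g (- \<epsilon> * (1 / x)))"
      by simp
    moreover have "complex_of_real x powr (- 2 * lam) = of_real x * of_real x powr (- 2 * lam - 1)"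
      using x by (simp add: powr_diff)
    moreover have "- 2 * (lam + 1 / 2) = - 2 * lam - 1" by simp
    \<comment> \<open>The remaining algebra with the analytic terms abstracted: \<open>e\<close> is
      the sign, \<open>d\<close> the constant, \<open>X\<close> the point, \<open>P\<close> the
      power with exponent \<open>- 2 * lam - 1\<close>, and \<open>G\<close>, \<open>G1\<close> are
      \<open>g\<close> and its derivative at the inverted point.\<close>
    moreover have "e * (d * (X * P) * (e / X\<^sup>2 * G1) + d * ((- 2 * lam) * P) * G) =
        - e * d * P * (2 * lam * G + (- e * (1 / X)) * G1)" if "X \<noteq> 0" for e d X P G G1 :: complex
      using that by (simp add: field_simps power2_eq_square)
    ultimately show ?thesis using x by simp
  qed
  then show ?thesis using smooth_nderiv[OF f] smooth_euler[OF g]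
    by (auto simp: inversion_pair_def)
qed

section \<open>Local zeta functions of inversion pairs\<close>

definition zeta_pair :: "complex \<Rightarrow> (real \<Rightarrow> complex) \<Rightarrow> (real \<Rightarrow> complex) \<Rightarrow> (real \<Rightarrow> complex) \<Rightarrow> real \<Rightarrow> complex \<Rightarrow> complex" where
  "zeta_pair lam c f g \<epsilon> s =
     mellin_unit (\<lambda>x. f (\<epsilon> * x)) s + c \<epsilon> * mellin_unit (\<lambda>x. g (- \<epsilon> * x)) (2 * lam - s)"

lemma mellin_unit_cmult:
  assumes "smooth h"
  shows "mellin_unit (\<lambda>x. c * h x) s = c * mellin_unit h s"
proof -
  have s: "nderiv n (\<lambda>x. c * h x) = (\<lambda>x. c * nderiv n h x)" for n
    by (rule nderiv_eqI[of "\<lambda>n x. c * nderiv n h x"])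
      (auto intro!: has_vector_derivative_mult_right smooth_has_vector_derivative assms)
  have "taylor_rem N (\<lambda>x. c * h x) x = c * taylor_rem N h x" for N x
    by (simp add: taylor_rem_def s right_diff_distrib sum_distrib_left mult_ac)
  moreover have "of_real x powr (s - 1) * (c * z) = c * (of_real x powr (s - 1) * z)" for x z
    by simp
  ultimately show ?thesis
    unfolding mellin_unit_def mellin_taylor_def s
    by (simp only: set_integral_mult_right) (simp add: distrib_left sum_distrib_left)
qed

text \<open>The two unit-interval transforms produce the boundary values \<open>f \<epsilon>\<close>
  and \<open>c \<epsilon> * g (- \<epsilon>)\<close>, which cancel by the inversion relation at
  \<open>x = 1\<close>. In the second transform the Euler constant leaves
  \<open>2 * lam - (2 * lam - s) = s\<close>, the same factor as in the first.\<close>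

lemma zeta_pair_deriv:
  assumes p: "inversion_pair lam c f g" and \<epsilon>: "\<epsilon> \<in> {1,-1}"
    and s: "s \<notin> \<int>\<^sub>\<le>\<^sub>0" and s': "2 * lam - s \<notin> \<int>\<^sub>\<le>\<^sub>0"
  shows "zeta_pair (lam + 1 / 2) (\<lambda>\<epsilon>. - of_real \<epsilon> * c \<epsilon>) (nderiv 1 f) (\<lambda>y. (2 * lam) * g y + of_real y * nderiv 1 g y) \<epsilon> (s + 1)
     = - of_real \<epsilon> * s * zeta_pair lam c f g \<epsilon> s"
proof -
  have f: "smooth f" and g: "smooth g"
    and fg: "f \<epsilon> = c \<epsilon> * g (- \<epsilon>)"
    using p \<epsilon> unfolding inversion_pair_def by (fastforce dest: spec[of _ 1])+
  define h where "h x = f (\<epsilon> * x)" for x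
  define k where "k x = g (- \<epsilon> * x)" for x
  have h: "smooth h" unfolding h_def[abs_def] by (rule smooth_comp_scale[OF f])
  have k: "smooth k" unfolding k_def[abs_def] by (rule smooth_comp_scale[OF g])
  have h1: "nderiv 1 h = (\<lambda>x. of_real \<epsilon> * nderiv 1 f (\<epsilon> * x))"
    unfolding h_def[abs_def] by (subst smooth_comp_scale(2)[OF f]) simp
  have k1: "nderiv 1 k x = of_real (- \<epsilon>) * nderiv 1 g (- \<epsilon> * x)" for x
    unfolding k_def[abs_def] by (subst smooth_comp_scale(2)[OF g]) simp
  have ee: "complex_of_real \<epsilon> * (of_real \<epsilon> * z) = z" for z using \<epsilon> by auto
  have "nderiv 1 f (\<epsilon> * x) = of_real \<epsilon> * nderiv 1 h x" for x
    unfolding h1 ee ..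
  then have "mellin_unit (\<lambda>x. nderiv 1 f (\<epsilon> * x)) (s + 1) = of_real \<epsilon> * mellin_unit (nderiv 1 h) (s + 1)"
    using mellin_unit_cmult[OF smooth_nderiv[OF h, of 1]] by simp
  also have "mellin_unit (nderiv 1 h) (s + 1) = f \<epsilon> - s * mellin_unit h s"
    using mellin_unit_deriv[OF h s] by (simp add: h_def)
  finally have 1: "mellin_unit (\<lambda>x. nderiv 1 f (\<epsilon> * x)) (s + 1) = of_real \<epsilon> * (f \<epsilon> - s * mellin_unit h s)" .
  have "(2 * lam) * g (- \<epsilon> * x) + of_real (- \<epsilon> * x) * nderiv 1 g (- \<epsilon> * x) = 2 * lam * k x + of_real x * nderiv 1 k x" for x
    unfolding k1 by (simp add: k_def)
  then have "mellin_unit (\<lambda>x. (2 * lam) * g (- \<epsilon> * x) + of_real (- \<epsilon> * x) * nderiv 1 g (- \<epsilon> * x)) (2 * lam - s) =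
     mellin_unit (\<lambda>x. 2 * lam * k x + of_real x * nderiv 1 k x) (2 * lam - s)" by simp
  also have "\<dots> = 2 * lam * mellin_unit k (2 * lam - s) + mellin_unit (nderiv 1 k) (2 * lam - s + 1)"
    by (rule mellin_unit_euler[OF k])
  also have "mellin_unit (nderiv 1 k) (2 * lam - s + 1) = g (- \<epsilon>) - (2 * lam - s) * mellin_unit k (2 * lam - s)"
    using mellin_unit_deriv[OF k s'] by (simp add: k_def)
  finally have 2: "mellin_unit (\<lambda>x. (2 * lam) * g (- \<epsilon> * x) + of_real (- \<epsilon> * x) * nderiv 1 g (- \<epsilon> * x)) (2 * lam - s) =
     s * mellin_unit k (2 * lam - s) + g (- \<epsilon>)" by (simp add: algebra_simps)
  have e: "2 * (lam + 1 / 2) - (s + 1) = 2 * lam - s" by simp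
  show ?thesis unfolding zeta_pair_def e 1 2 unfolding h_def[symmetric] k_def[symmetric] fg
    by (simp add: algebra_simps)
qed

lemma nonpos_Ints_add_of_natD: "s + of_nat m \<in> \<int>\<^sub>\<le>\<^sub>0 \<Longrightarrow> (s::complex) \<in> \<int>\<^sub>\<le>\<^sub>0"
  by (metis add_diff_cancel_right' nonpos_Ints_diff_Nats of_nat_in_Nats)

text \<open>\<open>2 * lam - s\<close> does not change when \<open>lam\<close> grows by
  \<open>m / 2\<close> and \<open>s\<close> by \<open>m\<close>, so the same two exclusions serve
  for every \<open>m\<close>.\<close>

lemma inversion_pair_nderiv:
  assumes "inversion_pair lam c f g"
  obtains c' g' where "inversion_pair (lam + of_nat m / 2) c' (nderiv m f) g'"
    "\<forall>\<epsilon> s. \<epsilon> \<in> {1,-1} \<longrightarrow> s \<notin> \<int>\<^sub>\<le>\<^sub>0 \<longrightarrow> 2 * lam - s \<notin> \<int>\<^sub>\<le>\<^sub>0 \<longrightarrow>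
       zeta_pair (lam + of_nat m / 2) c' (nderiv m f) g' \<epsilon> (s + of_nat m) =
       of_real (- \<epsilon>) ^ m * pochhammer s m * zeta_pair lam c f g \<epsilon> s"
proof -
  have "\<exists>c' g'. inversion_pair (lam + of_nat m / 2) c' (nderiv m f) g' \<and>
    (\<forall>\<epsilon> s. \<epsilon> \<in> {1,-1} \<longrightarrow> s \<notin> \<int>\<^sub>\<le>\<^sub>0 \<longrightarrow> 2 * lam - s \<notin> \<int>\<^sub>\<le>\<^sub>0 \<longrightarrow>
       zeta_pair (lam + of_nat m / 2) c' (nderiv m f) g' \<epsilon> (s + of_nat m) =
       of_real (- \<epsilon>) ^ m * pochhammer s m * zeta_pair lam c f g \<epsilon> s)"
  proof (induction m)
    case 0
    show ?case by (rule exI[of _ c], rule exI[of _ g]) (use assms in auto)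
  next
    case (Suc m)
    then obtain c' g' where p: "inversion_pair (lam + of_nat m / 2) c' (nderiv m f) g'" and
      z: "\<And>\<epsilon> s. \<epsilon> \<in> {1,-1} \<Longrightarrow> s \<notin> \<int>\<^sub>\<le>\<^sub>0 \<Longrightarrow> 2 * lam - s \<notin> \<int>\<^sub>\<le>\<^sub>0 \<Longrightarrow>
       zeta_pair (lam + of_nat m / 2) c' (nderiv m f) g' \<epsilon> (s + of_nat m) =
       of_real (- \<epsilon>) ^ m * pochhammer s m * zeta_pair lam c f g \<epsilon> s"
      by blast
    have e: "lam + of_nat m / 2 + 1 / 2 = lam + of_nat (Suc m) / 2" "nderiv 1 (nderiv m f) = nderiv (Suc m) f"
      by (simp_all add: field_simps nderiv_nderiv)
    show ?case
    proof (intro exI conjI allI impI)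
      show "inversion_pair (lam + of_nat (Suc m) / 2) (\<lambda>\<epsilon>. - of_real \<epsilon> * c' \<epsilon>) (nderiv (Suc m) f)
       (\<lambda>y. 2 * (lam + of_nat m / 2) * g' y + of_real y * nderiv 1 g' y)"
        using inversion_pair_deriv[OF p, unfolded e] .
      fix \<epsilon> :: real and s assume a: "\<epsilon> \<in> {1,-1}" "s \<notin> \<int>\<^sub>\<le>\<^sub>0" "2 * lam - s \<notin> \<int>\<^sub>\<le>\<^sub>0"
      have "s + of_nat m \<notin> \<int>\<^sub>\<le>\<^sub>0" using a nonpos_Ints_add_of_natD by blast
      moreover have "2 * (lam + of_nat m / 2) - (s + of_nat m) \<notin> \<int>\<^sub>\<le>\<^sub>0" using a by (simp add: algebra_simps)
      ultimately have "zeta_pair (lam + of_nat (Suc m) / 2) (\<lambda>\<epsilon>. - of_real \<epsilon> * c' \<epsilon>) (nderiv (Suc m) f)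
       (\<lambda>y. 2 * (lam + of_nat m / 2) * g' y + of_real y * nderiv 1 g' y) \<epsilon> (s + of_nat m + 1) =
         - of_real \<epsilon> * (s + of_nat m) * zeta_pair (lam + of_nat m / 2) c' (nderiv m f) g' \<epsilon> (s + of_nat m)"
        by (rule zeta_pair_deriv[OF p a(1), of "s + of_nat m", unfolded e])
      then show "zeta_pair (lam + of_nat (Suc m) / 2) (\<lambda>\<epsilon>. - of_real \<epsilon> * c' \<epsilon>) (nderiv (Suc m) f)
       (\<lambda>y. 2 * (lam + of_nat m / 2) * g' y + of_real y * nderiv 1 g' y) \<epsilon> (s + of_nat (Suc m)) =
        of_real (- \<epsilon>) ^ Suc m * pochhammer s (Suc m) * zeta_pair lam c f g \<epsilon> s"
        using z[OF a] by (simp add: pochhammer_Suc add_ac mult_ac)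
    qed
  qed
  then show thesis by (elim exE conjE) (rule that)
qed

text \<open>\<open>Re s > 0\<close> gives convergence at 0, and \<open>Re s < 2 * Re lam\<close>
  gives it at infinity: after \<open>x = 1 / y\<close> the exponents \<open>- 2\<close>,
  \<open>- (s - 1)\<close> and \<open>2 * lam\<close> add up to that of a Mellin integral of
  \<open>g\<close> at \<open>2 * lam - s\<close>.\<close>

lemma mellin_zeta_pair:
  assumes p: "inversion_pair lam c f g" and \<epsilon>: "\<epsilon> \<in> {1,-1}" and s: "0 < Re s" "Re s < 2 * Re lam"
  shows "set_integrable lborel {0<..} (mellin_integrand \<epsilon> f s)" "mellin \<epsilon> f s = zeta_pair lam c f g \<epsilon> s"
proof -
  have f: "smooth f" and g: "smooth g"
    and fg: "\<And>x. x > 0 \<Longrightarrow> f (\<epsilon> * x) = c \<epsilon> * of_real x powr (- 2 * lam) * g (- \<epsilon> * (1 / x))"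
    using p \<epsilon> by (auto simp: inversion_pair_def)
  let ?F = "mellin_integrand \<epsilon> f s"
  let ?K = "\<lambda>y. complex_of_real y powr (2 * lam - s - 1) * g (- \<epsilon> * y)"
  have h: "smooth (\<lambda>x. f (\<epsilon> * x))" by (rule smooth_comp_scale[OF f])
  have k: "smooth (\<lambda>x. g (- \<epsilon> * x))" by (rule smooth_comp_scale[OF g])
  have i1: "set_integrable lborel {0<..<1} ?F"
    using set_integrable_taylor_rem[OF h, of 0 s] s by (simp add: mellin_integrand_def[abs_def] taylor_rem_def)
  have i2: "set_integrable lborel {0<..<1} (\<lambda>y. c \<epsilon> * ?K y)"
    using set_integrable_taylor_rem[OF k, of 0 "2 * lam - s"] s by (intro set_integrable_mult_right) (simp add: taylor_rem_def)
  have eq: "(1 / y\<^sup>2) *\<^sub>R ?F (1 / y) = c \<epsilon> * ?K y" if "y \<in> {0<..<1}" for y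
  proof -
    have y: "y > 0" using that by auto
    have A: "f (\<epsilon> * (1 / y)) = c \<epsilon> * of_real (1 / y) powr (- 2 * lam) * g (- \<epsilon> * y)"
      using fg[of "1 / y"] y by simp
    have B: "complex_of_real (1 / y) powr z = of_real y powr (- z)" for z
      using y by (simp only: of_real_powr_eq_exp_ln zero_less_divide_1_iff) (simp add: ln_div)
    have C: "complex_of_real (1 / y\<^sup>2) = of_real y powr (- 2)"
      using y powr_nat'[of "complex_of_real y" 2] by (simp add: powr_minus divide_simps)
    have "2 * lam - s - 1 = - 2 + (- (s - 1)) + (- (- 2 * lam))" by simp
    then have D: "complex_of_real y powr (2 * lam - s - 1) =
        of_real y powr (- 2) * of_real y powr (- (s - 1)) * of_real y powr (- (- 2 * lam))"
      using y by (simp only: powr_add)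
    show ?thesis
      unfolding mellin_integrand_def scaleR_conv_of_real A B C D by (simp only: mult_ac)
  qed
  have meas: "set_borel_measurable lborel {1<..} ?F"
    unfolding mellin_integrand_def[abs_def] by (intro set_borel_measurable_mellin smooth_borel_measurable h) auto
  have i3: "set_integrable lborel {0<..<1} (\<lambda>y. (1 / y\<^sup>2) *\<^sub>R ?F (1 / y))"
    using i2 by (subst set_integrable_cong[OF refl refl eq])
  have i4: "set_integrable lborel {1<..} ?F" by (rule set_integral_inverse_unit[OF meas i3])
  have e4: "(LINT x:{1<..}|lborel. ?F x) = c \<epsilon> * mellin_unit (\<lambda>x. g (- \<epsilon> * x)) (2 * lam - s)"
  proof -
    have "(LINT x:{1<..}|lborel. ?F x) = (LINT y:{0<..<1}|lborel. (1 / y\<^sup>2) *\<^sub>R ?F (1 / y))"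
      by (rule set_integral_inverse_unit[OF meas i3])
    also have "\<dots> = (LINT y:{0<..<1}|lborel. c \<epsilon> * ?K y)"
      using eq by (intro set_lebesgue_integral_cong) auto
    also have "\<dots> = c \<epsilon> * mellin_unit (\<lambda>x. g (- \<epsilon> * x)) (2 * lam - s)"
      using s by (subst mellin_unit_integral[OF k]) auto
    finally show ?thesis .
  qed
  show "set_integrable lborel {0<..} ?F" by (rule set_integral_split_at_1[OF i1 i4])
  have "mellin \<epsilon> f s = (LINT x:{0<..<1}|lborel. ?F x) + (LINT x:{1<..}|lborel. ?F x)"
    unfolding mellin_def by (rule set_integral_split_at_1[OF i1 i4])
  also have "(LINT x:{0<..<1}|lborel. ?F x) = mellin_unit (\<lambda>x. f (\<epsilon> * x)) s"
    using s by (subst mellin_unit_integral[OF h]) (auto simp: mellin_integrand_def[abs_def])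
  finally show "mellin \<epsilon> f s = zeta_pair lam c f g \<epsilon> s" by (simp add: e4 zeta_pair_def)
qed

text \<open>One function meets the defining condition of \<open>local_zeta\<close> for every
  \<open>m\<close>: the bounds on \<open>Re s\<close> place \<open>s + m\<close> in the strip of
  convergence for the weight \<open>lam + m / 2\<close>.\<close>

lemma zeta_pair_mellin_nderiv:
  assumes p: "inversion_pair lam c f g" and \<epsilon>: "\<epsilon> \<in> {1,-1}"
    and s: "- real m < Re s" "Re s < 2 * Re lam" "s \<notin> \<int>\<^sub>\<le>\<^sub>0"
  shows "zeta_pair lam c f g \<epsilon> s = of_real (- \<epsilon>) ^ m / pochhammer s m * mellin \<epsilon> (nderiv m f) (s + of_nat m)"
proof -
  obtain c' g' where p': "inversion_pair (lam + of_nat m / 2) c' (nderiv m f) g'"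
    "\<forall>\<epsilon> s. \<epsilon> \<in> {1,-1} \<longrightarrow> s \<notin> \<int>\<^sub>\<le>\<^sub>0 \<longrightarrow> 2 * lam - s \<notin> \<int>\<^sub>\<le>\<^sub>0 \<longrightarrow>
       zeta_pair (lam + of_nat m / 2) c' (nderiv m f) g' \<epsilon> (s + of_nat m) =
       of_real (- \<epsilon>) ^ m * pochhammer s m * zeta_pair lam c f g \<epsilon> s"
    by (rule inversion_pair_nderiv[OF p, where m = m])
  have "2 * lam - s \<notin> \<int>\<^sub>\<le>\<^sub>0" 
  proof
    assume "2 * lam - s \<in> \<int>\<^sub>\<le>\<^sub>0"
    then obtain n where "2 * lam - s = of_int n" "n \<le> 0" by (rule nonpos_Ints_cases)
    then have "Re (2 * lam - s) \<le> 0" by simp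
    with s show False by simp
  qed
  then have "mellin \<epsilon> (nderiv m f) (s + of_nat m) = of_real (- \<epsilon>) ^ m * pochhammer s m * zeta_pair lam c f g \<epsilon> s"
    using mellin_zeta_pair(2)[OF p'(1) \<epsilon>, of "s + of_nat m"] p'(2)[rule_format, OF \<epsilon> s(3)] s by simp
  moreover have "pochhammer s m \<noteq> 0"
    using s(3) by (auto simp: pochhammer_eq_0_iff)
  moreover have "complex_of_real (- \<epsilon>) ^ m * of_real (- \<epsilon>) ^ m = 1"
    using \<epsilon> by (auto simp: power_mult_distrib[symmetric])
  moreover have "e / P * (e * P * Z) = (e * e) * Z" if "P \<noteq> 0" for e P Z :: complex
    using that by simp
  ultimately show ?thesis by simp
qed

text \<open>The relation between \<open>g\<close> and \<open>f_inf\<close> is solved for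
  \<open>f\<close>. For \<open>\<epsilon> = 1\<close> the inverted point is negative, where
  \<open>f_inf\<close> carries the factor \<open>\<i> powi l\<close>, whence the inverse power on
  the positive half-line.\<close>

lemma inversion_pair_Vspace:
  assumes "smooth f" "smooth g" "\<And>x. x \<noteq> 0 \<Longrightarrow> g x = f_inf lam l f x"
  shows "inversion_pair lam (\<lambda>\<epsilon>. if \<epsilon> > 0 then \<i> powi (- l) else 1) f g"
proof -
  have "f (\<epsilon> * x) = (if \<epsilon> > 0 then \<i> powi (- l) else 1) * of_real x powr (- 2 * lam) * g (- \<epsilon> * (1 / x))"
    if "\<epsilon> \<in> {1,-1}" "x > 0" for \<epsilon> x :: real
  proof -
    have "complex_of_real (1 / x) powr (- 2 * lam) = of_real x powr (2 * lam)"
      using that by (simp only: of_real_powr_eq_exp_ln zero_less_divide_1_iff) (simp add: ln_div)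
    moreover have "complex_of_real x powr (- 2 * lam) * of_real x powr (2 * lam) = 1"
      using that by (simp add: powr_add[symmetric])
    ultimately show ?thesis using that assms(3)[of "- \<epsilon> * (1 / x)"]
      by (auto simp: f_inf_def power_int_minus field_simps abs_if)
  qed
  then show ?thesis using assms(1,2) by (auto simp: inversion_pair_def)
qed

section \<open>Gamma and Fourier integrals\<close>

text \<open>The indicator is part of the kernel so that Fubini's theorem can be used on the whole
  plane.\<close>

definition gamma_kernel :: "complex \<Rightarrow> complex \<Rightarrow> real \<Rightarrow> complex" where
  "gamma_kernel w z t = indicator {0<..} t *\<^sub>R (complex_of_real t powr (w - 1) * exp (- z * of_real t))"

lemma gamma_kernel_measurable [measurable]: "gamma_kernel w z \<in> borel_measurable borel"
  using set_borel_measurable_mellin[of "{0<..}" "\<lambda>t. exp (- z * of_real t)" "w - 1"]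
  by (simp add: gamma_kernel_def[abs_def] set_borel_measurable_def)

lemma norm_gamma_kernel: "norm (gamma_kernel w z t) = norm (gamma_kernel w (of_real (Re z)) t)"
  by (auto simp: gamma_kernel_def indicator_def norm_mult)

lemma integrable_gamma_kernel:
  assumes "Re w > 0" "Re z > 0"
  shows "integrable lborel (gamma_kernel w z)"
proof -
  have eq: "gamma_kernel w (of_real (Re z)) = (\<lambda>t. indicator {0<..} t *\<^sub>R (complex_of_real t powr (w - 1) / of_real (exp (Re z * t))))"
    by (intro ext) (simp add: gamma_kernel_def exp_minus divide_inverse exp_of_real[symmetric])
  have "integrable lebesgue (gamma_kernel w (of_real (Re z)))"
    using absolutely_integrable_Gamma_integral[OF assms] unfolding eq set_integrable_def .
  then have "integrable lborel (gamma_kernel w (of_real (Re z)))"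
    by (simp add: integrable_completion)
  then show ?thesis
    by (rule Bochner_Integration.integrable_bound) (auto simp: norm_gamma_kernel[symmetric])
qed

lemma integral_gamma_kernel_of_real:
  assumes "Re w > 0" "a > 0"
  shows "(LINT t|lborel. gamma_kernel w (of_real a) t) = Gamma w * of_real a powr (- w)"
proof -
  have "gamma_kernel w 1 = (\<lambda>t. if t \<in> {0<..} then complex_of_real t powr (w - 1) / of_real (exp t) else 0)"
    by (intro ext) (simp add: gamma_kernel_def indicator_def exp_minus divide_inverse exp_of_real[symmetric])
  then have "(gamma_kernel w 1 has_integral Gamma w) UNIV"
    using Gamma_integral_complex'[OF assms(1)] by (simp only: has_integral_restrict_UNIV)
  then have G: "(LINT t|lborel. gamma_kernel w 1 t) = Gamma w"
    using has_integral_integral_lborel[OF integrable_gamma_kernel[of w 1]] assms(1)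
    by (intro has_integral_unique[of "gamma_kernel w 1" _ UNIV]) auto
  have "gamma_kernel w 1 (0 + a * t) = of_real a powr (w - 1) * gamma_kernel w (of_real a) t" for t
  proof (cases "t > 0")
    case True
    then have "complex_of_real (a * t) powr (w - 1) = of_real a powr (w - 1) * of_real t powr (w - 1)"
      using assms(2) by (simp only: of_real_powr_eq_exp_ln mult_pos_pos) (simp add: ln_mult exp_add[symmetric] algebra_simps)
    then show ?thesis using True assms(2) by (simp add: gamma_kernel_def)
  next
    case False
    then have "\<not> 0 < a * t" using assms(2) by (simp add: zero_less_mult_iff)
    then show ?thesis using False by (simp add: gamma_kernel_def)
  qed
  then have "Gamma w = of_real a * (of_real a powr (w - 1) * (LINT t|lborel. gamma_kernel w (of_real a) t))"
    using lborel_integral_real_affine[of a "gamma_kernel w 1" 0] assms(2) G by (simp add: scaleR_conv_of_real)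
  also have "\<dots> = of_real a powr w * (LINT t|lborel. gamma_kernel w (of_real a) t)"
    using assms(2) by (simp add: powr_diff)
  finally show ?thesis using assms(2) by (simp add: powr_minus)
qed

text \<open>Both sides are holomorphic in \<open>z\<close> on the right half-plane and agree on the
  positive real axis by scaling; the identity theorem takes the place of a rotation of the
  contour.\<close>

lemma integral_gamma_kernel:
  assumes w: "Re w > 0" and z: "Re z > 0"
  shows "(LINT t|lborel. gamma_kernel w z t) = Gamma w * z powr (- w)"
proof -
  let ?S = "{z. Re z > 0}"
  let ?F = "\<lambda>z. (LINT t|lborel. gamma_kernel w z t) - Gamma w * z powr (- w)"
  have S: "open ?S" "connected ?S"
    by (simp_all add: open_halfspace_Re_gt convex_connected convex_halfspace_Re_gt)
  have "(\<lambda>z. LINT t|lborel. gamma_kernel w z t) holomorphic_on ?S"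
  proof (rule holomorphic_integral_parametric[OF S(1)])
    show "(\<lambda>z. gamma_kernel w z t) holomorphic_on ?S" for t
      unfolding gamma_kernel_def scaleR_conv_of_real by (intro holomorphic_intros)
    fix s assume "s \<in> ?S"
    then have s: "Re s > 0" by simp
    show "\<exists>r>0. \<exists>G. integrable lborel G \<and> (\<forall>z\<in>ball s r. \<forall>t\<in>space lborel. z \<in> ?S \<longrightarrow> norm (gamma_kernel w z t) \<le> G t)"
    proof (intro exI[of _ "Re s / 2"] exI[of _ "\<lambda>t. norm (gamma_kernel w (of_real (Re s / 2)) t)"] conjI ballI impI)
      \<comment> \<open>This radius keeps \<open>Re z\<close> at least \<open>Re s / 2\<close>, so
        the kernel with the real parameter \<open>Re s / 2\<close> dominates.\<close>
      show "integrable lborel (\<lambda>t. norm (gamma_kernel w (of_real (Re s / 2)) t))"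
        using w s by (intro integrable_norm integrable_gamma_kernel) auto
      fix z t assume "z \<in> ball s (Re s / 2)"
      then have "\<bar>Re s - Re z\<bar> < Re s / 2"
        using abs_Re_le_cmod[of "s - z"] by (auto simp: dist_norm)
      then have rz: "Re s / 2 \<le> Re z" by linarith
      show "norm (gamma_kernel w z t) \<le> norm (gamma_kernel w (of_real (Re s / 2)) t)"
      proof (cases "t > 0")
        case True
        then have "- (Re z * t) \<le> - (Re s / 2 * t)" using mult_right_mono[OF rz, of t] by simp
        then show ?thesis using True by (auto simp: gamma_kernel_def norm_mult intro!: mult_left_mono)
      qed (auto simp: gamma_kernel_def)
    qed (use s in auto)
  qed auto
  moreover have "(\<lambda>z. Gamma w * z powr (- w)) holomorphic_on ?S"
    by (intro holomorphic_intros) (auto simp: complex_nonpos_Reals_iff)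
  ultimately have hol: "?F holomorphic_on ?S" by (rule holomorphic_on_diff)
  have "1 islimpt complex_of_real ` {0<..}"
    unfolding islimpt_approachable
  proof (intro allI impI)
    fix e :: real assume "e > 0"
    have "dist (complex_of_real (1 + e / 2)) (of_real 1) = \<bar>1 + e / 2 - 1\<bar>"
      by (simp only: dist_of_real dist_real_def)
    with \<open>e > 0\<close> have "dist (complex_of_real (1 + e / 2)) 1 = e / 2" by (simp only: of_real_1)
    moreover have "complex_of_real (1 + e / 2) \<in> of_real ` {0<..}" using \<open>e > 0\<close> by (intro imageI) auto
    ultimately show "\<exists>x'\<in>complex_of_real ` {0<..}. x' \<noteq> 1 \<and> dist x' 1 < e"
      using \<open>e > 0\<close> by (intro bexI[of _ "complex_of_real (1 + e / 2)"]) auto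
  qed
  moreover have "?F u = 0" if "u \<in> complex_of_real ` {0<..}" for u
    using that integral_gamma_kernel_of_real[OF w] by force
  ultimately have "?F z = 0"
    using analytic_continuation[OF hol S, of "complex_of_real ` {0<..}" 1 z] z by fastforce
  then show ?thesis by simp
qed

section \<open>Fourier integrals and their Mellin transforms\<close>

lemma integrable_halves:
  fixes F :: "real \<Rightarrow> complex"
  assumes "set_integrable lborel {0<..} F" "set_integrable lborel {0<..} (\<lambda>x. F (- x))"
  shows "integrable lborel F"
    "(LINT x|lborel. F x) = (LINT x:{0<..}|lborel. F x) + (LINT x:{0<..}|lborel. F (- x))"
proof -
  let ?n = "\<lambda>x. indicator {..<0} x *\<^sub>R F x"
  have e: "?n (0 + (-1) * x) = indicator {0<..} x *\<^sub>R F (- x)" for x by (auto simp: indicator_def)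
  have n: "integrable lborel ?n"
    using assms(2) lborel_integrable_real_affine_iff[of "-1" ?n 0] unfolding e set_integrable_def by simp
  have n': "(LINT x|lborel. ?n x) = (LINT x:{0<..}|lborel. F (- x))"
    using lborel_integral_real_affine[of "-1" ?n 0] unfolding e set_lebesgue_integral_def by simp
  have p: "integrable lborel (\<lambda>x. indicator {0<..} x *\<^sub>R F x)" using assms(1) by (simp add: set_integrable_def)
  have i: "integrable lborel (\<lambda>x. indicator {0<..} x *\<^sub>R F x + ?n x)"
    using p n by (rule Bochner_Integration.integrable_add)
  have "integrable lborel F \<longleftrightarrow> integrable lborel (\<lambda>x. indicator {0<..} x *\<^sub>R F x + ?n x)"
    by (rule integrable_discrete_difference[where X = "{0}"]) (auto simp: indicator_def)
  with i show "integrable lborel F" by simp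
  have "(LINT x|lborel. F x) = (LINT x|lborel. indicator {0<..} x *\<^sub>R F x + ?n x)"
    by (rule integral_discrete_difference[where X = "{0}"]) (auto simp: indicator_def)
  also have "\<dots> = (LINT x:{0<..}|lborel. F x) + (LINT x:{0<..}|lborel. F (- x))"
    using p n n' by (simp add: set_lebesgue_integral_def)
  finally show "(LINT x|lborel. F x) = (LINT x:{0<..}|lborel. F x) + (LINT x:{0<..}|lborel. F (- x))" .
qed

text \<open>Up to a power of \<open>t\<close>, \<open>fourier_m m f\<close> is this transform of
  \<open>nderiv m f\<close>; the analysis below can thus stay with integrable functions.\<close>

definition fourier_int :: "(real \<Rightarrow> complex) \<Rightarrow> real \<Rightarrow> complex" where
  "fourier_int g t = (LINT x|lborel. g x * exp (2 * of_real pi * \<i> * of_real x * of_real t))"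

lemma norm_fourier_kernel [simp]: "norm (exp (2 * of_real pi * \<i> * of_real x * of_real t)) = 1"
  by simp

lemma integrable_fourier_kernel:
  assumes g: "integrable lborel g"
  shows "integrable lborel (\<lambda>x. g x * exp (2 * of_real pi * \<i> * of_real x * of_real t))"
proof -
  have [measurable]: "g \<in> borel_measurable borel" using g by auto
  show ?thesis
    by (rule Bochner_Integration.integrable_bound[OF g]) (measurable, simp only: norm_mult norm_fourier_kernel, simp)
qed

lemma fourier_int_measurable [measurable]:
  assumes [measurable]: "g \<in> borel_measurable borel"
  shows "fourier_int g \<in> borel_measurable borel"
  unfolding fourier_int_def[abs_def] by measurable

lemma norm_fourier_int_le: "norm (fourier_int g t) \<le> (LINT x|lborel. norm (g x))"
proof -
  have "norm (fourier_int g t) \<le> (LINT x|lborel. norm (g x * exp (2 * of_real pi * \<i> * of_real x * of_real t)))"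
    unfolding fourier_int_def by (rule integral_norm_bound)
  then show ?thesis by (simp add: norm_mult)
qed

text \<open>With the factor \<open>exp (- d * t)\<close> the modulus of the double integrand is a
  product of integrable functions of \<open>t\<close> and \<open>x\<close>, so Fubini applies. The
  Fourier kernel is then absorbed into a Gamma integral with parameter
  \<open>d - 2 * pi * \<i> * \<epsilon> * x\<close> in the right half-plane.\<close>

lemma gamma_kernel_fourier_int:
  assumes g: "integrable lborel g" and w: "Re w > 0" and d: "d > 0"
  shows "(LINT t|lborel. gamma_kernel w (of_real d) t * fourier_int g (\<epsilon> * t)) =
    Gamma w * (LINT x|lborel. g x * (of_real d - 2 * of_real pi * \<i> * of_real (\<epsilon> * x)) powr (- w))"
proof -
  have [measurable]: "g \<in> borel_measurable borel" using g by auto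
  let ?f = "\<lambda>(t, x). gamma_kernel w (of_real d) t * (g x * exp (2 * of_real pi * \<i> * of_real x * of_real (\<epsilon> * t)))"
  have "integrable (lborel \<Otimes>\<^sub>M lborel) ?f"
  proof (rule lborel_pair.Fubini_integrable)
    have "(LINT x|lborel. norm (?f (t, x))) = norm (gamma_kernel w (of_real d) t) * (LINT x|lborel. norm (g x))" for t
      by (simp add: norm_mult)
    then show "integrable lborel (\<lambda>t. LINT x|lborel. norm (?f (t, x)))"
      using integrable_gamma_kernel[of w "of_real d"] w d by simp
    show "AE t in lborel. integrable lborel (\<lambda>x. ?f (t, x))"
    proof (rule AE_I2)
      fix t
      have "integrable lborel (\<lambda>x. g x * exp (2 * of_real pi * \<i> * of_real x * of_real (\<epsilon> * t)))"
        by (rule integrable_fourier_kernel[OF g])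
      then show "integrable lborel (\<lambda>x. ?f (t, x))" by simp
    qed
    show "?f \<in> borel_measurable (lborel \<Otimes>\<^sub>M lborel)" by measurable
  qed
  then have F: "(LINT x|lborel. LINT t|lborel. ?f (t, x)) = (LINT t|lborel. LINT x|lborel. ?f (t, x))"
    using lborel_pair.Fubini_integral[of "\<lambda>t x. ?f (t, x)"] by simp
  have A: "(LINT x|lborel. ?f (t, x)) = gamma_kernel w (of_real d) t * fourier_int g (\<epsilon> * t)" for t
    by (simp add: fourier_int_def)
  have B: "(LINT t|lborel. ?f (t, x)) = Gamma w * (g x * (of_real d - 2 * of_real pi * \<i> * of_real (\<epsilon> * x)) powr (- w))" for x
  proof -
    have "?f (t, x) = g x * gamma_kernel w (of_real d - 2 * of_real pi * \<i> * of_real (\<epsilon> * x)) t" for t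
      by (simp add: gamma_kernel_def mult_exp_exp scaleR_conv_of_real algebra_simps)
    then have "(LINT t|lborel. ?f (t, x)) = g x * (LINT t|lborel. gamma_kernel w (of_real d - 2 * of_real pi * \<i> * of_real (\<epsilon> * x)) t)"
      by (simp only: integral_mult_right_zero)
    then show ?thesis
      using integral_gamma_kernel[OF w, of "of_real d - 2 * of_real pi * \<i> * of_real (\<epsilon> * x)"] d by simp
  qed
  show ?thesis using F unfolding A B by simp
qed

text \<open>The argument of \<open>z\<close> contributes \<open>exp (Im w * Arg z)\<close>, at most
  \<open>exp (pi * \<bar>Im w\<bar>)\<close>. The bound depends on \<open>z\<close> only through a
  lower bound for its modulus, as the limit \<open>d\<close> to 0 requires.\<close>

lemma norm_powr_minus_le:
  assumes "norm u \<le> norm z" "u \<noteq> 0" "Re w > 0"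
  shows "norm (z powr (- w)) \<le> norm u powr (- Re w) * exp (pi * \<bar>Im w\<bar>)"
proof -
  have "Im w * Arg z \<le> pi * \<bar>Im w\<bar>"
  proof -
    have "\<bar>Arg z\<bar> \<le> pi" using Arg_bounded[of z] by auto
    then have "\<bar>Im w\<bar> * \<bar>Arg z\<bar> \<le> \<bar>Im w\<bar> * pi" by (intro mult_left_mono) auto
    moreover have "Im w * Arg z \<le> \<bar>Im w\<bar> * \<bar>Arg z\<bar>" by (metis abs_ge_self abs_mult)
    ultimately show ?thesis by (simp add: mult.commute)
  qed
  moreover have "norm z powr (- Re w) \<le> norm u powr (- Re w)"
    using assms by (intro powr_mono2') auto
  ultimately show ?thesis by (auto simp: norm_powr_complex intro!: mult_mono)
qed

text \<open>A positive factor only adds its real logarithm to \<open>Ln\<close>, and the principal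
  logarithm of \<open>- \<sigma> * \<i>\<close> is \<open>- \<sigma> * pi * \<i> / 2\<close>. This
  is where the exponential factors of the functional equation come from.\<close>

lemma imaginary_powr:
  assumes "x > 0" "\<sigma> \<in> {1, -1}"
  shows "(- 2 * of_real pi * \<i> * of_real (\<sigma> * x)) powr (- w) =
     of_real (2 * pi) powr (- w) * exp (of_real \<sigma> * of_real pi * \<i> * w / 2) * of_real x powr (- w)"
proof -
  have x: "2 * pi * x > 0" using assms by simp
  define u where "u = (if \<sigma> = 1 then - \<i> else \<i>)"
  have u: "u \<noteq> 0" "Ln u = - of_real \<sigma> * of_real pi * \<i> / 2" using assms(2) by (auto simp: u_def)
  have e: "- 2 * of_real pi * \<i> * of_real (\<sigma> * x) = of_real (2 * pi * x) * u"
    using assms(2) by (auto simp: u_def mult_ac)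
  have L: "Ln (of_real (2 * pi * x) * u) = of_real (ln (2 * pi * x)) + Ln u"
    using Ln_times_of_real[OF x u(1)] Ln_of_real[OF x] by simp
  have l: "complex_of_real (ln (2 * pi * x)) = of_real (ln (2 * pi)) + of_real (ln x)"
    using assms by (simp add: ln_mult)
  have nz: "of_real (2 * pi * x) * u \<noteq> 0" using x u(1) by auto
  have "(- 2 * of_real pi * \<i> * of_real (\<sigma> * x)) powr (- w) = exp (- w * (of_real (ln (2 * pi)) + of_real (ln x) + Ln u))"
    unfolding e powr_def L l using nz by (simp only: if_False)
  moreover have "2 * pi > 0" by simp
  ultimately show ?thesis unfolding of_real_powr_eq_exp_ln[OF assms(1)] of_real_powr_eq_exp_ln[OF \<open>2 * pi > 0\<close>] u(2)
    by (simp add: exp_add[symmetric] algebra_simps)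
qed

text \<open>The Mellin transform of the additive character converges only conditionally, hence the detour through the
  regularised kernel with factor \<open>exp (- d * t)\<close> and \<open>d \<rightarrow> 0\<close>.\<close>

lemma mellin_fourier_int:
  assumes \<epsilon>: "\<epsilon> \<in> {1,-1}" and w: "Re w > 0" and g: "integrable lborel g"
    and gp: "\<And>\<eta>. \<eta> \<in> {1,-1} \<Longrightarrow> set_integrable lborel {0<..} (mellin_integrand \<eta> g (1 - w))"
    and gh: "set_integrable lborel {0<..} (mellin_integrand \<epsilon> (fourier_int g) w)"
  shows "mellin \<epsilon> (fourier_int g) w = of_real (2 * pi) powr (- w) * Gamma w *
    (exp (of_real \<epsilon> * of_real pi * \<i> * w / 2) * mellin 1 g (1 - w) +
     exp (- of_real \<epsilon> * of_real pi * \<i> * w / 2) * mellin (-1) g (1 - w))"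
proof -
  have [measurable]: "g \<in> borel_measurable borel" using g by auto
  define d where "d n = inverse (real (Suc n))" for n
  have d0: "d n > 0" for n by (simp add: d_def)
  have dlim: "d \<longlonglongrightarrow> 0" unfolding d_def by (rule LIMSEQ_inverse_real_of_nat)
  let ?I = "\<lambda>t. indicator {0<..} t *\<^sub>R mellin_integrand \<epsilon> (fourier_int g) w t"
  let ?R = "\<lambda>n x. g x * (of_real (d n) - 2 * of_real pi * \<i> * of_real (\<epsilon> * x)) powr (- w)"
  let ?Q = "\<lambda>x. g x * (- 2 * of_real pi * \<i> * of_real (\<epsilon> * x)) powr (- w)"
  have k: "gamma_kernel w (of_real (d n)) t * fourier_int g (\<epsilon> * t) = ?I t * exp (- of_real (d n * t))" for n t
    by (simp add: gamma_kernel_def mellin_integrand_def)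
  \<comment> \<open>The convergence factor has modulus at most 1 for \<open>t > 0\<close>, so the
    absolutely convergent limit integrand dominates.\<close>
  have left: "(\<lambda>n. LINT t|lborel. gamma_kernel w (of_real (d n)) t * fourier_int g (\<epsilon> * t)) \<longlonglongrightarrow> mellin \<epsilon> (fourier_int g) w"
    unfolding mellin_def set_lebesgue_integral_def
  proof (rule integral_dominated_convergence)
    show "integrable lborel (\<lambda>t. norm (?I t))" using gh unfolding set_integrable_def by (rule integrable_norm)
    show "?I \<in> borel_measurable lborel" using gh unfolding set_integrable_def by auto
    show "(\<lambda>t. gamma_kernel w (of_real (d n)) t * fourier_int g (\<epsilon> * t)) \<in> borel_measurable lborel" for n
      by measurable
    show "AE t in lborel. (\<lambda>n. gamma_kernel w (of_real (d n)) t * fourier_int g (\<epsilon> * t)) \<longlonglongrightarrow> ?I t"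
    proof (rule AE_I2)
      fix t
      have "(\<lambda>n. ?I t * exp (- of_real (d n * t))) \<longlonglongrightarrow> ?I t * exp (- of_real (0 * t))"
        by (intro tendsto_intros dlim)
      then show "(\<lambda>n. gamma_kernel w (of_real (d n)) t * fourier_int g (\<epsilon> * t)) \<longlonglongrightarrow> ?I t"
        unfolding k by simp
    qed
    show "AE t in lborel. norm (gamma_kernel w (of_real (d n)) t * fourier_int g (\<epsilon> * t)) \<le> norm (?I t)" for n
    proof (rule AE_I2)
      fix t
      show "norm (gamma_kernel w (of_real (d n)) t * fourier_int g (\<epsilon> * t)) \<le> norm (?I t)"
      proof (cases "t > 0")
        case True
        have "norm (exp (- complex_of_real (d n * t))) \<le> 1" using True d0[of n] by simp
        then show ?thesis unfolding k norm_mult by (intro mult_left_le) auto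
      qed (simp add: gamma_kernel_def)
    qed
  qed
  have int0: "set_integrable lborel {0<..} (\<lambda>x. ?Q (\<eta> * x))"
    "(LINT x:{0<..}|lborel. ?Q (\<eta> * x)) =
       of_real (2 * pi) powr (- w) * exp (of_real (\<epsilon> * \<eta>) * of_real pi * \<i> * w / 2) * mellin \<eta> g (1 - w)"
    if \<eta>: "\<eta> \<in> {1,-1}" for \<eta>
  proof -
    let ?c = "of_real (2 * pi) powr (- w) * exp (of_real (\<epsilon> * \<eta>) * of_real pi * \<i> * w / 2)"
    have "\<epsilon> * \<eta> \<in> {1,-1}" using \<epsilon> \<eta> by auto
    then have eq: "?Q (\<eta> * x) = ?c * mellin_integrand \<eta> g (1 - w) x" if "x \<in> {0<..}" for x
      using imaginary_powr[of x "\<epsilon> * \<eta>" w] that by (simp add: mellin_integrand_def mult_ac)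
    have "set_integrable lborel {0<..} (\<lambda>x. ?c * mellin_integrand \<eta> g (1 - w) x)"
      using gp[OF \<eta>] by (intro set_integrable_mult_right) auto
    then show "set_integrable lborel {0<..} (\<lambda>x. ?Q (\<eta> * x))"
      by (subst set_integrable_cong[OF refl refl eq])
    have "(LINT x:{0<..}|lborel. ?Q (\<eta> * x)) = (LINT x:{0<..}|lborel. ?c * mellin_integrand \<eta> g (1 - w) x)"
      using eq by (intro set_lebesgue_integral_cong) auto
    then show "(LINT x:{0<..}|lborel. ?Q (\<eta> * x)) = ?c * mellin \<eta> g (1 - w)"
      by (simp add: mellin_def)
  qed
  have R0: "integrable lborel ?Q"
    "(LINT x|lborel. ?Q x) = (LINT x:{0<..}|lborel. ?Q x) + (LINT x:{0<..}|lborel. ?Q (- x))"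
    using integrable_halves[of ?Q] int0(1)[of 1] int0(1)[of "-1"] by auto
  let ?P = "\<lambda>x. g x * of_real \<bar>x\<bar> powr (- w)"
  have P: "integrable lborel ?P"
  proof (rule integrable_halves)
    have eq1: "?P x = mellin_integrand 1 g (1 - w) x" if "x \<in> {0<..}" for x
      using that by (simp add: mellin_integrand_def)
    show "set_integrable lborel {0<..} ?P"
      using gp[of 1] by (subst set_integrable_cong[OF refl refl eq1]) auto
    have eq2: "?P (- x) = mellin_integrand (-1) g (1 - w) x" if "x \<in> {0<..}" for x
      using that by (simp add: mellin_integrand_def)
    show "set_integrable lborel {0<..} (\<lambda>x. ?P (- x))"
      using gp[of "-1"] by (subst set_integrable_cong[OF refl refl eq2]) auto
  qed
  \<comment> \<open>The base has imaginary part of modulus \<open>2 * pi * \<bar>x\<bar>\<close> for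
    every \<open>d\<close>, which gives a majorant independent of \<open>n\<close>. The point
    \<open>x = 0\<close> is left out because the base tends to 0 there, a point of the branch
    cut.\<close>
  have right: "(\<lambda>n. LINT x|lborel. ?R n x) \<longlonglongrightarrow> (LINT x|lborel. ?Q x)"
  proof (rule integral_dominated_convergence)
    let ?K = "(2 * pi) powr (- Re w) * exp (pi * \<bar>Im w\<bar>)"
    show "integrable lborel (\<lambda>x. ?K * norm (?P x))" using P by (intro integrable_mult_right integrable_norm)
    show "?Q \<in> borel_measurable lborel" using R0(1) by auto
    show "?R n \<in> borel_measurable lborel" for n
    proof -
      have "continuous_on UNIV (\<lambda>x. (of_real (d n) - 2 * of_real pi * \<i> * of_real (\<epsilon> * x)) powr (- w))"
        using d0[of n] by (intro continuous_intros) (auto simp: complex_nonpos_Reals_iff complex_eq_iff)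
      then have "(\<lambda>x. (of_real (d n) - 2 * of_real pi * \<i> * of_real (\<epsilon> * x)) powr (- w)) \<in> borel_measurable borel"
        by (rule borel_measurable_continuous_onI)
      then show ?thesis by simp
    qed
    have nz: "AE x in lborel. x \<noteq> (0::real)" by (rule AE_lborel_singleton)
    then show "AE x in lborel. (\<lambda>n. ?R n x) \<longlonglongrightarrow> ?Q x"
    proof eventually_elim
      case (elim x)
      have "(\<lambda>n. ?R n x) \<longlonglongrightarrow> g x * (of_real 0 - 2 * of_real pi * \<i> * of_real (\<epsilon> * x)) powr (- w)"
        using elim \<epsilon> by (intro tendsto_intros dlim) (auto simp: complex_nonpos_Reals_iff)
      then show ?case by simp
    qed
    show "AE x in lborel. norm (?R n x) \<le> ?K * norm (?P x)" for n
      using nz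
    proof eventually_elim
      case (elim x)
      let ?z = "of_real (d n) - 2 * of_real pi * \<i> * of_real (\<epsilon> * x)"
      have nx: "norm (complex_of_real (2 * pi * \<bar>x\<bar>)) = 2 * pi * \<bar>x\<bar>"
        by (simp only: norm_of_real) (simp add: abs_mult)
      also have "\<dots> = \<bar>Im ?z\<bar>" using \<epsilon> by (auto simp: abs_mult)
      also have "\<dots> \<le> norm ?z" by (rule abs_Im_le_cmod)
      finally have "norm (?z powr (- w)) \<le> norm (complex_of_real (2 * pi * \<bar>x\<bar>)) powr (- Re w) * exp (pi * \<bar>Im w\<bar>)"
        using elim w by (intro norm_powr_minus_le) auto
      also note nx
      also have "(2 * pi * \<bar>x\<bar>) powr (- Re w) = (2 * pi) powr (- Re w) * \<bar>x\<bar> powr (- Re w)" by (simp add: powr_mult)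
      finally have "norm (g x) * norm (?z powr (- w)) \<le> norm (g x) * ((2 * pi) powr (- Re w) * \<bar>x\<bar> powr (- Re w) * exp (pi * \<bar>Im w\<bar>))"
        by (intro mult_left_mono) auto
      moreover have "norm (complex_of_real \<bar>x\<bar> powr (- w)) = \<bar>x\<bar> powr (- Re w)" by (subst norm_powr_real_powr) auto
      ultimately show ?case by (simp add: norm_mult mult_ac)
    qed
  qed
  have "(\<lambda>n. LINT t|lborel. gamma_kernel w (of_real (d n)) t * fourier_int g (\<epsilon> * t)) \<longlonglongrightarrow> Gamma w * (LINT x|lborel. ?Q x)"
    unfolding gamma_kernel_fourier_int[OF g w d0] by (intro tendsto_intros right)
  then have "mellin \<epsilon> (fourier_int g) w = Gamma w * (LINT x|lborel. ?Q x)"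
    using left LIMSEQ_unique by blast
  also have "(LINT x|lborel. ?Q x) = of_real (2 * pi) powr (- w) * (exp (of_real \<epsilon> * of_real pi * \<i> * w / 2) * mellin 1 g (1 - w) +
     exp (- of_real \<epsilon> * of_real pi * \<i> * w / 2) * mellin (-1) g (1 - w))"
    using R0(2) int0(2)[of 1] int0(2)[of "-1"] by (simp add: algebra_simps)
  finally show ?thesis by (simp add: mult_ac)
qed

text \<open>Integrability on a half-line is convergence of the Mellin integral at
  \<open>s = 1\<close>, which \<open>2 * Re lam > 1\<close> puts inside the strip.\<close>

lemma inversion_pair_integrable:
  assumes p: "inversion_pair lam c f g" and lam: "2 * Re lam > 1"
  shows "integrable lborel f"
proof (rule integrable_halves)
  have eq: "f (\<epsilon> * x) = mellin_integrand \<epsilon> f 1 x" if "x \<in> {0<..}" for \<epsilon> x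
    using that by (simp add: mellin_integrand_def)
  have "set_integrable lborel {0<..} (\<lambda>x. f (\<epsilon> * x))" if "\<epsilon> \<in> {1,-1}" for \<epsilon>
    using mellin_zeta_pair(1)[OF p that, of 1] lam by (subst set_integrable_cong[OF refl refl eq]) auto
  from this[of 1] this[of "-1"]
  show "set_integrable lborel {0<..} f" "set_integrable lborel {0<..} (\<lambda>x. f (- x))" by auto
qed

text \<open>Supplies the vanishing boundary terms at infinity when the Fourier integral is
  integrated by parts.\<close>

lemma inversion_pair_tendsto_0:
  assumes p: "inversion_pair lam c f g" and lam: "Re lam > 0" and \<epsilon>: "\<epsilon> \<in> {1,-1}"
  shows "((\<lambda>x. f (\<epsilon> * x)) \<longlongrightarrow> 0) at_top"
proof -
  have g: "smooth g"
    and fg: "\<And>x. x > 0 \<Longrightarrow> f (\<epsilon> * x) = c \<epsilon> * of_real x powr (- 2 * lam) * g (- \<epsilon> * (1 / x))"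
    using p \<epsilon> by (auto simp: inversion_pair_def)
  have "((\<lambda>x::real. - \<epsilon> * (1 / x)) \<longlongrightarrow> - \<epsilon> * 0) at_top"
    by (intro tendsto_intros tendsto_divide_0[OF tendsto_const] filterlim_at_top_imp_at_infinity filterlim_ident)
  then have 1: "((\<lambda>x::real. g (- \<epsilon> * (1 / x))) \<longlongrightarrow> g 0) at_top"
    using isCont_tendsto_compose[OF smooth_isCont[OF g, of 0]] by simp
  have "((\<lambda>x::real. x powr (- 2 * Re lam)) \<longlongrightarrow> 0) at_top"
    using lam by (intro tendsto_neg_powr filterlim_ident) auto
  moreover have "\<forall>\<^sub>F x in at_top. x powr (- 2 * Re lam) = norm (complex_of_real x powr (- 2 * lam))"
    using eventually_gt_at_top[of 0] by eventually_elim (simp add: norm_powr_real_powr)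
  ultimately have "((\<lambda>x::real. norm (complex_of_real x powr (- 2 * lam))) \<longlongrightarrow> 0) at_top"
    by (rule Lim_transform_eventually)
  then have "((\<lambda>x::real. complex_of_real x powr (- 2 * lam)) \<longlongrightarrow> 0) at_top" by (rule tendsto_norm_zero_cancel)
  then have "((\<lambda>x. c \<epsilon> * of_real x powr (- 2 * lam) * g (- \<epsilon> * (1 / x))) \<longlongrightarrow> c \<epsilon> * 0 * g 0) at_top"
    by (intro tendsto_intros 1)
  moreover have "\<forall>\<^sub>F x in at_top. c \<epsilon> * of_real x powr (- 2 * lam) * g (- \<epsilon> * (1 / x)) = f (\<epsilon> * x)"
    using eventually_gt_at_top[of 0] by eventually_elim (simp add: fg)
  ultimately show ?thesis by (simp add: Lim_transform_eventually)
qed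

lemma fourier_int_by_parts:
  assumes p: "inversion_pair lam c f g" and lam: "2 * Re lam > 1" and t: "t \<noteq> 0"
  shows "fourier_int f t = - 1 / (2 * of_real pi * \<i> * of_real t) * fourier_int (nderiv 1 f) t"
proof -
  have f: "smooth f" using p by (simp add: inversion_pair_def)
  let ?e = "\<lambda>x. exp (2 * of_real pi * \<i> * of_real x * of_real t)"
  let ?a = "2 * of_real pi * \<i> * of_real t"
  have i0: "integrable lborel (\<lambda>x. f x * ?e x)"
    by (intro integrable_fourier_kernel inversion_pair_integrable[OF p lam])
  have i1: "integrable lborel (\<lambda>x. nderiv 1 f x * ?e x)"
    using lam by (intro integrable_fourier_kernel inversion_pair_integrable[OF inversion_pair_deriv[OF p]]) simp
  let ?F = "\<lambda>x. f x * ?e x"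
  let ?d = "\<lambda>x. nderiv 1 f x * ?e x + ?a * (f x * ?e x)"
  have lim: "((\<lambda>x. ?F (\<eta> * x)) \<longlongrightarrow> 0) at_top" if "\<eta> \<in> {1,-1}" for \<eta>
  proof -
    have "((\<lambda>x. norm (f (\<eta> * x))) \<longlongrightarrow> 0) at_top"
      using inversion_pair_tendsto_0[OF p _ that] lam by (intro tendsto_norm_zero) auto
    moreover have "norm (?F (\<eta> * x)) = norm (f (\<eta> * x))" for x
      unfolding norm_mult norm_fourier_kernel by simp
    ultimately show ?thesis by (intro tendsto_norm_zero_cancel[of "\<lambda>x. ?F (\<eta> * x)"]) simp
  qed
  have top: "(?F \<longlongrightarrow> 0) at_top" using lim[of 1] by simp
  have bot: "(?F \<longlongrightarrow> 0) at_bot" using lim[of "-1"] by (subst filterlim_at_bot_mirror) simp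
  have lims: "((?F \<circ> real_of_ereal) \<longlongrightarrow> 0) (at_right (-\<infinity>))" "((?F \<circ> real_of_ereal) \<longlongrightarrow> 0) (at_left \<infinity>)"
    using top bot by (simp_all only: ereal_tendsto_simps)
  have "(LBINT x=-\<infinity>..\<infinity>. ?d x) = 0 - 0"
  proof (rule interval_integral_FTC_integrable[OF _ _ _ _ lims])
    fix x
    have "((\<lambda>z. exp (2 * of_real pi * \<i> * z * of_real t)) has_field_derivative ?a * ?e x) (at (complex_of_real x))"
      by (auto intro!: derivative_eq_intros)
    then have "(?e has_vector_derivative ?a * ?e x) (at x)" by (rule has_vector_derivative_real_field)
    from has_vector_derivative_mult[OF smooth_has_vector_derivative'[OF f] this]
    show "(?F has_vector_derivative ?d x) (at x)" by (simp add: algebra_simps)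
    show "isCont ?d x" by (intro continuous_intros smooth_isCont smooth_nderiv f)
    show "set_integrable lborel (einterval (- \<infinity>) \<infinity>) ?d"
      using i0 i1 by (auto simp: set_integrable_def)
  qed auto
  then have "(LINT x|lborel. ?d x) = 0" by (simp add: interval_lebesgue_integral_def set_lebesgue_integral_def)
  moreover have "(LINT x|lborel. ?d x) = (LINT x|lborel. nderiv 1 f x * ?e x) + ?a * (LINT x|lborel. f x * ?e x)"
    using i0 i1 by simp
  ultimately have "fourier_int (nderiv 1 f) t + ?a * fourier_int f t = 0"
    by (simp add: fourier_int_def)
  then have "fourier_int (nderiv 1 f) t = - (?a * fourier_int f t)" by (simp add: eq_neg_iff_add_eq_0)
  then show ?thesis using t by simp
qed

text \<open>Each integration by parts gains \<open>1 / (2 * pi * \<bar>t\<bar>)\<close>. The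
  induction ranges over all inversion pairs because it passes to the derivative, a pair of weight
  \<open>lam + 1 / 2\<close>.\<close>

lemma fourier_int_decay:
  assumes "inversion_pair lam c f g" "2 * Re lam > 1"
  shows "\<exists>C\<ge>0. \<forall>t. \<bar>t\<bar> ^ N * norm (fourier_int f t) \<le> C"
  using assms
proof (induction N arbitrary: lam c f g)
  case 0
  show ?case using norm_fourier_int_le[of f]
    by (intro exI[of _ "LINT x|lborel. norm (f x)"]) simp
next
  case (Suc N)
  obtain C where C: "C \<ge> 0" "\<And>t. \<bar>t\<bar> ^ N * norm (fourier_int (nderiv 1 f) t) \<le> C"
    using Suc.IH[OF inversion_pair_deriv[OF Suc.prems(1)]] Suc.prems(2) by auto
  have "\<bar>t\<bar> ^ Suc N * norm (fourier_int f t) \<le> C" for t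
  proof (cases "t = 0")
    case False
    have "\<bar>t\<bar> ^ Suc N * norm (fourier_int f t) = \<bar>t\<bar> ^ N * norm (fourier_int (nderiv 1 f) t) / (2 * pi)"
      unfolding fourier_int_by_parts[OF Suc.prems False] using False by (simp add: norm_mult norm_divide)
    also have "\<dots> \<le> C / 1" using C pi_gt3 by (intro frac_le) auto
    finally show ?thesis by simp
  qed (use C in simp)
  then show ?case using C by blast
qed

text \<open>Near 0 the transform is bounded, so \<open>Re w > 0\<close> suffices; at infinity it
  decays faster than any power, and some order \<open>N > Re w\<close> is used.\<close>

lemma set_integrable_mellin_fourier_int:
  assumes p: "inversion_pair lam c f g" and lam: "2 * Re lam > 1" and \<epsilon>: "\<epsilon> \<in> {1,-1}" and w: "Re w > 0"
  shows "set_integrable lborel {0<..} (mellin_integrand \<epsilon> (fourier_int f) w)"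
proof (rule set_integral_split_at_1)
  have [measurable]: "f \<in> borel_measurable borel"
    using p by (auto simp: inversion_pair_def intro: smooth_borel_measurable)
  have "norm (fourier_int f (\<epsilon> * t)) \<le> (LINT x|lborel. norm (f x)) * t powr 0" if "t \<in> {0<..<1}" for t
    using norm_fourier_int_le[of f] that by simp
  then show "set_integrable lborel {0<..<1} (mellin_integrand \<epsilon> (fourier_int f) w)"
    unfolding mellin_integrand_def[abs_def] using w by (intro set_integrable_mellin_unit[where c = 0]) auto
  define N where "N = nat \<lceil>Re w\<rceil> + 1"
  have N: "real N > Re w" unfolding N_def by linarith
  obtain C where C: "C \<ge> 0" "\<And>t. \<bar>t\<bar> ^ N * norm (fourier_int f t) \<le> C"
    using fourier_int_decay[OF p lam] by blast
  have meas: "set_borel_measurable lborel {1<..} (mellin_integrand \<epsilon> (fourier_int f) w)"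
    unfolding mellin_integrand_def[abs_def] by (intro set_borel_measurable_mellin) auto
  have eq: "(1 / y\<^sup>2) *\<^sub>R mellin_integrand \<epsilon> (fourier_int f) w (1 / y) =
      of_real y powr (- w - 1) * fourier_int f (\<epsilon> * (1 / y))" if "y \<in> {0<..<1}" for y
  proof -
    have y: "y > 0" using that by auto
    have B: "complex_of_real (1 / y) powr z = of_real y powr (- z)" for z
      using y by (simp only: of_real_powr_eq_exp_ln zero_less_divide_1_iff) (simp add: ln_div)
    have C: "complex_of_real (1 / y\<^sup>2) = of_real y powr (- 2)"
      using y powr_nat'[of "complex_of_real y" 2] by (simp add: powr_minus divide_simps)
    have "- w - 1 = - 2 + (- (w - 1))" by simp
    then have D: "complex_of_real y powr (- w - 1) = of_real y powr (- 2) * of_real y powr (- (w - 1))"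
      using y by (simp only: powr_add)
    show ?thesis unfolding mellin_integrand_def scaleR_conv_of_real B C D by (simp only: mult_ac)
  qed
  have "norm (fourier_int f (\<epsilon> * (1 / y))) \<le> C * y powr real N" if "y \<in> {0<..<1}" for y
  proof -
    have "\<bar>\<epsilon> * (1 / y)\<bar> = 1 / y" using \<epsilon> that by (auto simp: abs_mult)
    with C(2)[of "\<epsilon> * (1 / y)"] show ?thesis using that by (simp add: powr_realpow power_one_over field_simps)
  qed
  then have "set_integrable lborel {0<..<1} (\<lambda>y. of_real y powr (- w - 1) * fourier_int f (\<epsilon> * (1 / y)))"
    using N by (intro set_integrable_mellin_unit[where c = "real N" and C = C]) auto
  then have "set_integrable lborel {0<..<1} (\<lambda>y. (1 / y\<^sup>2) *\<^sub>R mellin_integrand \<epsilon> (fourier_int f) w (1 / y))"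
    by (subst set_integrable_cong[OF refl refl eq])
  then show "set_integrable lborel {1<..} (mellin_integrand \<epsilon> (fourier_int f) w)"
    by (rule set_integral_inverse_unit[OF meas])
qed

lemma holomorphic_mellin_fourier_int:
  assumes p: "inversion_pair lam c f g" and lam: "2 * Re lam > 1" and \<epsilon>: "\<epsilon> \<in> {1,-1}"
  shows "mellin \<epsilon> (fourier_int f) holomorphic_on {w. Re w > 0}"
proof -
  have "mellin \<epsilon> (fourier_int f) analytic_on {w. Re w > 0}"
    unfolding analytic_on_analytic_at[of _ "{w. Re w > 0}"]
  proof
    fix w assume "w \<in> {w. Re w > 0}"
    then have w: "Re w > 0" by simp
    have [measurable]: "f \<in> borel_measurable borel"
      using p by (auto simp: inversion_pair_def intro: smooth_borel_measurable)
    have i: "set_integrable lborel {0<..} (\<lambda>x. of_real x powr (of_real a - 1) * fourier_int f (\<epsilon> * x))" if "a > 0" for a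
      using set_integrable_mellin_fourier_int[OF p lam \<epsilon>, of "of_real a"] that by (simp add: mellin_integrand_def[abs_def])
    have hol: "mellin \<epsilon> (fourier_int f) holomorphic_on {z. Re w / 2 < Re z \<and> Re z < Re w + 1}"
      unfolding mellin_def[abs_def] mellin_integrand_def[abs_def]
      using w by (intro holomorphic_mellin_strip i) auto
    have "open ({z. Re w / 2 < Re z} \<inter> {z. Re z < Re w + 1})"
      by (intro open_Int open_halfspace_Re_gt open_halfspace_Re_lt)
    then have "open {z. Re w / 2 < Re z \<and> Re z < Re w + 1}" by (simp add: Collect_conj_eq)
    then show "mellin \<epsilon> (fourier_int f) analytic_on {w}"
      using hol w by (auto simp: analytic_at)
  qed
  then show ?thesis by (rule analytic_imp_holomorphic)
qed

section \<open>Analytic continuation\<close>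

lemma exp_half_pi_of_nat:
  assumes "\<sigma> \<in> {1, -1}"
  shows "exp (of_real \<sigma> * of_real pi * \<i> * of_nat n / 2) = (of_real \<sigma> * \<i>) ^ n"
proof -
  have "exp (of_real \<sigma> * (of_real pi * \<i> / 2)) = of_real \<sigma> * \<i>"
  proof -
    have "exp (of_real pi * \<i> / 2) = \<i>" using cis_pi_half by (simp add: cis_conv_exp mult_ac)
    then show ?thesis using assms by (auto simp: exp_minus)
  qed
  moreover have "of_real \<sigma> * of_real pi * \<i> * of_nat n / 2 = of_nat n * (of_real \<sigma> * (of_real pi * \<i> / 2))" by simp
  ultimately show ?thesis by (simp only: exp_of_nat_mult)
qed

definition dual_pair :: "complex \<Rightarrow> (real \<Rightarrow> complex) \<Rightarrow> (real \<Rightarrow> complex) \<Rightarrow> (real \<Rightarrow> complex) \<Rightarrow> real \<Rightarrow> complex \<Rightarrow> complex" where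
  "dual_pair lam c f g \<epsilon> s = of_real (2 * pi) powr (- s) * Gamma s *
     (exp (of_real \<epsilon> * of_real pi * \<i> * s / 2) * zeta_pair lam c f g 1 (1 - s) +
      exp (- of_real \<epsilon> * of_real pi * \<i> * s / 2) * zeta_pair lam c f g (-1) (1 - s))"

text \<open>The derivative of order \<open>m\<close> that defines the Fourier transform shifts \<open>s\<close> by \<open>m\<close>; all resulting factors cancel.\<close>

lemma functional_equation_shift:
  assumes s: "s \<notin> \<int>" and e: "\<epsilon> \<in> {1,-1}" "\<eta> \<in> {1,-1}"
  shows "(- 1 / (2 * of_real pi * \<i> * of_real \<epsilon>)) ^ m * (of_real (2 * pi) powr (- (s - of_nat m)) * Gamma (s - of_nat m) *
     exp (of_real (\<epsilon> * \<eta>) * of_real pi * \<i> * (s - of_nat m) / 2) * (of_real (- \<eta>) ^ m * pochhammer (1 - s) m)) =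
    of_real (2 * pi) powr (- s) * Gamma s * exp (of_real (\<epsilon> * \<eta>) * of_real pi * \<i> * s / 2)"
proof -
  let ?w = "s - of_nat m"
  have w: "?w \<notin> \<int>\<^sub>\<le>\<^sub>0"
    using s by (metis Ints_add Ints_of_nat diff_add_cancel nonpos_Ints_Int)
  have "pochhammer (1 - s) m = (- 1) ^ m * pochhammer ?w m"
    using pochhammer_minus[of "s - 1" m] by simp
  also have "pochhammer ?w m = Gamma s / Gamma ?w" using pochhammer_Gamma[OF w] by simp
  finally have 1: "Gamma ?w * pochhammer (1 - s) m = (- 1) ^ m * Gamma s"
    using Gamma_eq_zero_iff[of ?w] w by simp
  have 2: "complex_of_real (2 * pi) powr (- ?w) = of_real (2 * pi) powr (- s) * of_real (2 * pi) ^ m"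
    by (simp add: powr_diff powr_minus powr_nat' field_simps)
  have e': "- (\<epsilon> * \<eta>) \<in> {1,-1}" using e by auto
  have "of_real (\<epsilon> * \<eta>) * of_real pi * \<i> * ?w / 2 =
      of_real (\<epsilon> * \<eta>) * of_real pi * \<i> * s / 2 + of_real (- (\<epsilon> * \<eta>)) * of_real pi * \<i> * of_nat m / 2"
    by (simp add: algebra_simps diff_divide_distrib)
  then have 3: "exp (of_real (\<epsilon> * \<eta>) * of_real pi * \<i> * ?w / 2) =
      exp (of_real (\<epsilon> * \<eta>) * of_real pi * \<i> * s / 2) * (of_real (- (\<epsilon> * \<eta>)) * \<i>) ^ m"
    using exp_half_pi_of_nat[of "- (\<epsilon> * \<eta>)" m] e' by (simp only: exp_add)
  \<comment> \<open>The bases of the five \<open>m\<close>-th powers, in order: the prefactor of the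
    Fourier transform, the power of \<open>2 * pi\<close>, the reflection of the Pochhammer symbol,
    the exponential factor, and the sign from differentiating on the half-line
    \<open>\<eta>\<close>.\<close>
  have 4: "(- 1 / (2 * of_real pi * \<i> * of_real \<epsilon>)) * of_real (2 * pi) * (- 1) * (of_real (- (\<epsilon> * \<eta>)) * \<i>) * of_real (- \<eta>) = (1 :: complex)"
    using e by (auto simp: field_simps)
  have "(- 1 / (2 * of_real pi * \<i> * of_real \<epsilon>)) ^ m * (of_real (2 * pi) powr (- ?w) * Gamma ?w *
     exp (of_real (\<epsilon> * \<eta>) * of_real pi * \<i> * ?w / 2) * (of_real (- \<eta>) ^ m * pochhammer (1 - s) m)) =
     (- 1 / (2 * of_real pi * \<i> * of_real \<epsilon>)) ^ m * of_real (2 * pi) powr (- ?w) * (Gamma ?w * pochhammer (1 - s) m) *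
     exp (of_real (\<epsilon> * \<eta>) * of_real pi * \<i> * ?w / 2) * of_real (- \<eta>) ^ m" by (simp only: mult_ac)
  also have "\<dots> = ((- 1 / (2 * of_real pi * \<i> * of_real \<epsilon>)) * of_real (2 * pi) * (- 1) * (of_real (- (\<epsilon> * \<eta>)) * \<i>) * of_real (- \<eta>)) ^ m *
     (of_real (2 * pi) powr (- s) * Gamma s * exp (of_real (\<epsilon> * \<eta>) * of_real pi * \<i> * s / 2))"
    unfolding 1 2 3 power_mult_distrib by (simp only: mult_ac)
  finally show ?thesis unfolding 4 by simp
qed

context
  fixes lam c f g and M :: nat and \<epsilon> :: real
  assumes p: "inversion_pair lam c f g" and M_def: "M = (LEAST m. Re lam + real m / 2 > 1 / 2)"
    and \<epsilon>: "\<epsilon> \<in> {1,-1}"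
begin

private lemma M: "2 * Re (lam + of_nat M / 2) > 1"
proof -
  have "Re lam + real (nat (\<lceil>1 - 2 * Re lam\<rceil> + 1)) / 2 > 1 / 2" by linarith
  then have "Re lam + real M / 2 > 1 / 2" unfolding M_def by (rule LeastI)
  then show ?thesis by simp
qed

private lemma mellin_integrand_fourier:
  assumes "t \<in> {0<..}"
  shows "mellin_integrand \<epsilon> (fourier lam f) s t = (- 1 / (2 * of_real pi * \<i> * of_real \<epsilon>)) ^ M *
    mellin_integrand \<epsilon> (fourier_int (nderiv M f)) (s - of_nat M) t"
proof -
  have "complex_of_real t powr (s - 1) = of_real t powr (s - of_nat M - 1) * of_real t ^ M"
    using assms by (simp add: powr_diff powr_nat')
  moreover have "fourier lam f (\<epsilon> * t) = (- 1 / (2 * of_real pi * \<i> * of_real (\<epsilon> * t))) ^ M * fourier_int (nderiv M f) (\<epsilon> * t)"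
    by (simp add: fourier_def fourier_m_def fourier_int_def M_def)
  moreover have "(- 1 / (2 * of_real pi * \<i> * of_real (\<epsilon> * t))) ^ M = (- 1 / (2 * of_real pi * \<i> * of_real \<epsilon>)) ^ M / of_real t ^ M"
    unfolding power_divide[symmetric] by (simp add: mult.assoc)
  ultimately show ?thesis using assms by (simp add: mellin_integrand_def)
qed

text \<open>Put \<open>w = s - M\<close>; the power \<open>t ^ M\<close> in the denominator of
  \<open>fourier\<close> is this shift. On the strip \<open>0 < Re w < 1\<close> the left side needs
  \<open>Re w > 0\<close>, and the right side needs \<open>0 < Re (1 - w) < 2 * Re lam + M\<close>,
  whose upper bound exceeds 1. The open strip contains no integer, as the shift of the functional
  equation requires.\<close>

lemma mellin_fourier:
  shows "Re s > real M \<Longrightarrow> set_integrable lborel {0<..} (mellin_integrand \<epsilon> (fourier lam f) s)"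
    and "mellin \<epsilon> (fourier lam f) holomorphic_on {s. Re s > real M}"
    and "real M < Re s \<Longrightarrow> Re s < real M + 1 \<Longrightarrow> mellin \<epsilon> (fourier lam f) s = dual_pair lam c f g \<epsilon> s"
proof -
  obtain c' g' where p': "inversion_pair (lam + of_nat M / 2) c' (nderiv M f) g'" and
    z: "\<forall>\<epsilon> s. \<epsilon> \<in> {1,-1} \<longrightarrow> s \<notin> \<int>\<^sub>\<le>\<^sub>0 \<longrightarrow> 2 * lam - s \<notin> \<int>\<^sub>\<le>\<^sub>0 \<longrightarrow>
       zeta_pair (lam + of_nat M / 2) c' (nderiv M f) g' \<epsilon> (s + of_nat M) =
       of_real (- \<epsilon>) ^ M * pochhammer s M * zeta_pair lam c f g \<epsilon> s"
    by (rule inversion_pair_nderiv[OF p, where m = M])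
  let ?K = "(- 1 / (2 * of_real pi * \<i> * of_real \<epsilon>)) ^ M :: complex"
  let ?h = "fourier_int (nderiv M f)"
  show "set_integrable lborel {0<..} (mellin_integrand \<epsilon> (fourier lam f) s)" if "Re s > real M" for s
  proof -
    have "set_integrable lborel {0<..} (mellin_integrand \<epsilon> ?h (s - of_nat M))"
      using that by (intro set_integrable_mellin_fourier_int[OF p' M \<epsilon>]) simp
    then have "set_integrable lborel {0<..} (\<lambda>t. ?K * mellin_integrand \<epsilon> ?h (s - of_nat M) t)"
      by (intro set_integrable_mult_right) simp
    then show ?thesis by (subst set_integrable_cong[OF refl refl mellin_integrand_fourier])
  qed
  have eq: "mellin \<epsilon> (fourier lam f) s = ?K * mellin \<epsilon> ?h (s - of_nat M)" for s
  proof -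
    have "mellin \<epsilon> (fourier lam f) s = (LINT t:{0<..}|lborel. ?K * mellin_integrand \<epsilon> ?h (s - of_nat M) t)"
      unfolding mellin_def using mellin_integrand_fourier by (intro set_lebesgue_integral_cong) auto
    then show ?thesis by (simp add: mellin_def)
  qed
  have "(\<lambda>s. ?K * (mellin \<epsilon> ?h \<circ> (\<lambda>s. s - of_nat M)) s) holomorphic_on {s. Re s > real M}"
    by (intro holomorphic_on_mult holomorphic_on_const holomorphic_on_compose_gen[OF _ holomorphic_mellin_fourier_int[OF p' M \<epsilon>]]
       holomorphic_intros) auto
  then show "mellin \<epsilon> (fourier lam f) holomorphic_on {s. Re s > real M}"
    by (subst holomorphic_cong[OF refl eq]) (simp add: o_def)
  assume s: "real M < Re s" "Re s < real M + 1"
  let ?w = "s - of_nat M"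
  have nonint: "s \<notin> \<int>"
  proof
    assume "s \<in> \<int>"
    then obtain n where "s = of_int n" by (rule Ints_cases)
    then have "int M < n" "n < int M + 1" using s by simp_all
    then show False by simp
  qed
  have "1 - s \<notin> \<int>\<^sub>\<le>\<^sub>0"
    using nonint by (metis Ints_1 Ints_diff diff_diff_eq2 add_diff_cancel_left' nonpos_Ints_Int)
  moreover have "2 * lam - (1 - s) \<notin> \<int>\<^sub>\<le>\<^sub>0"
  proof
    assume "2 * lam - (1 - s) \<in> \<int>\<^sub>\<le>\<^sub>0"
    then obtain n where "2 * lam - (1 - s) = of_int n" "n \<le> 0" by (rule nonpos_Ints_cases)
    then have "Re (2 * lam - (1 - s)) \<le> 0" by simp
    with s M show False by simp
  qed
  ultimately have zz: "zeta_pair (lam + of_nat M / 2) c' (nderiv M f) g' \<eta> (1 - s + of_nat M) =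
       of_real (- \<eta>) ^ M * pochhammer (1 - s) M * zeta_pair lam c f g \<eta> (1 - s)" if "\<eta> \<in> {1,-1}" for \<eta>
    using z that by blast
  have ww: "1 - ?w = 1 - s + of_nat M" by simp
  have mm: "set_integrable lborel {0<..} (mellin_integrand \<eta> (nderiv M f) (1 - ?w))"
    "mellin \<eta> (nderiv M f) (1 - ?w) = of_real (- \<eta>) ^ M * pochhammer (1 - s) M * zeta_pair lam c f g \<eta> (1 - s)"
    if "\<eta> \<in> {1,-1}" for \<eta>
    using mellin_zeta_pair[OF p' that, of "1 - ?w"] s M zz[OF that] unfolding ww by simp_all
  have "mellin \<epsilon> ?h ?w = of_real (2 * pi) powr (- ?w) * Gamma ?w *
    (exp (of_real \<epsilon> * of_real pi * \<i> * ?w / 2) * mellin 1 (nderiv M f) (1 - ?w) +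
     exp (- of_real \<epsilon> * of_real pi * \<i> * ?w / 2) * mellin (-1) (nderiv M f) (1 - ?w))"
    using s by (intro mellin_fourier_int[OF \<epsilon>] mm(1) inversion_pair_integrable[OF p' M] set_integrable_mellin_fourier_int[OF p' M \<epsilon>]) auto
  then have "mellin \<epsilon> (fourier lam f) s = ?K * (of_real (2 * pi) powr (- ?w) * Gamma ?w *
     exp (of_real (\<epsilon> * 1) * of_real pi * \<i> * ?w / 2) * (of_real (- 1) ^ M * pochhammer (1 - s) M)) * zeta_pair lam c f g 1 (1 - s) +
     ?K * (of_real (2 * pi) powr (- ?w) * Gamma ?w *
     exp (of_real (\<epsilon> * -1) * of_real pi * \<i> * ?w / 2) * (of_real (- (-1)) ^ M * pochhammer (1 - s) M)) * zeta_pair lam c f g (-1) (1 - s)"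
    unfolding eq using mm(2)[of 1] mm(2)[of "-1"] by (simp add: algebra_simps)
  also have "\<dots> = dual_pair lam c f g \<epsilon> s"
    using functional_equation_shift[OF nonint \<epsilon>, of 1 M] functional_equation_shift[OF nonint \<epsilon>, of "-1" M]
    by (simp only: insert_iff simp_thms) (simp add: dual_pair_def algebra_simps)
  finally show "mellin \<epsilon> (fourier lam f) s = dual_pair lam c f g \<epsilon> s" .
qed

end

section \<open>Uniqueness of the normalised continuations\<close>

lemma nicely_meromorphic_tendsto:
  assumes "F nicely_meromorphic_on A" "w \<in> A" "(F \<longlongrightarrow> v) (at w)"
  shows "F w = v" "\<not> is_pole F w"
proof -
  show np: "\<not> is_pole F w"
    using assms(3) not_tendsto_and_filterlim_at_infinity[of "at w" F v] by (auto simp: is_pole_def)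
  then have "(F \<longlongrightarrow> F w) (at w)" using assms(1,2) by (auto simp: nicely_meromorphic_on_def)
  then show "F w = v" using assms(3) LIM_unique by blast
qed

text \<open>The identity theorem for the difference, singularities removed, gives equality on
  punctured neighbourhoods only. The normalisation then settles every point: the value is 0 at a
  pole and the limit elsewhere.\<close>

lemma nicely_meromorphic_eq_on:
  assumes F: "F nicely_meromorphic_on A" and G: "G nicely_meromorphic_on A"
    and A: "open A" "connected A" and S: "open S" "S \<noteq> {}" "S \<subseteq> A"
    and eq: "\<And>s. s \<in> S \<Longrightarrow> F s = G s" and w: "w \<in> A"
  shows "F w = G w"
proof -
  have mer: "(\<lambda>s. F s - G s) meromorphic_on A"
    using F G by (intro meromorphic_intros) (auto simp: nicely_meromorphic_on_def)
  define h where "h = remove_sings (\<lambda>s. F s - G s)"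
  have h: "h nicely_meromorphic_on A" unfolding h_def by (rule remove_sings_nicely_meromorphic[OF mer])
  have ev: "\<forall>\<^sub>F u in at v. h u = F u - G u" if "v \<in> A" for v
    unfolding h_def using mer that meromorphic_on_isolated_singularity meromorphic_on_subset
    by (intro eventually_remove_sings_eq_at) blast
  obtain z where z: "z \<in> S" using S by auto
  then have zA: "z \<in> A" using S by auto
  have "\<forall>\<^sub>F u in at z. u \<in> S" using S z by (intro eventually_at_in_open') auto
  then have "\<forall>\<^sub>F u in at z. h u = 0"
    using ev[OF zA] by eventually_elim (auto simp: eq)
  then have "\<exists>\<^sub>F u in at z. h u = 0" by (intro eventually_frequently) auto
  then have h0: "h v = 0" if "v \<in> A" for v
    using frequently_eq_meromorphic_imp_constant[OF _ h A] z S that by blast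
  have "\<forall>\<^sub>F u in at w. u \<in> A" using A w by (intro eventually_at_in_open') auto
  then have FG: "\<forall>\<^sub>F u in at w. F u = G u"
    using ev[OF w] by eventually_elim (auto simp: h0)
  show ?thesis
  proof (cases "is_pole F w")
    case True
    then have "is_pole G w" using is_pole_cong[OF FG refl] by simp
    then have "F w = 0" "G w = 0"
      using True F G w nicely_meromorphic_tendsto(2) unfolding nicely_meromorphic_on_def by blast+
    then show ?thesis by simp
  next
    case False
    then have "(F \<longlongrightarrow> F w) (at w)" using F w by (auto simp: nicely_meromorphic_on_def)
    then have "(G \<longlongrightarrow> F w) (at w)" using FG by (rule Lim_transform_eventually)
    then show ?thesis using nicely_meromorphic_tendsto(1)[OF G w] by simp
  qed
qed

lemma mellin_unit_affine_meromorphic: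
  assumes "smooth h"
  shows "(\<lambda>s. mellin_unit h (a + b * s)) meromorphic_on UNIV"
  by (rule meromorphic_on_compose[OF mellin_unit_meromorphic[OF assms]]) (auto intro!: analytic_intros)

lemma zeta_pair_affine_meromorphic:
  assumes p: "inversion_pair lam c f g"
  shows "(\<lambda>s. zeta_pair lam c f g \<epsilon> (a + b * s)) meromorphic_on UNIV"
proof -
  have f: "smooth (\<lambda>x. f (\<epsilon> * x))" and g: "smooth (\<lambda>x. g (- \<epsilon> * x))"
    using p smooth_comp_scale(1)[of f \<epsilon>] smooth_comp_scale(1)[of g "- \<epsilon>"] by (auto simp: inversion_pair_def)
  have "(\<lambda>s. mellin_unit (\<lambda>x. f (\<epsilon> * x)) (a + b * s) + c \<epsilon> * mellin_unit (\<lambda>x. g (- \<epsilon> * x)) ((2 * lam - a) + (- b) * s)) meromorphic_on UNIV"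
    by (intro meromorphic_intros mellin_unit_affine_meromorphic f g)
  then show ?thesis by (simp add: zeta_pair_def algebra_simps)
qed

lemma zeta_pair_meromorphic: "inversion_pair lam c f g \<Longrightarrow> zeta_pair lam c f g \<epsilon> meromorphic_on UNIV"
  using zeta_pair_affine_meromorphic[of lam c f g \<epsilon> 0 1] by simp

lemma zeta_pair_analytic:
  assumes p: "inversion_pair lam c f g" and s: "s \<notin> \<int>\<^sub>\<le>\<^sub>0" "2 * lam - s \<notin> \<int>\<^sub>\<le>\<^sub>0"
  shows "zeta_pair lam c f g \<epsilon> analytic_on {s}"
proof -
  have f: "smooth (\<lambda>x. f (\<epsilon> * x))" and g: "smooth (\<lambda>x. g (- \<epsilon> * x))"
    using p smooth_comp_scale(1)[of f \<epsilon>] smooth_comp_scale(1)[of g "- \<epsilon>"] by (auto simp: inversion_pair_def)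
  have "(mellin_unit (\<lambda>x. g (- \<epsilon> * x)) \<circ> (\<lambda>s. 2 * lam - s)) analytic_on {s}"
    using s mellin_unit_analytic[OF g] by (intro analytic_on_compose analytic_intros) auto
  then show ?thesis
    unfolding zeta_pair_def[abs_def] o_def by (intro analytic_intros mellin_unit_analytic[OF f s(1)])
qed

lemma not_nonpos_IntI: "Re z > 0 \<Longrightarrow> z \<notin> \<int>\<^sub>\<le>\<^sub>0"
proof
  assume "Re z > 0" "z \<in> \<int>\<^sub>\<le>\<^sub>0"
  then obtain n where "z = of_int n" "n \<le> 0" by (auto elim: nonpos_Ints_cases)
  with \<open>Re z > 0\<close> show False by simp
qed

text \<open>The closed form shows that the condition under \<open>SOME\<close> can be met, and the
  identity theorem leaves no other solution.\<close>

lemma local_zeta_eq: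
  assumes p: "inversion_pair lam c f g" and \<epsilon>: "\<epsilon> \<in> {1,-1}"
  shows "local_zeta lam \<epsilon> f = remove_sings (zeta_pair lam c f g \<epsilon>)"
proof -
  let ?P = "\<lambda>G. G nicely_meromorphic_on UNIV \<and>
     (\<forall>m s. - real m < Re s \<and> Re s < 2 * Re lam \<and> s \<notin> \<int>\<^sub>\<le>\<^sub>0 \<longrightarrow>
        G s = of_real (- \<epsilon>) ^ m / pochhammer s m * mellin \<epsilon> (nderiv m f) (s + of_nat m))"
  have ex: "?P (remove_sings (zeta_pair lam c f g \<epsilon>))"
  proof (intro conjI allI impI)
    show "remove_sings (zeta_pair lam c f g \<epsilon>) nicely_meromorphic_on UNIV"
      by (rule remove_sings_nicely_meromorphic[OF zeta_pair_meromorphic[OF p]])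
    fix m s assume s: "- real m < Re s \<and> Re s < 2 * Re lam \<and> s \<notin> \<int>\<^sub>\<le>\<^sub>0"
    then have "2 * lam - s \<notin> \<int>\<^sub>\<le>\<^sub>0" by (intro not_nonpos_IntI) simp
    then have "remove_sings (zeta_pair lam c f g \<epsilon>) s = zeta_pair lam c f g \<epsilon> s"
      using zeta_pair_analytic[OF p] s by (intro remove_sings_at_analytic) auto
    then show "remove_sings (zeta_pair lam c f g \<epsilon>) s = of_real (- \<epsilon>) ^ m / pochhammer s m * mellin \<epsilon> (nderiv m f) (s + of_nat m)"
      using zeta_pair_mellin_nderiv[OF p \<epsilon>] s by simp
  qed
  have L: "?P (local_zeta lam \<epsilon> f)" unfolding local_zeta_def by (rule someI[where P = ?P, OF ex])
  define m where "m = nat (\<lceil>1 - 2 * Re lam\<rceil> + 1)"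
  have m: "- real m < 2 * Re lam - 1" unfolding m_def by linarith
  \<comment> \<open>The upper half-plane avoids the excluded nonpositive integers, and
    \<open>m\<close> was taken large enough for the strip to be nonempty.\<close>
  let ?S = "{s. Re s > - real m} \<inter> {s. Re s < 2 * Re lam} \<inter> {s. Im s > 0}"
  have "open ?S" by (intro open_Int open_halfspace_Re_gt open_halfspace_Re_lt open_halfspace_Im_gt)
  moreover have "Complex (2 * Re lam - 1) 1 \<in> ?S" using m by simp
  then have "?S \<noteq> {}" by blast
  moreover have "local_zeta lam \<epsilon> f s = remove_sings (zeta_pair lam c f g \<epsilon>) s" if "s \<in> ?S" for s
  proof -
    have "s \<notin> \<int>\<^sub>\<le>\<^sub>0" using that by (auto elim!: nonpos_Ints_cases)
    then show ?thesis using that L ex by auto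
  qed
  ultimately show ?thesis
    using L ex nicely_meromorphic_eq_on[of "local_zeta lam \<epsilon> f" UNIV "remove_sings (zeta_pair lam c f g \<epsilon>)" ?S]
    by (intro ext) auto
qed

lemma Gamma_meromorphic: "Gamma meromorphic_on A"
proof -
  have "(\<lambda>z. inverse (rGamma z :: complex)) meromorphic_on UNIV"
    by (intro meromorphic_intros analytic_on_imp_meromorphic_on)
      (simp add: analytic_on_open holomorphic_rGamma)
  then show ?thesis unfolding Gamma_def by (rule meromorphic_on_subset) auto
qed

lemma dual_pair_meromorphic:
  assumes p: "inversion_pair lam c f g"
  shows "dual_pair lam c f g \<epsilon> meromorphic_on UNIV"
proof -
  have "(\<lambda>s. zeta_pair lam c f g \<eta> (1 - s)) meromorphic_on UNIV" for \<eta>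
    using zeta_pair_affine_meromorphic[OF p, of \<eta> 1 "-1"] by simp
  moreover have "(\<lambda>s. complex_of_real (2 * pi) powr (- s)) analytic_on UNIV"
    by (simp add: powr_def) (intro analytic_intros)
  moreover have "(\<lambda>s. exp (a * s / 2)) analytic_on UNIV" for a by (intro analytic_intros) auto
  ultimately show ?thesis unfolding dual_pair_def[abs_def]
    by (intro meromorphic_intros Gamma_meromorphic) (blast intro: analytic_on_imp_meromorphic_on)+
qed

text \<open>The identity theorem is used twice: from the strip, where the functional equation is
  known, to the half-plane \<open>?A\<close> of convergence, and from a half-plane to the whole
  plane.\<close>

lemma dual_zeta_eq:
  assumes p: "inversion_pair lam c f g" and \<epsilon>: "\<epsilon> \<in> {1,-1}"
  shows "dual_zeta lam \<epsilon> f = remove_sings (dual_pair lam c f g \<epsilon>)"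
    "\<exists>c. \<forall>s. Re s > c \<longrightarrow> set_integrable lborel {0<..} (mellin_integrand \<epsilon> (fourier lam f) s) \<and>
           dual_zeta lam \<epsilon> f s = mellin \<epsilon> (fourier lam f) s"
proof -
  define M where "M = (LEAST m. Re lam + real m / 2 > 1 / 2)"
  note mf = mellin_fourier[OF p M_def \<epsilon>]
  let ?D = "dual_pair lam c f g \<epsilon>"
  let ?P = "\<lambda>G. G nicely_meromorphic_on UNIV \<and>
     (\<exists>c. \<forall>s. Re s > c \<longrightarrow>
        set_integrable lborel {0<..} (mellin_integrand \<epsilon> (fourier lam f) s) \<and>
        G s = mellin \<epsilon> (fourier lam f) s)"
  have nice: "remove_sings ?D nicely_meromorphic_on UNIV"
    by (rule remove_sings_nicely_meromorphic[OF dual_pair_meromorphic[OF p]])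
  let ?S = "{s. Re s > real M} \<inter> {s. Re s < real M + 1}"
  let ?A = "{s. Re s > real M}"
  have oS: "open ?S" by (intro open_Int open_halfspace_Re_gt open_halfspace_Re_lt)
  have oA: "open ?A" "connected ?A"
    by (simp_all add: open_halfspace_Re_gt convex_connected convex_halfspace_Re_gt)
  have hS: "?D holomorphic_on ?S"
  proof -
    have "mellin \<epsilon> (fourier lam f) holomorphic_on ?S" using mf(2) by (rule holomorphic_on_subset) auto
    then show ?thesis by (rule holomorphic_transform) (use mf(3) in auto)
  qed
  have eqA: "remove_sings ?D s = mellin \<epsilon> (fourier lam f) s" if "s \<in> ?A" for s
  proof (rule nicely_meromorphic_eq_on[OF _ _ oA oS _ _ _ that])
    show "remove_sings ?D nicely_meromorphic_on ?A" using nice by (rule nicely_meromorphic_on_subset) auto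
    show "mellin \<epsilon> (fourier lam f) nicely_meromorphic_on ?A"
      using mf(2) oA by (intro analytic_on_imp_nicely_meromorphic_on) (simp add: analytic_on_open)
    have "Complex (real M + 1 / 2) 0 \<in> ?S" by simp
    then show "?S \<noteq> {}" by blast
    show "remove_sings ?D s = mellin \<epsilon> (fourier lam f) s" if "s \<in> ?S" for s
    proof -
      have "?D analytic_on {s}" using hS oS that analytic_at by blast
      then show ?thesis using mf(3) that by simp
    qed
  qed auto
  have ex: "?P (remove_sings ?D)"
    using nice eqA mf(1) by (intro conjI exI[of _ "real M"]) auto
  have L: "?P (dual_zeta lam \<epsilon> f)" unfolding dual_zeta_def by (rule someI[where P = ?P, OF ex])
  then show "\<exists>c. \<forall>s. Re s > c \<longrightarrow> set_integrable lborel {0<..} (mellin_integrand \<epsilon> (fourier lam f) s) \<and>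
           dual_zeta lam \<epsilon> f s = mellin \<epsilon> (fourier lam f) s" by blast
  from L obtain d where d: "\<And>s. Re s > d \<Longrightarrow> dual_zeta lam \<epsilon> f s = mellin \<epsilon> (fourier lam f) s" by blast
  show "dual_zeta lam \<epsilon> f = remove_sings ?D"
  proof
    fix w
    show "dual_zeta lam \<epsilon> f w = remove_sings ?D w"
    proof (rule nicely_meromorphic_eq_on[OF conjunct1[OF L] nice open_UNIV connected_UNIV])
      \<comment> \<open>The abscissa \<open>d\<close> belonging to the chosen function is unknown,
        so the comparison is made to the right of both \<open>d\<close> and
        \<open>M\<close>.\<close>
      show "open {s. Re s > max d (real M)}" by (rule open_halfspace_Re_gt)
      have "complex_of_real (max d (real M) + 1) \<in> {s. Re s > max d (real M)}" by (auto simp: max_def)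
      then show "{s. Re s > max d (real M)} \<noteq> {}" by blast
      show "dual_zeta lam \<epsilon> f s = remove_sings ?D s" if "s \<in> {s. Re s > max d (real M)}" for s
        using d[of s] eqA[of s] that by simp
    qed auto
  qed
qed

text \<open>If the pole had order \<open>m > n\<close>, then \<open>F s * (s - z) ^ m\<close> would
  tend to the nonzero value of \<open>zor_poly\<close> at \<open>z\<close>, but it is a convergent
  function times \<open>(s - z) ^ (m - n)\<close> and tends to 0.\<close>

lemma zorder_ge_of_tendsto:
  assumes mer: "F meromorphic_on {z}" and pole: "is_pole F z"
    and lim: "((\<lambda>s. F s * (s - z) ^ n) \<longlongrightarrow> v) (at z)"
  shows "zorder F z \<ge> - int n"
proof (rule ccontr)
  assume "\<not> zorder F z \<ge> - int n"
  then have n: "nat (- zorder F z) > n" by simp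
  define m where "m = nat (- zorder F z)"
  have "isolated_singularity_at F z" using mer meromorphic_at_iff by blast
  then obtain r0 where r0: "r0 > 0" "F analytic_on ball z r0 - {z}" by (auto simp: isolated_singularity_at_def)
  have "F holomorphic_on ball z r0 - {z}" using r0(2) by (rule analytic_imp_holomorphic)
  from zorder_exist_pole[OF this _ _ pole] r0(1)
  obtain r where r: "r > 0" "zor_poly F z z \<noteq> 0" "zor_poly F z holomorphic_on cball z r"
    "\<And>w. w \<in> cball z r - {z} \<Longrightarrow> F w = zor_poly F z w / (w - z) ^ m"
    unfolding m_def by auto
  have "isCont (zor_poly F z) z"
    using r(1,3) by (intro continuous_on_interior[OF holomorphic_on_imp_continuous_on]) auto
  then have l1: "(zor_poly F z \<longlongrightarrow> zor_poly F z z) (at z)" by (simp add: isCont_def)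
  have "((\<lambda>s. F s * (s - z) ^ n * (s - z) ^ (m - n)) \<longlongrightarrow> v * (z - z) ^ (m - n)) (at z)"
    by (intro tendsto_mult lim tendsto_intros)
  then have l2: "((\<lambda>s. F s * (s - z) ^ n * (s - z) ^ (m - n)) \<longlongrightarrow> 0) (at z)"
    using n by (simp add: m_def power_0_left)
  have "\<forall>\<^sub>F s in at z. s \<in> ball z r - {z}" using r(1) by (intro eventually_at_in_open) auto
  then have "\<forall>\<^sub>F s in at z. F s * (s - z) ^ n * (s - z) ^ (m - n) = zor_poly F z s"
  proof eventually_elim
    case (elim s)
    have "(s - z) ^ n * (s - z) ^ (m - n) = (s - z) ^ m" using n m_def by (simp add: power_add[symmetric])
    moreover have "F s * (s - z) ^ m = zor_poly F z s" using elim r(4)[of s] by auto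
    ultimately show ?case by (simp add: mult.assoc)
  qed
  with l2 have "(zor_poly F z \<longlongrightarrow> 0) (at z)" by (rule Lim_transform_eventually)
  with l1 have "zor_poly F z z = 0" using LIM_unique by blast
  with r(2) show False by simp
qed

lemma residue_of_tendsto:
  assumes mer: "F meromorphic_on {z}" and lim: "((\<lambda>s. F s * (s - z)) \<longlongrightarrow> v) (at z)"
  shows "residue F z = v"
proof -
  have "isolated_singularity_at F z" using mer meromorphic_at_iff by blast
  then obtain r0 where r0: "r0 > 0" "F analytic_on ball z r0 - {z}" by (auto simp: isolated_singularity_at_def)
  then show ?thesis
    using lim by (intro residue_simple'[of "ball z r0"]) (auto intro: analytic_imp_holomorphic)
qed

section \<open>Poles and residues\<close>

lemma filterlim_at_affine:
  fixes a b s0 :: complex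
  assumes "b \<noteq> 0"
  shows "filterlim (\<lambda>s. a + b * s) (at (a + b * s0)) (at s0)"
  using assms by (auto simp: filterlim_at eventually_at_filter intro!: tendsto_intros always_eventually)

lemma mellin_unit_tendsto_residue:
  assumes "smooth h"
  shows "((\<lambda>s. mellin_unit h s * (s + of_nat k)) \<longlongrightarrow> nderiv k h 0 / fact k) (at (- of_nat k))"
proof -
  obtain d where d: "((\<lambda>s. mellin_unit h s - nderiv k h 0 / fact k / (s + of_nat k)) \<longlongrightarrow> d) (at (- of_nat k))"
    by (rule mellin_unit_pole[OF assms])
  have "((\<lambda>s. (mellin_unit h s - nderiv k h 0 / fact k / (s + of_nat k)) * (s + of_nat k) + nderiv k h 0 / fact k)
     \<longlongrightarrow> d * (- of_nat k + of_nat k) + nderiv k h 0 / fact k) (at (- of_nat k))"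
    by (intro tendsto_intros d)
  moreover have "\<forall>\<^sub>F s in at (- of_nat k). (mellin_unit h s - nderiv k h 0 / fact k / (s + of_nat k)) * (s + of_nat k) + nderiv k h 0 / fact k
      = mellin_unit h s * (s + of_nat k)"
  proof -
    have "\<forall>\<^sub>F s in at (- of_nat k). s \<noteq> (- of_nat k :: complex)" by (auto simp: eventually_at_filter)
    then show ?thesis
    proof eventually_elim
      case (elim s)
      then have "s + of_nat k \<noteq> 0" by (simp add: add_eq_0_iff2)
      then show ?case by (simp add: left_diff_distrib)
    qed
  qed
  ultimately show ?thesis by (simp add: Lim_transform_eventually)
qed

context
  fixes lam c f g and \<epsilon> :: real
  assumes p: "inversion_pair lam c f g" and \<epsilon>: "\<epsilon> \<in> {1,-1}"
begin

private abbreviation "E \<eta> s \<equiv> exp (of_real (\<epsilon> * \<eta>) * of_real pi * \<i> * s / 2)"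

text \<open>The contribution of \<open>f\<close> on the unit interval of each half-line. The factor
  1 in \<open>1 * x\<close> is kept so that both terms are instances of
  \<open>f (\<eta> * x)\<close>.\<close>

definition near_part :: "complex \<Rightarrow> complex" where
  "near_part s = E 1 s * mellin_unit (\<lambda>x. f (1 * x)) (1 - s) + E (-1) s * mellin_unit (\<lambda>x. f (- 1 * x)) (1 - s)"

text \<open>The contribution of \<open>f\<close> near infinity, expressed through \<open>g\<close>
  near 0; each half-line of \<open>f\<close> sees the opposite half-line of
  \<open>g\<close>.\<close>

definition far_part :: "complex \<Rightarrow> complex" where
  "far_part s = E 1 s * (c 1 * mellin_unit (\<lambda>x. g (- 1 * x)) (2 * lam - 1 + s)) +
     E (-1) s * (c (-1) * mellin_unit (\<lambda>x. g (- (- 1) * x)) (2 * lam - 1 + s))"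

private lemma smooth_f: "smooth (\<lambda>x. f (\<eta> * x))" and smooth_g: "smooth (\<lambda>x. g (\<eta> * x))" 
  and sf: "smooth f" and sg: "smooth g"
  using p smooth_comp_scale(1)[of f \<eta>] smooth_comp_scale(1)[of g "\<eta>"] by (auto simp: inversion_pair_def)

lemma dual_pair_parts:
  "dual_pair lam c f g \<epsilon> s = of_real (2 * pi) powr (- s) * Gamma s * (near_part s + far_part s)"
proof -
  have "2 * lam - (1 - s) = 2 * lam - 1 + s" by simp
  then show ?thesis
    by (simp add: dual_pair_def near_part_def far_part_def zeta_pair_def algebra_simps)
qed

lemma near_part_tendsto_value:
  assumes "1 - s0 \<notin> \<int>\<^sub>\<le>\<^sub>0" shows "(near_part \<longlongrightarrow> near_part s0) (at s0)"
proof -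
  have l: "((\<lambda>s. mellin_unit (\<lambda>x. f (\<eta> * x)) (1 - s)) \<longlongrightarrow> mellin_unit (\<lambda>x. f (\<eta> * x)) (1 - s0)) (at s0)" for \<eta>
    by (rule isCont_tendsto_compose[OF analytic_at_imp_isCont[OF mellin_unit_analytic[OF smooth_f assms]]])
      (intro tendsto_intros)
  show ?thesis unfolding near_part_def[abs_def] by (intro tendsto_intros l) auto
qed

text \<open>The Taylor coefficients of \<open>f\<close> at 0 cause no poles of the dual zeta function: the residues at \<open>- k\<close> of the
  two half-lines differ by the factor \<open>(-1) ^ k\<close>, and the exponential factors at \<open>s = k + 1\<close> by \<open>- (-1) ^ k\<close>.\<close>

lemma near_part_tendsto: "\<exists>L. (near_part \<longlongrightarrow> L) (at s0)"
proof (cases "1 - s0 \<in> \<int>\<^sub>\<le>\<^sub>0")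
  case False
  then show ?thesis using near_part_tendsto_value by blast
next
  case True
  then obtain k where k: "1 - s0 = - of_nat k" by (auto elim: nonpos_Ints_cases')
  then have s0: "s0 = of_nat k + 1" by (simp add: algebra_simps)
  define a where "a = nderiv k f 0 / fact k"
  have ak: "nderiv k (\<lambda>x. f (\<eta> * x)) 0 / fact k = of_real \<eta> ^ k * a" for \<eta>
    by (subst smooth_comp_scale(2)[OF sf]) (simp add: a_def)
  have "\<exists>d. ((\<lambda>s. mellin_unit (\<lambda>x. f (\<eta> * x)) (1 - s) - of_real \<eta> ^ k * a / (1 - s + of_nat k)) \<longlongrightarrow> d) (at s0)" for \<eta>
  proof -
    obtain d where "((\<lambda>s. mellin_unit (\<lambda>x. f (\<eta> * x)) s - nderiv k (\<lambda>x. f (\<eta> * x)) 0 / fact k / (s + of_nat k)) \<longlongrightarrow> d) (at (- of_nat k))"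
      by (rule mellin_unit_pole[OF smooth_f])
    moreover have "filterlim (\<lambda>s. 1 - s) (at (- of_nat k)) (at s0)"
      using filterlim_at_affine[of "-1" 1 s0] by (simp add: s0)
    ultimately show ?thesis unfolding ak by (intro exI) (rule filterlim_compose)
  qed
  then obtain d where d: "\<And>\<eta>. ((\<lambda>s. mellin_unit (\<lambda>x. f (\<eta> * x)) (1 - s) - of_real \<eta> ^ k * a / (1 - s + of_nat k)) \<longlongrightarrow> d \<eta>) (at s0)"
    by metis
  \<comment> \<open>Added over both half-lines, the principal parts are
    \<open>- a * N s / (s - s0)\<close>. Since \<open>N\<close> vanishes at \<open>s0\<close>, the
    quotient \<open>N s / (s - s0)\<close> tends to a derivative.\<close>
  define N where "N s = E 1 s + (- 1) ^ k * E (-1) s" for s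
  have "N s0 = 0"
  proof -
    have "E \<eta> s0 = (of_real (\<epsilon> * \<eta>) * \<i>) ^ Suc k" if "\<eta> \<in> {1,-1}" for \<eta>
    proof -
      have "\<epsilon> * \<eta> \<in> {1,-1}" using that \<epsilon> by auto
      from exp_half_pi_of_nat[OF this, of "Suc k"] show ?thesis unfolding s0 by (simp only: of_nat_Suc add.commute)
    qed
    from this[of 1] this[of "-1"] have "N s0 = (of_real \<epsilon> * \<i>) ^ Suc k + (- 1) ^ k * (- (of_real \<epsilon> * \<i>)) ^ Suc k"
      by (simp add: N_def)
    also have "\<dots> = 0" by (subst power_minus[of _ "Suc k"]) (simp add: power_mult_distrib[symmetric])
    finally show ?thesis .
  qed
  have "N field_differentiable (at s0)" unfolding N_def[abs_def] field_differentiable_def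
    by (rule exI) (rule derivative_eq_intros refl | simp)+
  then obtain N' where "(N has_field_derivative N') (at s0)" by (auto simp: field_differentiable_def)
  then have "((\<lambda>s. (N s - N s0) / (s - s0)) \<longlongrightarrow> N') (at s0)" by (simp add: has_field_derivative_iff)
  then have q: "((\<lambda>s. N s / (s - s0)) \<longlongrightarrow> N') (at s0)" using \<open>N s0 = 0\<close> by simp
  have "((\<lambda>s. E 1 s * (mellin_unit (\<lambda>x. f (1 * x)) (1 - s) - of_real 1 ^ k * a / (1 - s + of_nat k)) +
      E (-1) s * (mellin_unit (\<lambda>x. f (-1 * x)) (1 - s) - of_real (-1) ^ k * a / (1 - s + of_nat k)) - a * (N s / (s - s0)))
     \<longlongrightarrow> E 1 s0 * d 1 + E (-1) s0 * d (-1) - a * N') (at s0)"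
    by (intro tendsto_intros d q) auto
  moreover have "E 1 s * (mellin_unit (\<lambda>x. f (1 * x)) (1 - s) - of_real 1 ^ k * a / (1 - s + of_nat k)) +
      E (-1) s * (mellin_unit (\<lambda>x. f (-1 * x)) (1 - s) - of_real (-1) ^ k * a / (1 - s + of_nat k)) - a * (N s / (s - s0)) = near_part s" for s
  proof -
    have "1 - s + of_nat k = - (s - s0)" by (simp add: s0)
    moreover have "e1 * (m1 - 1 * a / (- z)) + e2 * (m2 - u * a / (- z)) - a * ((e1 + u * e2) / z) = e1 * m1 + e2 * m2"
      for e1 e2 m1 m2 u z :: complex by (simp add: algebra_simps add_divide_distrib)
    ultimately show ?thesis by (simp only: N_def near_part_def of_real_1 of_real_minus power_one)
  qed
  ultimately show ?thesis by auto
qed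

lemma far_part_tendsto_value:
  assumes "\<And>k. s0 \<noteq> 1 - 2 * lam - of_nat k"
  shows "(far_part \<longlongrightarrow> far_part s0) (at s0)"
proof -
  have "2 * lam - 1 + s0 \<notin> \<int>\<^sub>\<le>\<^sub>0"
  proof
    assume "2 * lam - 1 + s0 \<in> \<int>\<^sub>\<le>\<^sub>0"
    then obtain k where "2 * lam - 1 + s0 = - of_nat k" by (auto elim: nonpos_Ints_cases')
    then have "s0 = 1 - 2 * lam - of_nat k" by (simp add: algebra_simps eq_diff_eq)
    with assms show False by blast
  qed
  note an = mellin_unit_analytic[OF smooth_g this]
  have l: "((\<lambda>s. mellin_unit (\<lambda>x. g (\<eta> * x)) (2 * lam - 1 + s)) \<longlongrightarrow> mellin_unit (\<lambda>x. g (\<eta> * x)) (2 * lam - 1 + s0)) (at s0)" for \<eta>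
    by (rule isCont_tendsto_compose[OF analytic_at_imp_isCont[OF an]]) (intro tendsto_intros)
  show ?thesis unfolding far_part_def[abs_def] by (intro tendsto_intros l) auto
qed

text \<open>The factor \<open>(- 1) ^ k\<close> accompanies \<open>c 1\<close> because the positive
  half-line of \<open>f\<close> is paired with \<open>g (- x)\<close>.\<close>

lemma far_part_tendsto_residue:
  fixes k :: nat
  defines "s0 \<equiv> 1 - 2 * lam - of_nat k"
  shows "((\<lambda>s. far_part s * (s - s0)) \<longlongrightarrow>
     nderiv k g 0 / fact k * (c 1 * (- 1) ^ k * E 1 s0 + c (-1) * E (-1) s0)) (at s0)"
proof -
  have fl: "filterlim (\<lambda>s. 2 * lam - 1 + s) (at (- of_nat k)) (at s0)"
    using filterlim_at_affine[of 1 "2 * lam - 1" s0] by (simp add: s0_def)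
  have l: "((\<lambda>s. mellin_unit (\<lambda>x. g (\<eta> * x)) (2 * lam - 1 + s) * (s - s0)) \<longlongrightarrow> of_real \<eta> ^ k * nderiv k g 0 / fact k) (at s0)" for \<eta>
  proof -
    have "((\<lambda>s. mellin_unit (\<lambda>x. g (\<eta> * x)) (2 * lam - 1 + s) * (2 * lam - 1 + s + of_nat k)) \<longlongrightarrow> nderiv k (\<lambda>x. g (\<eta> * x)) 0 / fact k) (at s0)"
      by (rule filterlim_compose[OF mellin_unit_tendsto_residue[OF smooth_g] fl])
    moreover have "2 * lam - 1 + s + of_nat k = s - s0" for s by (simp add: s0_def)
    moreover have "nderiv k (\<lambda>x. g (\<eta> * x)) 0 = of_real \<eta> ^ k * nderiv k g 0"
      by (subst smooth_comp_scale(2)[OF sg]) simp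
    ultimately show ?thesis by simp
  qed
  have "((\<lambda>s. E 1 s * (c 1 * (mellin_unit (\<lambda>x. g (- 1 * x)) (2 * lam - 1 + s) * (s - s0))) +
     E (-1) s * (c (-1) * (mellin_unit (\<lambda>x. g (- (- 1) * x)) (2 * lam - 1 + s) * (s - s0)))) \<longlongrightarrow>
     E 1 s0 * (c 1 * (of_real (- 1) ^ k * nderiv k g 0 / fact k)) + E (-1) s0 * (c (-1) * (of_real (- (- 1)) ^ k * nderiv k g 0 / fact k))) (at s0)"
    by (intro tendsto_intros l) auto
  then show ?thesis by (simp add: far_part_def algebra_simps)
qed

private lemma powr_tendsto: "((\<lambda>s. complex_of_real (2 * pi) powr (- s)) \<longlongrightarrow> of_real (2 * pi) powr (- s0)) (at s0)"
  using pi_gt_zero by (intro tendsto_intros) (auto simp: complex_nonpos_Reals_iff not_le[symmetric])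

private lemma Gamma_tendsto: "s0 \<notin> \<int>\<^sub>\<le>\<^sub>0 \<Longrightarrow> (Gamma \<longlongrightarrow> (Gamma s0 :: complex)) (at s0)"
  unfolding isCont_def[symmetric] by (intro continuous_intros) simp_all

private lemma Gamma_tendsto_residue: "((\<lambda>s. Gamma s * (s + of_nat k)) \<longlongrightarrow> (- 1) ^ k / fact k) (at (- of_nat k :: complex))"
  using Gamma_residues[of k] by simp

lemma dual_pair_tendsto:
  assumes "s0 \<notin> \<int>\<^sub>\<le>\<^sub>0" "\<And>k. s0 \<noteq> 1 - 2 * lam - of_nat k"
  obtains L where "(dual_pair lam c f g \<epsilon> \<longlongrightarrow> L) (at s0)"
proof -
  obtain L1 where "(near_part \<longlongrightarrow> L1) (at s0)" using near_part_tendsto by blast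
  then have "((\<lambda>s. of_real (2 * pi) powr (- s) * Gamma s * (near_part s + far_part s)) \<longlongrightarrow>
     of_real (2 * pi) powr (- s0) * Gamma s0 * (L1 + far_part s0)) (at s0)"
    by (intro tendsto_mult tendsto_add powr_tendsto Gamma_tendsto assms far_part_tendsto_value)
  then show ?thesis unfolding dual_pair_parts[symmetric] by (rule that)
qed

lemma dual_pair_residue_at_far:
  fixes k :: nat
  defines "s0 \<equiv> 1 - 2 * lam - of_nat k"
  assumes "s0 \<notin> \<int>\<^sub>\<le>\<^sub>0"
  shows "((\<lambda>s. dual_pair lam c f g \<epsilon> s * (s - s0)) \<longlongrightarrow> of_real (2 * pi) powr (- s0) * Gamma s0 *
     (nderiv k g 0 / fact k * (c 1 * (- 1) ^ k * E 1 s0 + c (-1) * E (-1) s0))) (at s0)"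
proof -
  obtain L1 where L1: "(near_part \<longlongrightarrow> L1) (at s0)" using near_part_tendsto by blast
  have "((\<lambda>s. of_real (2 * pi) powr (- s) * Gamma s * (near_part s * (s - s0) + far_part s * (s - s0))) \<longlongrightarrow>
     of_real (2 * pi) powr (- s0) * Gamma s0 * (L1 * (s0 - s0) +
     nderiv k g 0 / fact k * (c 1 * (- 1) ^ k * E 1 s0 + c (-1) * E (-1) s0))) (at s0)"
    unfolding s0_def
    by (intro tendsto_mult tendsto_add powr_tendsto Gamma_tendsto assms(2)[unfolded s0_def] far_part_tendsto_residue L1[unfolded s0_def] tendsto_diff tendsto_ident_at tendsto_const)
  then show ?thesis by (simp add: dual_pair_parts algebra_simps)
qed

text \<open>Here only \<open>Gamma\<close> is singular: \<open>far_part\<close> is regular by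
  assumption, and \<open>near_part\<close> because \<open>1 - s = k + 1\<close> is not a pole of
  \<open>mellin_unit\<close>.\<close>

lemma dual_pair_residue_at_Gamma_pole:
  fixes k :: nat
  assumes "\<And>j. - of_nat k \<noteq> 1 - 2 * lam - of_nat j"
  shows "((\<lambda>s. dual_pair lam c f g \<epsilon> s * (s + of_nat k)) \<longlongrightarrow> of_real (2 * pi) powr (of_nat k) * ((- 1) ^ k / fact k) *
     (E 1 (- of_nat k) * zeta_pair lam c f g 1 (of_nat k + 1) + E (-1) (- of_nat k) * zeta_pair lam c f g (-1) (of_nat k + 1))) (at (- of_nat k))"
proof -
  let ?s = "- of_nat k :: complex"
  have n: "1 - ?s \<notin> \<int>\<^sub>\<le>\<^sub>0" by (rule not_nonpos_IntI) simp
  have "((\<lambda>s. of_real (2 * pi) powr (- s) * (Gamma s * (s + of_nat k)) * (near_part s + far_part s)) \<longlongrightarrow>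
     of_real (2 * pi) powr (- ?s) * ((- 1) ^ k / fact k) * (near_part ?s + far_part ?s)) (at ?s)"
    by (intro tendsto_mult tendsto_add powr_tendsto Gamma_tendsto_residue near_part_tendsto_value far_part_tendsto_value n assms)
  moreover have "near_part ?s + far_part ?s = E 1 ?s * zeta_pair lam c f g 1 (of_nat k + 1) + E (-1) ?s * zeta_pair lam c f g (-1) (of_nat k + 1)"
  proof -
    have "1 - ?s = of_nat k + 1" "2 * lam - (of_nat k + 1) = 2 * lam - 1 + ?s" by simp_all
    then show ?thesis unfolding near_part_def far_part_def zeta_pair_def by (simp only:) (simp add: algebra_simps)
  qed
  ultimately show ?thesis by (simp add: dual_pair_parts mult_ac)
qed

text \<open>\<open>Gamma\<close> and \<open>far_part\<close> have at most simple poles and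
  \<open>near_part\<close> has none, so two factors \<open>s - s0\<close> suffice
  everywhere.\<close>

lemma dual_pair_tendsto_double: "\<exists>L. ((\<lambda>s. dual_pair lam c f g \<epsilon> s * (s - s0) ^ 2) \<longlongrightarrow> L) (at s0)"
proof -
  obtain L1 where L1: "(near_part \<longlongrightarrow> L1) (at s0)" using near_part_tendsto by blast
  have G: "\<exists>L. ((\<lambda>s. Gamma s * (s - s0)) \<longlongrightarrow> L) (at s0)"
  proof (cases "s0 \<in> \<int>\<^sub>\<le>\<^sub>0")
    case True
    then obtain k where "s0 = - of_nat k" by (auto elim: nonpos_Ints_cases')
    then show ?thesis using Gamma_tendsto_residue[of k] by auto
  next
    case False
    then have "((\<lambda>s. Gamma s * (s - s0)) \<longlongrightarrow> Gamma s0 * (s0 - s0)) (at s0)"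
      by (intro tendsto_mult Gamma_tendsto tendsto_diff tendsto_ident_at tendsto_const)
    then show ?thesis by blast
  qed
  have F: "\<exists>L. ((\<lambda>s. far_part s * (s - s0)) \<longlongrightarrow> L) (at s0)"
  proof (cases "\<exists>k. s0 = 1 - 2 * lam - of_nat k")
    case True
    then show ?thesis using far_part_tendsto_residue by blast
  next
    case False
    then have "((\<lambda>s. far_part s * (s - s0)) \<longlongrightarrow> far_part s0 * (s0 - s0)) (at s0)"
      by (intro tendsto_mult far_part_tendsto_value tendsto_diff tendsto_ident_at tendsto_const) auto
    then show ?thesis by blast
  qed
  obtain G1 where G1: "((\<lambda>s. Gamma s * (s - s0)) \<longlongrightarrow> G1) (at s0)" using G by blast
  obtain F1 where F1: "((\<lambda>s. far_part s * (s - s0)) \<longlongrightarrow> F1) (at s0)" using F by blast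
  have "((\<lambda>s. of_real (2 * pi) powr (- s) * (Gamma s * (s - s0)) * (near_part s * (s - s0) + far_part s * (s - s0))) \<longlongrightarrow>
     of_real (2 * pi) powr (- s0) * G1 * (L1 * (s0 - s0) + F1)) (at s0)"
    by (intro tendsto_mult tendsto_add powr_tendsto G1 L1 F1 tendsto_diff tendsto_ident_at tendsto_const)
  moreover have "of_real (2 * pi) powr (- s) * (Gamma s * (s - s0)) * (near_part s * (s - s0) + far_part s * (s - s0)) =
     dual_pair lam c f g \<epsilon> s * (s - s0) ^ 2" for s
    unfolding dual_pair_parts by (simp add: algebra_simps power2_eq_square)
  ultimately show ?thesis by auto
qed

end

lemma double_pointsI:
  assumes "s \<in> \<int>\<^sub>\<le>\<^sub>0" "s = 1 - 2 * lam - of_nat k"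
  shows "s \<in> double_points lam"
proof -
  obtain j where j: "s = - of_nat j" using assms(1) by (auto elim: nonpos_Ints_cases')
  \<comment> \<open>Comparing \<open>- j\<close> with \<open>1 - 2 * lam - k\<close> forces this
    \<open>q\<close>. The index \<open>i\<close> below is then the minimum of \<open>j\<close> and
    \<open>k\<close>, hence a natural number.\<close>
  define q where "q = 1 + int j - int k"
  have "2 * lam = of_int q" using assms(2) j by (simp add: q_def algebra_simps)
  then have l: "lam = of_int q / 2" by (simp add: field_simps)
  define i where "i = nat (min 0 (- (q - 1)) + int j)"
  have "min 0 (- (q - 1)) - int i = - int j" unfolding i_def q_def by auto
  then have "of_int (min 0 (- (q - 1)) - int i) = (of_int (- int j) :: complex)" by (rule arg_cong)
  then have "s = of_int (min 0 (- (q - 1))) - of_nat i" using j by simp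
  then show ?thesis unfolding double_points_def using l by blast
qed

lemma f_inf_ext_eq:
  assumes "smooth g" "\<And>x. x \<noteq> 0 \<Longrightarrow> g x = f_inf lam l f x"
  shows "f_inf_ext lam l f = g"
proof -
  have "(g \<longlongrightarrow> g 0) (at 0)" using smooth_isCont[OF assms(1)] by (simp add: isCont_def)
  moreover have "\<forall>\<^sub>F x in at 0. g x = f_inf lam l f x" using assms(2) by (auto simp: eventually_at_filter)
  ultimately have "(f_inf lam l f \<longlongrightarrow> g 0) (at 0)" by (rule Lim_transform_eventually)
  then have "Lim (at 0) (f_inf lam l f) = g 0" by (intro tendsto_Lim) auto
  then show ?thesis using assms(2) by (auto simp: f_inf_ext_def fun_eq_iff)
qed

context
  fixes lam c f g and \<epsilon> :: real
  assumes p: "inversion_pair lam c f g" and \<epsilon>: "\<epsilon> \<in> {1,-1}"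
begin

private lemma mer: "dual_pair lam c f g \<epsilon> meromorphic_on {s}"
  using dual_pair_meromorphic[OF p] by (rule meromorphic_on_subset) auto

private lemma iso: "isolated_singularity_at (dual_pair lam c f g \<epsilon>) s"
  using mer meromorphic_at_iff by blast

lemma dual_zeta_nicely_meromorphic: "dual_zeta lam \<epsilon> f nicely_meromorphic_on UNIV"
  unfolding dual_zeta_eq(1)[OF p \<epsilon>] by (rule remove_sings_nicely_meromorphic[OF dual_pair_meromorphic[OF p]])

lemma dual_zeta_poles:
  assumes "is_pole (dual_zeta lam \<epsilon> f) s"
  shows "s \<in> \<int>\<^sub>\<le>\<^sub>0 \<or> (\<exists>k::nat. s = 1 - 2 * lam - of_nat k)"
proof (rule ccontr)
  assume "\<not> ?thesis"
  then obtain L where "(dual_pair lam c f g \<epsilon> \<longlongrightarrow> L) (at s)" using dual_pair_tendsto[OF p \<epsilon>] by blast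
  moreover have "is_pole (dual_pair lam c f g \<epsilon>) s" using assms iso by (simp add: dual_zeta_eq(1)[OF p \<epsilon>])
  ultimately show False
    using not_tendsto_and_filterlim_at_infinity[of "at s"] by (auto simp: is_pole_def)
qed

lemma zorder_dual_zeta:
  assumes pole: "is_pole (dual_zeta lam \<epsilon> f) s"
  shows "zorder (dual_zeta lam \<epsilon> f) s \<ge> - 2"
    and "\<not> (s \<in> \<int>\<^sub>\<le>\<^sub>0 \<and> (\<exists>k::nat. s = 1 - 2 * lam - of_nat k)) \<Longrightarrow> zorder (dual_zeta lam \<epsilon> f) s \<ge> - 1"
proof -
  have z: "zorder (dual_zeta lam \<epsilon> f) s = zorder (dual_pair lam c f g \<epsilon>) s"
    using iso by (simp add: dual_zeta_eq(1)[OF p \<epsilon>])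
  have pole': "is_pole (dual_pair lam c f g \<epsilon>) s" using pole iso by (simp add: dual_zeta_eq(1)[OF p \<epsilon>])
  obtain L where "((\<lambda>u. dual_pair lam c f g \<epsilon> u * (u - s) ^ 2) \<longlongrightarrow> L) (at s)"
    using dual_pair_tendsto_double[OF p \<epsilon>] by blast
  from zorder_ge_of_tendsto[OF mer pole' this] show "zorder (dual_zeta lam \<epsilon> f) s \<ge> - 2" using z by simp
  assume n: "\<not> (s \<in> \<int>\<^sub>\<le>\<^sub>0 \<and> (\<exists>k::nat. s = 1 - 2 * lam - of_nat k))"
  have "\<exists>L. ((\<lambda>u. dual_pair lam c f g \<epsilon> u * (u - s) ^ 1) \<longlongrightarrow> L) (at s)"
  proof (cases "s \<in> \<int>\<^sub>\<le>\<^sub>0")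
    case True
    then obtain k where k: "s = - of_nat k" by (auto elim: nonpos_Ints_cases')
    have "- of_nat k \<noteq> 1 - 2 * lam - of_nat j" for j using n True k by metis
    from dual_pair_residue_at_Gamma_pole[OF p \<epsilon> this] show ?thesis unfolding k by auto
  next
    case False
    then obtain k where k: "s = 1 - 2 * lam - of_nat k" using dual_zeta_poles[OF pole] by blast
    from dual_pair_residue_at_far[OF p \<epsilon>, of k] show ?thesis using False unfolding k by auto
  qed
  then obtain L where "((\<lambda>u. dual_pair lam c f g \<epsilon> u * (u - s) ^ 1) \<longlongrightarrow> L) (at s)" by blast
  from zorder_ge_of_tendsto[OF mer pole' this] show "zorder (dual_zeta lam \<epsilon> f) s \<ge> - 1" using z by simp
qed

text \<open>The zeta functions are known to agree with \<open>dual_pair\<close> and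
  \<open>zeta_pair\<close> only on punctured neighbourhoods. The right side is continuous at
  \<open>s\<close>, so it is the limit of the dual zeta function there, which the normalisation
  turns into its value.\<close>

lemma dual_zeta_functional_equation:
  assumes s: "s \<notin> \<int>\<^sub>\<le>\<^sub>0" and np: "\<And>\<eta>. \<eta> \<in> {1,-1} \<Longrightarrow> \<not> is_pole (local_zeta lam \<eta> f) (1 - s)"
  shows "dual_zeta lam \<epsilon> f s = of_real (2 * pi) powr (- s) * Gamma s *
     (exp (of_real \<epsilon> * of_real pi * \<i> * s / 2) * local_zeta lam 1 f (1 - s) +
      exp (- of_real \<epsilon> * of_real pi * \<i> * s / 2) * local_zeta lam (-1) f (1 - s))"
proof -
  have fl: "filterlim (\<lambda>u. 1 - u) (at (1 - s)) (at s)" using filterlim_at_affine[of "-1" 1 s] by simp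
  have lim: "((\<lambda>u. local_zeta lam \<eta> f (1 - u)) \<longlongrightarrow> local_zeta lam \<eta> f (1 - s)) (at s)"
    and ev: "\<forall>\<^sub>F u in at s. local_zeta lam \<eta> f (1 - u) = zeta_pair lam c f g \<eta> (1 - u)" if \<eta>: "\<eta> \<in> {1,-1}" for \<eta>
  proof -
    note zm = zeta_pair_meromorphic[OF p, of \<eta>]
    have "local_zeta lam \<eta> f nicely_meromorphic_on UNIV"
      unfolding local_zeta_eq[OF p \<eta>] by (rule remove_sings_nicely_meromorphic[OF zm])
    then have "local_zeta lam \<eta> f analytic_on {1 - s}"
      using np[OF \<eta>] by (intro nicely_meromorphic_on_imp_analytic_at) auto
    then have "(local_zeta lam \<eta> f \<longlongrightarrow> local_zeta lam \<eta> f (1 - s)) (at (1 - s))"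
      using analytic_at_imp_isCont isCont_def by blast
    then show "((\<lambda>u. local_zeta lam \<eta> f (1 - u)) \<longlongrightarrow> local_zeta lam \<eta> f (1 - s)) (at s)"
      by (rule filterlim_compose[OF _ fl])
    have "zeta_pair lam c f g \<eta> meromorphic_on {1 - s}" using zm by (rule meromorphic_on_subset) auto
    then have "isolated_singularity_at (zeta_pair lam c f g \<eta>) (1 - s)" using meromorphic_at_iff by blast
    then have "\<forall>\<^sub>F u in at (1 - s). local_zeta lam \<eta> f u = zeta_pair lam c f g \<eta> u"
      unfolding local_zeta_eq[OF p \<eta>] by (rule eventually_remove_sings_eq_at)
    then show "\<forall>\<^sub>F u in at s. local_zeta lam \<eta> f (1 - u) = zeta_pair lam c f g \<eta> (1 - u)"
      using fl by (rule eventually_compose_filterlim)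
  qed
  let ?R = "\<lambda>u. of_real (2 * pi) powr (- u) * Gamma u *
     (exp (of_real \<epsilon> * of_real pi * \<i> * u / 2) * local_zeta lam 1 f (1 - u) +
      exp (- of_real \<epsilon> * of_real pi * \<i> * u / 2) * local_zeta lam (-1) f (1 - u))"
  have G: "(Gamma \<longlongrightarrow> Gamma s) (at s)"
    unfolding isCont_def[symmetric] using s by (intro continuous_intros) simp_all
  have P: "((\<lambda>u. complex_of_real (2 * pi) powr (- u)) \<longlongrightarrow> of_real (2 * pi) powr (- s)) (at s)"
    using pi_gt_zero by (intro tendsto_intros) (auto simp: complex_nonpos_Reals_iff not_le[symmetric])
  have E: "((\<lambda>u. exp (a * u / 2)) \<longlongrightarrow> exp (a * s / 2)) (at s)" for a by (intro tendsto_intros) auto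
  have "(?R \<longlongrightarrow> ?R s) (at s)"
    by (intro tendsto_mult[OF tendsto_mult[OF P G]] tendsto_add tendsto_mult E lim) auto
  moreover have "\<forall>\<^sub>F u in at s. ?R u = dual_zeta lam \<epsilon> f u"
  proof -
    have "\<forall>\<^sub>F u in at s. dual_zeta lam \<epsilon> f u = dual_pair lam c f g \<epsilon> u"
      unfolding dual_zeta_eq(1)[OF p \<epsilon>] by (rule eventually_remove_sings_eq_at[OF iso])
    moreover have "\<forall>\<^sub>F u in at s. local_zeta lam 1 f (1 - u) = zeta_pair lam c f g 1 (1 - u)" by (rule ev) simp
    moreover have "\<forall>\<^sub>F u in at s. local_zeta lam (-1) f (1 - u) = zeta_pair lam c f g (-1) (1 - u)" by (rule ev) simp
    ultimately show ?thesis by eventually_elim (simp only: dual_pair_def)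
  qed
  ultimately have "(dual_zeta lam \<epsilon> f \<longlongrightarrow> ?R s) (at s)" by (rule Lim_transform_eventually)
  then show ?thesis by (rule nicely_meromorphic_tendsto(1)[OF dual_zeta_nicely_meromorphic UNIV_I])
qed

lemma residue_dual_zeta_Gamma_pole:
  fixes k :: nat
  assumes n: "\<And>j. - of_nat k \<noteq> 1 - 2 * lam - of_nat j"
  shows "residue (dual_zeta lam \<epsilon> f) (- of_nat k) = of_real \<epsilon> ^ k * fourier_deriv0 lam f k / fact k"
proof -
  have "2 * lam - (of_nat k + 1) \<notin> \<int>\<^sub>\<le>\<^sub>0"
  proof
    assume "2 * lam - (of_nat k + 1) \<in> \<int>\<^sub>\<le>\<^sub>0"
    then obtain j where "2 * lam - (of_nat k + 1) = - of_nat j" by (auto elim: nonpos_Ints_cases')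
    then have "- of_nat k = 1 - 2 * lam - of_nat j" by (simp add: algebra_simps)
    with n show False by blast
  qed
  moreover have "complex_of_nat k + 1 \<notin> \<int>\<^sub>\<le>\<^sub>0" by (rule not_nonpos_IntI) simp
  ultimately have lz: "local_zeta lam \<eta> f (of_nat k + 1) = zeta_pair lam c f g \<eta> (of_nat k + 1)" if "\<eta> \<in> {1,-1}" for \<eta>
    unfolding local_zeta_eq[OF p that] by (intro remove_sings_at_analytic zeta_pair_analytic[OF p])
  have E: "exp (of_real (\<epsilon> * \<eta>) * of_real pi * \<i> * (- of_nat k) / 2) = (of_real (- (\<epsilon> * \<eta>)) * \<i>) ^ k" if "\<eta> \<in> {1,-1}" for \<eta>
  proof -
    have "- (\<epsilon> * \<eta>) \<in> {1,-1}" using that \<epsilon> by auto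
    moreover have "of_real (\<epsilon> * \<eta>) * of_real pi * \<i> * (- of_nat k) / 2 = of_real (- (\<epsilon> * \<eta>)) * of_real pi * \<i> * of_nat k / 2" by simp
    ultimately show ?thesis by (simp only: exp_half_pi_of_nat)
  qed
  let ?Z = "\<lambda>\<eta>. zeta_pair lam c f g \<eta> (of_nat k + 1)"
  have "residue (dual_zeta lam \<epsilon> f) (- of_nat k) = residue (dual_pair lam c f g \<epsilon>) (- of_nat k)"
    using iso by (simp add: dual_zeta_eq(1)[OF p \<epsilon>])
  also have "\<dots> = of_real (2 * pi) powr (of_nat k) * ((- 1) ^ k / fact k) *
     (exp (of_real (\<epsilon> * 1) * of_real pi * \<i> * (- of_nat k) / 2) * ?Z 1 + exp (of_real (\<epsilon> * - 1) * of_real pi * \<i> * (- of_nat k) / 2) * ?Z (-1))"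
    using dual_pair_residue_at_Gamma_pole[OF p \<epsilon> n] by (intro residue_of_tendsto mer) simp
  also have "\<dots> = of_real (2 * pi) ^ k * ((- 1) ^ k / fact k) *
     ((of_real (- (\<epsilon> * 1)) * \<i>) ^ k * ?Z 1 + (of_real (- (\<epsilon> * -1)) * \<i>) ^ k * ?Z (-1))"
    using E[of 1] E[of "-1"] by (simp add: powr_nat')
  \<comment> \<open>The \<open>k\<close>-th powers of \<open>2 * pi\<close>, of the sign in the
    residue of \<open>Gamma\<close> and of the exponential factor are collected; their bases
    multiply to \<open>\<epsilon> * 2 * pi * \<i>\<close>, with a further sign on the negative
    half-line.\<close>
  also have "\<dots> = ((of_real (2 * pi) * (- 1) * (of_real (- (\<epsilon> * 1)) * \<i>)) ^ k * ?Z 1 +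
      (of_real (2 * pi) * (- 1) * (of_real (- (\<epsilon> * -1)) * \<i>)) ^ k * ?Z (-1)) / fact k"
    unfolding power_mult_distrib by (simp add: algebra_simps add_divide_distrib)
  also have "of_real (2 * pi) * (- 1) * (of_real (- (\<epsilon> * 1)) * \<i>) = of_real \<epsilon> * (2 * of_real pi * \<i>)" by simp
  also have "of_real (2 * pi) * (- 1) * (of_real (- (\<epsilon> * -1)) * \<i>) = of_real \<epsilon> * (2 * of_real pi * \<i>) * (- 1)" by simp
  also have "((of_real \<epsilon> * (2 * of_real pi * \<i>)) ^ k * ?Z 1 + (of_real \<epsilon> * (2 * of_real pi * \<i>) * (- 1)) ^ k * ?Z (-1)) / fact k =
      of_real \<epsilon> ^ k * ((2 * of_real pi * \<i>) ^ k * (?Z 1 + (- 1) ^ k * ?Z (-1))) / fact k"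
    unfolding power_mult_distrib[of "of_real \<epsilon>"] power_mult_distrib[of _ "- 1"] by (simp add: algebra_simps)
  finally show ?thesis unfolding fourier_deriv0_def using lz[of 1] lz[of "-1"] by simp
qed

lemma residue_dual_zeta_far:
  fixes k :: nat
  defines "s0 \<equiv> 1 - 2 * lam - of_nat k"
  assumes n: "s0 \<notin> \<int>\<^sub>\<le>\<^sub>0" and c: "c (-1) = 1"
  shows "residue (dual_zeta lam \<epsilon> f) s0 =
    of_real (2 * pi) powr (2 * lam + of_nat k - 1) * Gamma s0 * (nderiv k g 0 / fact k) * (of_real \<epsilon> * \<i>) powi (int k - 1) *
    (exp (of_real \<epsilon> * lam * of_real pi * \<i>) - c 1 * exp (- of_real \<epsilon> * lam * of_real pi * \<i>))"
proof -
  let ?e = "of_real \<epsilon> * \<i>"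
  have ee: "1 / ?e = - ?e" using \<epsilon> by auto
  have nz: "?e \<noteq> 0" using \<epsilon> by auto
  \<comment> \<open>The exponent is \<open>- 1\<close> for \<open>k = 0\<close>, so the integer
    power is split and the reciprocal replaced by \<open>- ?e\<close>.\<close>
  have pw: "?e powi (int k - 1) = ?e ^ k * (- ?e)"
  proof -
    have "?e powi (int k - 1) = ?e ^ k * (1 / ?e)" using nz by (simp add: power_int_diff)
    then show ?thesis unfolding ee .
  qed
  have E: "exp (of_real (\<epsilon> * \<eta>) * of_real pi * \<i> * s0 / 2) =
     (of_real (\<epsilon> * \<eta>) * \<i>) * (of_real (- (\<epsilon> * \<eta>)) * \<i>) ^ k * exp (- (of_real (\<epsilon> * \<eta>) * lam * of_real pi * \<i>))" if "\<eta> \<in> {1,-1}" for \<eta>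
  proof -
    have m: "\<epsilon> * \<eta> \<in> {1,-1}" "- (\<epsilon> * \<eta>) \<in> {1,-1}" using that \<epsilon> by auto
    \<comment> \<open>The summands 1, \<open>- k\<close> and \<open>- 2 * lam\<close> of
      \<open>s0\<close> are separated: the first two give powers of the imaginary unit, the third
      the exponential in \<open>lam\<close>.\<close>
    have "of_real (\<epsilon> * \<eta>) * of_real pi * \<i> * s0 / 2 = of_real (\<epsilon> * \<eta>) * of_real pi * \<i> * of_nat 1 / 2 +
       of_real (- (\<epsilon> * \<eta>)) * of_real pi * \<i> * of_nat k / 2 + (- (of_real (\<epsilon> * \<eta>) * lam * of_real pi * \<i>))"
      by (simp add: s0_def algebra_simps add_divide_distrib diff_divide_distrib)
    then show ?thesis by (simp only: exp_add exp_half_pi_of_nat[OF m(1)] exp_half_pi_of_nat[OF m(2)] power_one_right)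
  qed
  have alg: "P * G * (N * (d * (- q * y) + 1 * (q * x))) = P * G * N * q * (x - d * y)" for P G N d q x y :: complex
    by (simp add: algebra_simps)
  have "residue (dual_zeta lam \<epsilon> f) s0 = residue (dual_pair lam c f g \<epsilon>) s0"
    using iso by (simp add: dual_zeta_eq(1)[OF p \<epsilon>])
  also have "\<dots> = of_real (2 * pi) powr (- s0) * Gamma s0 *
     (nderiv k g 0 / fact k * (c 1 * ((- 1) ^ k * exp (of_real (\<epsilon> * 1) * of_real pi * \<i> * s0 / 2)) +
       c (-1) * exp (of_real (\<epsilon> * - 1) * of_real pi * \<i> * s0 / 2)))"
    using dual_pair_residue_at_far[OF p \<epsilon>, of k] n unfolding s0_def mult.assoc[of "c 1"] by (intro residue_of_tendsto mer) simp
  also have "(- 1) ^ k * exp (of_real (\<epsilon> * 1) * of_real pi * \<i> * s0 / 2) = - (?e ^ k * (- ?e)) * exp (- of_real \<epsilon> * lam * of_real pi * \<i>)"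
  proof -
    have "(- 1) ^ k * (of_real (- (\<epsilon> * 1)) * \<i>) ^ k = ?e ^ k" unfolding power_mult_distrib[symmetric] by simp
    then show ?thesis unfolding E[OF insertI1] by (simp add: mult_ac)
  qed
  also have "exp (of_real (\<epsilon> * - 1) * of_real pi * \<i> * s0 / 2) = (?e ^ k * (- ?e)) * exp (of_real \<epsilon> * lam * of_real pi * \<i>)"
    using E[of "-1"] by simp
  also have "- s0 = 2 * lam + of_nat k - 1" by (simp add: s0_def)
  finally show ?thesis unfolding pw c alg .
qed

end

theorem theorem2p14:
  fixes lam :: complex and l :: int and f :: "real \<Rightarrow> complex"
  assumes "f \<in> Vspace lam l"
  shows
    "((\<forall>\<epsilon>\<in>{1, -1}.
        dual_zeta lam \<epsilon> f nicely_meromorphic_on UNIV \<and>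
        (\<exists>c. \<forall>s. Re s > c \<longrightarrow>
           set_integrable lborel {0<..} (mellin_integrand \<epsilon> (fourier lam f) s) \<and>
           dual_zeta lam \<epsilon> f s = mellin \<epsilon> (fourier lam f) s) \<and>
        (\<forall>s. is_pole (dual_zeta lam \<epsilon> f) s \<longrightarrow>
           (\<exists>k::nat. s = - of_nat k \<or> s = 1 - 2 * lam - of_nat k)))) \<and>
     (\<forall>s. s \<notin> \<int>\<^sub>\<le>\<^sub>0 \<and> \<not> is_pole (local_zeta lam 1 f) (1 - s) \<and> \<not> is_pole (local_zeta lam (-1) f) (1 - s) \<longrightarrow>
        dual_zeta lam 1 f s = complex_of_real (2 * pi) powr (- s) * Gamma s *
          (exp (of_real pi * \<i> * s / 2) * local_zeta lam 1 f (1 - s) +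
           exp (- of_real pi * \<i> * s / 2) * local_zeta lam (-1) f (1 - s)) \<and>
        dual_zeta lam (-1) f s = complex_of_real (2 * pi) powr (- s) * Gamma s *
          (exp (- of_real pi * \<i> * s / 2) * local_zeta lam 1 f (1 - s) +
           exp (of_real pi * \<i> * s / 2) * local_zeta lam (-1) f (1 - s))) \<and>
     ((\<forall>q::int. lam \<noteq> of_int q / 2) \<longrightarrow>
        (\<forall>\<epsilon>\<in>{1, -1}. \<forall>s. is_pole (dual_zeta lam \<epsilon> f) s \<longrightarrow> zorder (dual_zeta lam \<epsilon> f) s \<ge> -1)) \<and>
     (\<forall>q::int. lam = of_int q / 2 \<longrightarrow>
        (\<forall>\<epsilon>\<in>{1, -1}. \<forall>s. is_pole (dual_zeta lam \<epsilon> f) s \<longrightarrow>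
           (if \<exists>k::nat. s = of_int (min 0 (- (q - 1))) - of_nat k
            then zorder (dual_zeta lam \<epsilon> f) s \<ge> -2
            else zorder (dual_zeta lam \<epsilon> f) s \<ge> -1))) \<and>
     (\<forall>\<epsilon>\<in>{1, -1}. \<forall>k::nat. - of_nat k \<notin> double_points lam \<longrightarrow>
        residue (dual_zeta lam \<epsilon> f) (- of_nat k) =
          of_real \<epsilon> ^ k * fourier_deriv0 lam f k / fact k) \<and>
     (\<forall>\<epsilon>\<in>{1, -1}. \<forall>k::nat. 1 - 2 * lam - of_nat k \<notin> double_points lam \<longrightarrow>
        residue (dual_zeta lam \<epsilon> f) (1 - 2 * lam - of_nat k) =
          complex_of_real (2 * pi) powr (2 * lam + of_nat k - 1) * Gamma (1 - 2 * lam - of_nat k) *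
          (nderiv k (f_inf_ext lam l f) 0 / fact k) *
          (of_real \<epsilon> * \<i>) powi (int k - 1) *
          (exp (of_real \<epsilon> * lam * of_real pi * \<i>) - \<i> powi (- l) * exp (- of_real \<epsilon> * lam * of_real pi * \<i>)))"
proof -
  obtain g where f: "smooth f" and g: "smooth g" and fg: "\<And>x. x \<noteq> 0 \<Longrightarrow> g x = f_inf lam l f x"
    using assms by (auto simp: Vspace_def)
  define c where "c = (\<lambda>\<epsilon>::real. if \<epsilon> > 0 then \<i> powi (- l) else 1)"
  have p: "inversion_pair lam c f g" unfolding c_def by (rule inversion_pair_Vspace[OF f g fg])
  have c: "c 1 = \<i> powi (- l)" "c (-1) = 1" by (simp_all add: c_def)
  have ext: "f_inf_ext lam l f = g" by (rule f_inf_ext_eq[OF g fg])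
  have poles: "\<exists>k::nat. s = - of_nat k \<or> s = 1 - 2 * lam - of_nat k"
    if "\<epsilon> \<in> {1,-1}" "is_pole (dual_zeta lam \<epsilon> f) s" for \<epsilon> s
    using dual_zeta_poles[OF p that] by (auto elim: nonpos_Ints_cases')
  have fe: "dual_zeta lam 1 f s = complex_of_real (2 * pi) powr (- s) * Gamma s *
          (exp (of_real pi * \<i> * s / 2) * local_zeta lam 1 f (1 - s) +
           exp (- of_real pi * \<i> * s / 2) * local_zeta lam (-1) f (1 - s)) \<and>
        dual_zeta lam (-1) f s = complex_of_real (2 * pi) powr (- s) * Gamma s *
          (exp (- of_real pi * \<i> * s / 2) * local_zeta lam 1 f (1 - s) +
           exp (of_real pi * \<i> * s / 2) * local_zeta lam (-1) f (1 - s))"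
    if "s \<notin> \<int>\<^sub>\<le>\<^sub>0 \<and> \<not> is_pole (local_zeta lam 1 f) (1 - s) \<and> \<not> is_pole (local_zeta lam (-1) f) (1 - s)" for s
    using dual_zeta_functional_equation[OF p, of 1 s] dual_zeta_functional_equation[OF p, of "-1" s] that by auto
  have ord: "zorder (dual_zeta lam \<epsilon> f) s \<ge> -1"
    if "\<epsilon> \<in> {1,-1}" "is_pole (dual_zeta lam \<epsilon> f) s" "s \<notin> double_points lam" for \<epsilon> s
    using zorder_dual_zeta(2)[OF p that(1,2)] double_pointsI that(3) by blast
  have ordq: "if \<exists>k::nat. s = of_int (min 0 (- (q - 1))) - of_nat k
            then zorder (dual_zeta lam \<epsilon> f) s \<ge> -2
            else zorder (dual_zeta lam \<epsilon> f) s \<ge> -1"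
    if "lam = of_int q / 2" "\<epsilon> \<in> {1,-1}" "is_pole (dual_zeta lam \<epsilon> f) s" for q :: int and \<epsilon> s
  proof (cases "\<exists>k::nat. s = of_int (min 0 (- (q - 1))) - of_nat k")
    case True
    then show ?thesis using zorder_dual_zeta(1)[OF p that(2,3)] by (simp only: if_True)
  next
    case False
    \<comment> \<open>\<open>lam\<close> determines \<open>q\<close>, so membership in
      \<open>double_points lam\<close> could come only from this \<open>q\<close>.\<close>
    then have "s \<notin> double_points lam" using that(1) by (auto simp: double_points_def)
    from ord[OF that(2,3) this] show ?thesis using False by (simp only: if_False)
  qed
  have "s \<notin> double_points lam" if "\<forall>q::int. lam \<noteq> of_int q / 2" for s
    using that by (auto simp: double_points_def)
  moreover have "residue (dual_zeta lam \<epsilon> f) (- of_nat k) = of_real \<epsilon> ^ k * fourier_deriv0 lam f k / fact k"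
    if "\<epsilon> \<in> {1,-1}" "- of_nat k \<notin> double_points lam" for \<epsilon> k
    using that double_pointsI[OF minus_of_nat_in_nonpos_Ints, of k lam]
    by (intro residue_dual_zeta_Gamma_pole[OF p]) blast+
  moreover have "residue (dual_zeta lam \<epsilon> f) (1 - 2 * lam - of_nat k) =
          complex_of_real (2 * pi) powr (2 * lam + of_nat k - 1) * Gamma (1 - 2 * lam - of_nat k) *
          (nderiv k (f_inf_ext lam l f) 0 / fact k) * (of_real \<epsilon> * \<i>) powi (int k - 1) *
          (exp (of_real \<epsilon> * lam * of_real pi * \<i>) - \<i> powi (- l) * exp (- of_real \<epsilon> * lam * of_real pi * \<i>))"
    if "\<epsilon> \<in> {1,-1}" "1 - 2 * lam - of_nat k \<notin> double_points lam" for \<epsilon> k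
    using that double_pointsI[of "1 - 2 * lam - of_nat k" lam k] residue_dual_zeta_far[OF p that(1), of k]
    unfolding ext c by auto
  ultimately show ?thesis
    using dual_zeta_nicely_meromorphic[OF p] dual_zeta_eq(2)[OF p] poles fe ord
    by (intro conjI ballI allI impI) ((rule ordq; assumption) | simp)+
qed

end
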